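(* Let $N\ge1$ be an integer and suppose $a>\max\{0,2-N\}$. Let $h_a(x,y;t)$ be the $a$-deformed heat kernel on $\mathbb{R}^N$. Then for all $x,z\in\mathbb{R}^N$ and $t,s>0$, $$c_a\int_{\mathbb{R}^N}h_a(x,y;t)\,h_a(y,z;s)\,\frac{dy}{|y|^{2-a}}=h_a(x,z;t+s).$$
   Context: Normalized I-Bessel function: for $\mu\in\mathbb{R}$ and $w\in\mathbb{C}$, $\tilde I_\mu(w)=\sum_{j=0}^\infty\frac{(w/2)^{2j}}{j!\,\Gamma(\mu+j+1)}$ (with $1/\Gamma=0$ at the poles of $\Gamma$). Normalized Gegenbauer polynomials $\check C^\nu_m(t)$ are defined by the formal power series expansion $\frac{1-x^2}{(1-2tx+x^2)^{\nu+1}}=\sum_{m=0}^\infty\check C^\nu_m(t)x^m$. For $b>0$, $\nu\in\mathbb{R}$ with $1+b\nu>0$, $w\in\mathbb{C}$, $t\in[-1,1]$, $$\mathscr{I}(b,\nu,w,t):=\Gamma(b\nu+1)\sum_{m=0}^\infty\left(\frac w2\right)^{bm}\tilde I_{b(m+\nu)}(w)\,\check C^\nu_m(t),$$ where $(w/2)^s=(|w|/2)^se^{i\theta s}$ for $w=|w|e^{i\theta}$, $\theta\in(-\pi,\pi]$; the series converges absolutely and locally uniformly. For $a>\max\{0,2-N\}$ put $B_a(r\omega,s\mu)=\mathscr{I}\left(\frac2a,\frac{N-2}{2},\frac{2(rs)^{a/2}}{ai},\langle\omega,\mu\rangle\right)$ for $r,s\ge0$, $\omega,\mu\in S^{N-1}$,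 and $c_a=\left(\int_{\mathbb{R}^N}e^{-\frac1a|x|^a}\frac{dx}{|x|^{2-a}}\right)^{-1}$. The $a$-deformed heat kernel is $$h_a(x,y;t)=c_a\int_{\mathbb{R}^N}\overline{B_a(x,\xi)}\,B_a(y,\xi)\,e^{-\frac ta|\xi|^a}\frac{d\xi}{|\xi|^{2-a}}\qquad(x,y\in\mathbb{R}^N,\ t>0),$$ an absolutely convergent integral. *)

theory Defs
  imports "HOL-Analysis.Analysis" "HOL-Computational_Algebra.Formal_Power_Series"
begin

text \<open>\<open>rGamma\<close> is the entire function \<open>1 / \<Gamma>\<close>, which vanishes at the poles of \<open>\<Gamma>\<close>.\<close>

definition norm_Bessel_I :: "real \<Rightarrow> complex \<Rightarrow> complex" where
  "norm_Bessel_I \<mu> w =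
     (\<Sum>j. (w / 2) ^ (2 * j) * of_real (rGamma (\<mu> + real j + 1)) / fact j)"

text \<open>\<open>fps_binomial c\<close> is the formal power series of \<open>(1 + X)\<close> to the real power \<open>c\<close>, so
  composing it with \<open>X\<^sup>2 - 2 t X\<close>, which has no constant term, gives the formal power
  series of \<open>(1 - 2 t X + X\<^sup>2)\<close> to the power \<open>c\<close>.\<close>

definition norm_Gegenbauer :: "real \<Rightarrow> nat \<Rightarrow> real \<Rightarrow> real" where
  "norm_Gegenbauer \<nu> m t =
     fps_nth ((1 - fps_X ^ 2) *
       (fps_binomial (- (\<nu> + 1)) oo (fps_X ^ 2 - fps_const (2 * t) * fps_X))) m"

text \<open>Principal power of a complex number with real exponent. Unlike with \<open>powr\<close>,
  \<open>0\<close> to the power \<open>0\<close> is \<open>1\<close>; \<open>Arg\<close> takes values in \<open>(-\<pi>, \<pi>]\<close>.\<close>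

definition ppow :: "complex \<Rightarrow> real \<Rightarrow> complex" where
  "ppow w s = (if s = 0 then 1 else of_real (cmod w powr s) * cis (Arg w * s))"

definition scriptI :: "real \<Rightarrow> real \<Rightarrow> complex \<Rightarrow> real \<Rightarrow> complex" where
  "scriptI b \<nu> w t = of_real (Gamma (b * \<nu> + 1)) *
     (\<Sum>m. ppow (w / 2) (b * real m) * norm_Bessel_I (b * (real m + \<nu>)) w *
        of_real (norm_Gegenbauer \<nu> m t))"

text \<open>The directions of \<open>x\<close> and \<open>y\<close> are \<open>sgn x\<close> and \<open>sgn y\<close>. At the origin the direction
  is irrelevant; the lemma \<open>kernel_B_polar\<close> below gives the formula in polar coordinates.\<close>

definition kernel_B :: "real \<Rightarrow> real ^ 'n \<Rightarrow> real ^ 'n \<Rightarrow> complex" where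
  "kernel_B a x y = scriptI (2 / a) ((real CARD('n) - 2) / 2)
     (of_real (2 * (norm x * norm y) powr (a / 2)) / (of_real a * \<i>)) (sgn x \<bullet> sgn y)"

lemma norm_Gegenbauer_0 [simp]: "norm_Gegenbauer \<nu> 0 t = 1"
  by (simp add: norm_Gegenbauer_def)

lemma scriptI_0_indep:
  assumes "b > 0"
  shows "scriptI b \<nu> 0 t = scriptI b \<nu> 0 u"
proof -
  have "ppow (0 / 2) (b * real m) * c * of_real (norm_Gegenbauer \<nu> m t) =
        ppow (0 / 2) (b * real m) * c * of_real (norm_Gegenbauer \<nu> m u)" for m c
    using assms by (cases "m = 0") (auto simp: ppow_def)
  then show ?thesis unfolding scriptI_def by (simp only: mult.assoc)
qed

lemma kernel_B_polar:
  fixes \<omega> \<mu> :: "real ^ 'n"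
  assumes "a > 0" "r \<ge> 0" "s \<ge> 0" "norm \<omega> = 1" "norm \<mu> = 1"
  shows "kernel_B a (r *\<^sub>R \<omega>) (s *\<^sub>R \<mu>) = scriptI (2 / a) ((real CARD('n) - 2) / 2)
     (of_real (2 * (r * s) powr (a / 2)) / (of_real a * \<i>)) (\<omega> \<bullet> \<mu>)"
proof (cases "r * s = 0")
  case True
  then show ?thesis
    using assms scriptI_0_indep[of "2 / a"] by (auto simp: kernel_B_def)
next
  case False
  then show ?thesis
    using assms by (simp add: kernel_B_def sgn_div_norm)
qed

text \<open>The dimension is carried by the type argument. The weight \<open>norm x powr (2 - a)\<close>
  takes the value \<open>0\<close> at the origin even for \<open>a = 2\<close>; this affects only a null set.\<close>

definition const_c :: "'n::finite itself \<Rightarrow> real \<Rightarrow> real" where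
  "const_c _ a =
     inverse (LINT x|(lborel :: (real ^ 'n) measure).
       exp (- (1 / a) * norm x powr a) / norm x powr (2 - a))"

definition heat_kernel :: "real \<Rightarrow> real ^ 'n \<Rightarrow> real ^ 'n \<Rightarrow> real \<Rightarrow> complex" where
  "heat_kernel a x y t = of_real (const_c TYPE('n) a) *
     (LINT \<xi>|lborel. cnj (kernel_B a x \<xi>) * kernel_B a y \<xi> *
        of_real (exp (- (t / a) * norm \<xi> powr a)) / of_real (norm \<xi> powr (2 - a)))"

end

theory Submission
  imports Defs
begin

text \<open>Both integrals of the theorem have the same shape: a product of two series
  \<open>\<Sum>m. c m * q ^ m * E m (\<alpha> * q powr a) * C m \<tau>\<close>, with \<open>E m\<close> a normalized Bessel series and \<open>C m\<close> a
  normalized Gegenbauer polynomial, against the weight \<open>exp (- p * norm y powr a) / norm y powr (2 - a)\<close>. In polar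
  coordinates the angular part collapses to the diagonal, because the \<open>C m\<close> are the zonal harmonics,
  and the radial part is Weber's second exponential integral, so the result is again such a series.
  Applied to the kernel \<open>B\<close> and its conjugate (negative \<open>\<alpha>\<close>) this
  gives the heat kernel in closed form; applied to two heat kernels (positive \<open>\<alpha>\<close>) it gives the
  semigroup law.

  The reproducing property of the \<open>C m\<close> is obtained without surface measure or harmonic functions:
  mixed moments of two linear forms under a Gaussian are read off from its generating function, polar
  coordinates turn them into spherical moments, and expanding monomials in the \<open>C m\<close> yields a
  triangular system that determines the spherical integrals.\<close>

section \<open>Normalized Bessel series\<close>

text \<open>The orders of the Bessel functions fit the radial integral. With
  \<open>u = |y| powr a\<close>, measure and weight leave \<open>u powr bindex 0\<close>, where
  \<open>bindex 0 = (N - 2) / a\<close>; on the diagonal the two factors \<open>|y| ^ m\<close>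
  raise the exponent by \<open>2 * m / a\<close> to \<open>bindex m\<close>, the order of both
  Bessel factors, as Weber's formula demands. The condition a > 2 - N says that
  \<open>bindex 0 > -1\<close>. The normalization of the Gegenbauer polynomials allows the parameter
  \<kappa> = \<nu> + 1 = N / 2 > 0 throughout, so \<nu> = 0 (N = 2) and \<nu> = -1/2 (N = 1) are not
  special. In the heat kernel the phases of the complex powers in \<open>B\<close> cancel against
  those of its conjugate, and the positive coefficients \<open>(a * t) powr (- (2 / a * m))\<close>
  remain. The main analytic obstacle is the interchange of the double series with the integral: the
  Gegenbauer polynomials are bounded only geometrically in m, so the decay of the Bessel factors in
  m must beat any given ratio, at a cost in q of at most \<open>exp (D * q powr (a / 2))\<close>.
  This is why the lower bound for \<Gamma> below carries a free parameter R.\<close>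

lemma powr_le_exp_mult_Gamma:
  fixes R s h :: real
  assumes "R > 0" "s \<ge> 0" "h > 0"
  shows "R powr s \<le> exp (2 * R + 3) * Gamma (s + h)"
proof -
  \<comment> \<open>Only the part of the Euler integral over [R+1, R+2] is kept. There
    \<open>t powr s\<close> is at least \<open>R powr s\<close>, \<open>t powr (h - 1)\<close> is at
    least \<open>1 / t\<close>, hence at least \<open>exp (- (R + 1))\<close>, and
    \<open>exp (- t)\<close> is at least \<open>exp (- (R + 2))\<close>; the exponents add up to 2R
    + 3, independently of s and h.\<close>
  have int: "(\<lambda>t. t powr (s + h - 1) / exp t) integrable_on {R+1..R+2}"
    using assms by (intro integrable_continuous_real continuous_intros) auto
  have Gam: "((\<lambda>t. t powr (s + h - 1) / exp t) has_integral Gamma (s + h)) {0..}"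
    using assms by (intro Gamma_integral_real) auto
  have const: "((\<lambda>_. R powr s * exp (- (2 * R + 3))) has_integral (R powr s * exp (- (2 * R + 3)))) {R+1..R+2}"
    using has_integral_const_real[of "R powr s * exp (- (2 * R + 3))" "R+1" "R+2"] by simp
  have le: "R powr s * exp (- (2 * R + 3)) \<le> t powr (s + h - 1) / exp t"
    if t: "t \<in> {R+1..R+2}" for t
  proof -
    have "exp (- (R + 1)) \<le> 1 / (R + 2)"
      using exp_ge_add_one_self[of "R + 1"] assms
      by (subst exp_minus, subst inverse_eq_divide, intro divide_left_mono mult_pos_pos) auto
    also have "1 / (R + 2) \<le> t powr (-1)"
      using t assms by (simp add: powr_minus divide_simps)
    also have "t powr (-1) \<le> t powr (h - 1)"
      using t assms by (intro powr_mono) auto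
    finally have "exp (- (R + 1)) * exp (- (R + 2)) \<le> t powr (h - 1) * exp (- t)"
      using t by (intro mult_mono) auto
    moreover have "R powr s \<le> t powr s"
      using t assms by (intro powr_mono2) auto
    ultimately have "R powr s * (exp (- (R + 1)) * exp (- (R + 2))) \<le> t powr s * (t powr (h - 1) * exp (- t))"
      by (intro mult_mono[of "R powr s" "t powr s"]) (auto intro!: mult_nonneg_nonneg)
    also have "exp (- (R + 1)) * exp (- (R + 2)) = exp (- (2 * R + 3))"
      by (simp flip: exp_add)
    also have "t powr s * (t powr (h - 1) * exp (- t)) = t powr (s + h - 1) / exp t"
      using powr_add[of t s "h - 1"] by (simp add: exp_minus divide_inverse add_diff_eq)
    finally show ?thesis .
  qed
  have "R powr s * exp (- (2 * R + 3)) \<le> integral {R+1..R+2} (\<lambda>t. t powr (s + h - 1) / exp t)"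
    by (rule has_integral_le[OF const integrable_integral[OF int] le])
  also have "\<dots> \<le> Gamma (s + h)"
    by (rule has_integral_subset_le[OF _ integrable_integral[OF int] Gam]) (use assms in auto)
  finally have "R powr s * exp (- (2 * R + 3)) \<le> Gamma (s + h)" .
  hence "R powr s / exp (2 * R + 3) \<le> Gamma (s + h)"
    by (simp only: exp_minus divide_inverse)
  thus ?thesis by (simp only: pos_divide_le_eq exp_gt_zero mult.commute)
qed

text \<open>The Bessel series in the variable (w/2)^2, which is real even for the purely imaginary w
  of the kernel: v < 0 gives functions of type J, v > 0 of type I.\<close>

definition besE :: "real \<Rightarrow> real \<Rightarrow> real" where
  "besE \<mu> v = (\<Sum>j. v ^ j * rGamma (\<mu> + real j + 1) / fact j)"

lemma rGamma_pos: "x > 0 \<Longrightarrow> rGamma x > (0::real)"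
  by (simp add: rGamma_inverse_Gamma)

text \<open>Taking R proportional to the size of the argument, with a large factor, turns
  \<open>R powr (- s)\<close> with s linear in m into geometric decay of any wanted ratio.\<close>

lemma rGamma_le:
  fixes R s h :: real
  assumes "R > 0" "s \<ge> 0" "h > 0"
  shows "rGamma (s + h) \<le> exp (2 * R + 3) * R powr (- s)"
proof -
  have "Gamma (s + h) > 0" using assms by simp
  moreover have "R powr s > 0" using assms by simp
  moreover note powr_le_exp_mult_Gamma[OF assms]
  ultimately have "1 / Gamma (s + h) \<le> exp (2 * R + 3) / R powr s"
    by (simp only: pos_le_divide_eq pos_divide_le_eq times_divide_eq_left mult_1)
  thus ?thesis by (simp only: rGamma_inverse_Gamma powr_minus divide_inverse mult_1)
qed

text \<open>\<open>rGamma_le\<close> is applied with s + j in place of s. Of the factor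
  \<open>Q ^ (2 * j)\<close> that bounds \<open>|v| ^ j\<close>, one \<open>Q ^ j\<close> is eaten
  by \<open>R powr (- j)\<close>, as R is at least Q; the other one stays over
  \<open>fact j\<close>, so an exponential series is left.\<close>

lemma besE_term_bound:
  fixes Q R s h v :: real
  assumes "h > 0" "s \<ge> 0" "Q > 0" "R \<ge> Q" "\<bar>v\<bar> \<le> Q^2"
  shows "\<bar>v ^ j * rGamma (s + h + real j) / fact j\<bar> \<le> exp (2 * R + 3) * R powr (- s) * (Q ^ j / fact j)"
proof -
  have "rGamma ((s + real j) + h) \<le> exp (2 * R + 3) * R powr (- (s + real j))"
    using assms by (intro rGamma_le) auto
  also have "\<dots> = exp (2 * R + 3) * R powr (- s) / R ^ j"
    using assms powr_diff[of R "- s" "real j"] by (simp add: powr_realpow)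
  also have "\<dots> \<le> exp (2 * R + 3) * R powr (- s) / Q ^ j"
    using assms by (intro divide_left_mono power_mono) auto
  finally have 1: "rGamma (s + h + real j) \<le> exp (2 * R + 3) * R powr (- s) / Q ^ j"
    by (simp add: add_ac)
  have 2: "\<bar>v\<bar> ^ j \<le> Q ^ j * Q ^ j"
    using power_mono[OF assms(5), of j] by (simp add: power2_eq_square power_mult_distrib)
  have "\<bar>v\<bar> ^ j * rGamma (s + h + real j) \<le> (Q ^ j * Q ^ j) * (exp (2 * R + 3) * R powr (- s) / Q ^ j)"
    using assms rGamma_pos[of "s + h + real j"] by (intro mult_mono 1 2) auto
  also have "\<dots> = exp (2 * R + 3) * R powr (- s) * Q ^ j"
    using assms by simp
  finally have "\<bar>v\<bar> ^ j * rGamma (s + h + real j) / fact j \<le> exp (2 * R + 3) * R powr (- s) * Q ^ j / fact j"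
    by (rule divide_right_mono) simp
  moreover have "\<bar>v ^ j * rGamma (s + h + real j) / fact j\<bar> = \<bar>v\<bar> ^ j * rGamma (s + h + real j) / fact j"
    using rGamma_pos[of "s + h + real j"] assms by (simp only: abs_mult abs_divide power_abs) simp
  ultimately show ?thesis by (simp only: times_divide_eq_right)
qed

lemma summable_norm_besE:
  fixes \<mu> v :: real
  assumes "\<mu> > -1"
  shows "summable (\<lambda>j. \<bar>v ^ j * rGamma (\<mu> + real j + 1) / fact j\<bar>)"
proof (rule summable_comparison_test')
  let ?Q = "1 + \<bar>v\<bar>"
  show "summable (\<lambda>j. exp (2 * ?Q + 3) * ?Q powr 0 * (?Q ^ j / fact j))"
    using summable_exp[of ?Q] by (intro summable_mult) (simp add: field_simps)
  show "norm \<bar>v ^ j * rGamma (\<mu> + real j + 1) / fact j\<bar> \<le> exp (2 * ?Q + 3) * ?Q powr 0 * (?Q ^ j / fact j)" for j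
  proof -
    have "0 \<le> \<bar>v\<bar> * \<bar>v\<bar>" by simp
    hence "\<bar>v\<bar> \<le> ?Q\<^sup>2" unfolding power2_eq_square by (simp add: algebra_simps)
    hence "\<bar>v ^ j * rGamma (0 + (\<mu> + 1) + real j) / fact j\<bar> \<le> exp (2 * ?Q + 3) * ?Q powr (- 0) * (?Q ^ j / fact j)"
      using assms by (intro besE_term_bound) auto
    moreover have "0 + (\<mu> + 1) + real j = \<mu> + real j + 1" by simp
    ultimately show ?thesis by (simp only: real_norm_def abs_abs minus_zero)
  qed
qed

lemma summable_besE:
  "\<mu> > -1 \<Longrightarrow> summable (\<lambda>j. v ^ j * rGamma (\<mu> + real j + 1) / fact j :: real)"
  by (rule summable_rabs_cancel[OF summable_norm_besE])

lemma besE_nonneg: "\<mu> > -1 \<Longrightarrow> v \<ge> 0 \<Longrightarrow> besE \<mu> v \<ge> 0"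
  unfolding besE_def
  by (intro suminf_nonneg summable_besE) (auto intro!: divide_nonneg_nonneg mult_nonneg_nonneg less_imp_le[OF rGamma_pos])

lemma suminf_abs_besE:
  assumes "\<mu> > -1"
  shows "(\<Sum>j. \<bar>v ^ j * rGamma (\<mu> + real j + 1) / fact j\<bar>) = besE \<mu> \<bar>v\<bar>"
  unfolding besE_def using assms
  by (intro arg_cong[where f = suminf] ext)
     (simp add: abs_mult power_abs abs_of_pos[OF rGamma_pos])

lemma abs_besE_le: "\<mu> > -1 \<Longrightarrow> \<bar>besE \<mu> v\<bar> \<le> besE \<mu> \<bar>v\<bar>"
  using summable_rabs[OF summable_norm_besE, of \<mu> v] suminf_abs_besE[of \<mu> v]
  unfolding besE_def by simp

lemma besE_bound:
  fixes Q R s h v :: real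
  assumes "h > 0" "s \<ge> 0" "Q > 0" "R \<ge> Q" "\<bar>v\<bar> \<le> Q^2"
  shows "besE (s + h - 1) \<bar>v\<bar> \<le> exp (2 * R + 3 + Q) * R powr (- s)"
proof -
  have "besE (s + h - 1) \<bar>v\<bar> \<le> (\<Sum>j. exp (2 * R + 3) * R powr (- s) * (Q ^ j / fact j))"
    unfolding besE_def
  proof (rule suminf_le)
    fix j
    show "\<bar>v\<bar> ^ j * rGamma (s + h - 1 + real j + 1) / fact j \<le> exp (2 * R + 3) * R powr (- s) * (Q ^ j / fact j)"
    proof -
      have "s + h - 1 + real j + 1 = s + h + real j" by simp
      moreover have "\<bar>\<bar>v\<bar> ^ j * rGamma (s + h + real j) / fact j\<bar> \<le> exp (2 * R + 3) * R powr (- s) * (Q ^ j / fact j)"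
        using assms by (intro besE_term_bound) auto
      ultimately show ?thesis by (simp only: abs_le_iff)
    qed
    show "summable (\<lambda>j. \<bar>v\<bar> ^ j * rGamma (s + h - 1 + real j + 1) / fact j)"
      using assms by (intro summable_besE) auto
    show "summable (\<lambda>j. exp (2 * R + 3) * R powr (- s) * (Q ^ j / fact j))"
      using summable_exp[of Q] by (intro summable_mult) (simp add: field_simps)
  qed
  also have "\<dots> = exp (2 * R + 3) * R powr (- s) * exp Q"
    using sums_mult[OF exp_converges[of Q], of "exp (2 * R + 3) * R powr (- s)"]
    by (intro sums_unique[symmetric]) (simp add: divide_inverse mult.commute)
  finally show ?thesis by (simp add: exp_add mult_ac)
qed

lemma continuous_on_besE:
  assumes "\<mu> > -1"
  shows "continuous_on UNIV (besE \<mu>)"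
proof -
  have "isCont (besE \<mu>) x" for x
  proof -
    have eq: "y ^ j * rGamma (\<mu> + real j + 1) / fact j = (rGamma (\<mu> + real j + 1) / fact j) * y ^ j" for y j
      by simp
    have "isCont (\<lambda>x. \<Sum>j. (rGamma (\<mu> + real j + 1) / fact j) * x ^ j) x"
      using summable_besE[OF assms, of "\<bar>x\<bar> + 1"]
      by (intro isCont_powser[of _ "\<bar>x\<bar> + 1"]) (auto simp: eq)
    thus ?thesis by (simp only: besE_def[abs_def] eq)
  qed
  thus ?thesis by (auto intro!: continuous_at_imp_continuous_on)
qed

lemma measurable_besE [measurable]:
  assumes "\<mu> > -1"
  shows "besE \<mu> \<in> borel_measurable borel"
  using continuous_on_besE[OF assms] by (rule borel_measurable_continuous_onI)

text \<open>Chu-Vandermonde: the left side is the binomial coefficient with lower index i and upper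
  index l + (\<kappa> + i - 1), split at the plus sign. It drives both Weber's integral and the
  evaluation of the Gaussian moments.\<close>

lemma pochhammer_Vandermonde:
  fixes \<kappa> :: real
  shows "pochhammer (\<kappa> + real l) i / fact i =
         (\<Sum>q\<le>i. real (l choose q) * (pochhammer (\<kappa> + real q) (i - q) / fact (i - q)))"
proof -
  have "pochhammer (\<kappa> + real l) i / fact i = (real l + (\<kappa> + real i - 1)) gchoose i"
    by (simp add: gbinomial_pochhammer' algebra_simps)
  also have "\<dots> = (\<Sum>q\<in>{0..i}. (real l gchoose q) * ((\<kappa> + real i - 1) gchoose (i - q)))"
    by (rule gbinomial_Vandermonde[symmetric])
  also have "\<dots> = (\<Sum>q\<le>i. real (l choose q) * (pochhammer (\<kappa> + real q) (i - q) / fact (i - q)))"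
    by (intro sum.cong) (auto simp: gbinomial_pochhammer'[of "\<kappa> + real i - 1"] binomial_gbinomial of_nat_diff algebra_simps)
  finally show ?thesis .
qed

section \<open>Weber's integral\<close>

lemma has_bochner_integral_Gamma:
  fixes s p :: real
  assumes "s > 0" "p > 0"
  shows "has_bochner_integral lborel (\<lambda>u. indicator {0<..} u * (u powr (s - 1) * exp (- p * u)))
           (Gamma s * p powr (- s))"
proof -
  have "has_bochner_integral lborel (\<lambda>t. indicator {0..} t * t powr (s - 1) / exp t) (Gamma s)"
    using Gamma_conv_nn_integral_real[OF assms(1)] assms
    by (intro has_bochner_integral_nn_integral) (auto simp: Gamma_real_pos less_imp_le)
  hence "has_bochner_integral lborel
      (\<lambda>u. indicator {0..} (0 + p * u) * (0 + p * u) powr (s - 1) / exp (0 + p * u)) (Gamma s /\<^sub>R \<bar>p\<bar>)"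
    using assms by (subst (asm) lborel_has_bochner_integral_real_affine_iff[of p _ _ 0]) auto
  hence "has_bochner_integral lborel
      (\<lambda>u. p powr (1 - s) * (indicator {0..} (0 + p * u) * (0 + p * u) powr (s - 1) / exp (0 + p * u)))
      (p powr (1 - s) * (Gamma s /\<^sub>R \<bar>p\<bar>))"
    by (rule has_bochner_integral_mult_right)
  moreover have "p powr (1 - s) * (Gamma s /\<^sub>R \<bar>p\<bar>) = Gamma s * p powr (- s)"
    using assms by (simp add: powr_diff powr_minus field_simps)
  moreover have "p powr (1 - s) * (indicator {0..} (0 + p * u) * (0 + p * u) powr (s - 1) / exp (0 + p * u))
      = indicator {0<..} u * (u powr (s - 1) * exp (- p * u))" for u
  proof (cases "u > 0")
    case True
    have "p powr (1 - s) * p powr (s - 1) = 1"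
      using assms by (simp flip: powr_add)
    thus ?thesis using True assms by (simp add: powr_mult exp_minus field_simps)
  next
    case False
    \<comment> \<open>At u = 0 both sides are 0 because \<open>0 powr x = 0\<close>; so the closed
      half-line turns into the open one.\<close>
    thus ?thesis using assms by (cases "u = 0") (auto simp: indicator_def zero_le_mult_iff)
  qed
  ultimately show ?thesis by (simp only:)
qed

text \<open>The hypothesis is on the sum of absolute values because in the applications that sum has
  a closed form (\<open>besE\<close> at an absolute value, or an exponential), whose integrability
  is checked in one go.\<close>

lemma
  fixes f :: "nat \<Rightarrow> 'a \<Rightarrow> real"
  assumes [measurable]: "\<And>k. f k \<in> borel_measurable M"
    and summ: "\<And>x. summable (\<lambda>k. \<bar>f k x\<bar>)"
    and int: "integrable M (\<lambda>x. \<Sum>k. \<bar>f k x\<bar>)"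
  shows integrable_series_term: "integrable M (f k)"
    and sums_integral_series: "(\<lambda>k. \<integral>x. f k x \<partial>M) sums (\<integral>x. (\<Sum>k. f k x) \<partial>M)"
proof -
  have le: "(\<Sum>i\<in>I. \<bar>f i x\<bar>) \<le> (\<Sum>k. \<bar>f k x\<bar>)" if "finite I" for I x
    using summ that by (intro sum_le_suminf) auto
  have nn: "0 \<le> (\<Sum>k. \<bar>f k x\<bar>)" for x
    using le[of "{}" x] by simp
  have 1: "integrable M (f k)" for k
    by (rule Bochner_Integration.integrable_bound[OF int])
       (use le[of "{k}" for k] nn in \<open>auto intro!: AE_I2\<close>)
  show "integrable M (f k)" by (rule 1)
  show "(\<lambda>k. \<integral>x. f k x \<partial>M) sums (\<integral>x. (\<Sum>k. f k x) \<partial>M)"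
  proof (rule sums_integral[OF 1])
    show "AE x in M. summable (\<lambda>i. norm (f i x))" using summ by simp
    show "summable (\<lambda>i. \<integral>x. norm (f i x) \<partial>M)"
    proof (rule summableI_nonneg_bounded)
      fix n
      have "(\<Sum>i<n. \<integral>x. norm (f i x) \<partial>M) = (\<integral>x. (\<Sum>i<n. \<bar>f i x\<bar>) \<partial>M)"
        by (subst Bochner_Integration.integral_sum) (auto intro!: integrable_abs 1)
      also have "\<dots> \<le> (\<integral>x. (\<Sum>k. \<bar>f k x\<bar>) \<partial>M)"
        by (intro integral_mono int le Bochner_Integration.integrable_sum integrable_abs 1) auto
      finally show "(\<Sum>i<n. \<integral>x. norm (f i x) \<partial>M) \<le> (\<integral>x. (\<Sum>k. \<bar>f k x\<bar>) \<partial>M)" .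
    qed auto
  qed
qed

section \<open>Absorbing square-root exponential growth into the Gamma weight\<close>

lemma mult_sqrt_le:
  fixes D p u :: real
  assumes "p > 0" "u \<ge> 0"
  shows "D * sqrt u \<le> p / 2 * u + D\<^sup>2 / (2 * p)"
proof -
  have "0 \<le> (p * sqrt u - D)\<^sup>2 / (2 * p)" using assms by simp
  also have "\<dots> = p / 2 * u + D\<^sup>2 / (2 * p) - D * sqrt u"
    using assms by (simp add: power2_diff power_mult_distrib add_divide_distrib diff_divide_distrib)
                   (simp add: power2_eq_square)
  finally show ?thesis by simp
qed

text \<open>By \<open>mult_sqrt_le\<close>, a completed square, half of the decay
  \<open>exp (- p * u)\<close> absorbs the growth of g at the price of a constant; the other half
  keeps a Gamma integral convergent. \<open>exp (D * sqrt u)\<close> is the growth of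
  \<open>besE\<close> at arguments proportional to u.\<close>

lemma integrable_Gamma_weight:
  fixes \<mu> p C D :: real and g :: "real \<Rightarrow> real"
  assumes "\<mu> > -1" "p > 0" and [measurable]: "g \<in> borel_measurable borel"
    and g: "\<And>u. u > 0 \<Longrightarrow> \<bar>g u\<bar> \<le> C * exp (D * sqrt u)"
  shows "integrable lborel (\<lambda>u. indicator {0<..} u * (u powr \<mu> * exp (- p * u)) * g u)"
proof (rule Bochner_Integration.integrable_bound)
  have "integrable lborel (\<lambda>u. indicator {0<..} u * (u powr (\<mu> + 1 - 1) * exp (- (p / 2) * u)))"
    using assms by (intro integrable.intros[OF has_bochner_integral_Gamma]) auto
  thus "integrable lborel (\<lambda>u. \<bar>C\<bar> * exp (D\<^sup>2 / (2 * p)) * (indicator {0<..} u * (u powr \<mu> * exp (- (p / 2) * u))))"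
    by simp
  have "norm (indicator {0<..} u * (u powr \<mu> * exp (- p * u)) * g u)
      \<le> norm (\<bar>C\<bar> * exp (D\<^sup>2 / (2 * p)) * (indicator {0<..} u * (u powr \<mu> * exp (- (p / 2) * u))))" for u
  proof (cases "u > 0")
    case True
    have "\<bar>g u\<bar> \<le> \<bar>C\<bar> * exp (D * sqrt u)"
      by (rule order_trans[OF g[OF True]]) (simp add: mult_right_mono)
    also have "\<dots> \<le> \<bar>C\<bar> * exp (p / 2 * u + D\<^sup>2 / (2 * p))"
      using mult_sqrt_le[of p u D] assms True by (intro mult_left_mono) auto
    finally have "(u powr \<mu> * exp (- p * u)) * \<bar>g u\<bar>
        \<le> (u powr \<mu> * exp (- p * u)) * (\<bar>C\<bar> * exp (p / 2 * u + D\<^sup>2 / (2 * p)))"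
      by (intro mult_left_mono) auto
    also have "\<dots> = \<bar>C\<bar> * u powr \<mu> * (exp (- p * u) * exp (p / 2 * u + D\<^sup>2 / (2 * p)))"
      by simp
    also have "exp (- p * u) * exp (p / 2 * u + D\<^sup>2 / (2 * p)) = exp (D\<^sup>2 / (2 * p)) * exp (- (p / 2) * u)"
      by (simp flip: exp_add)
    finally show ?thesis using True by (simp add: abs_mult mult_ac)
  qed auto
  thus "AE u in lborel. norm (indicator {0<..} u * (u powr \<mu> * exp (- p * u)) * g u)
      \<le> norm (\<bar>C\<bar> * exp (D\<^sup>2 / (2 * p)) * (indicator {0<..} u * (u powr \<mu> * exp (- (p / 2) * u))))"
    by simp
qed auto

text \<open>\<open>besE_bound\<close> with s = 0 and Q = R = 1 + \<open>sqrt |v|\<close>; the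
  exponent is 3 + 3Q. The bound is the same for all orders \<mu>, so products of Bessel factors of
  different orders are dominated as well.\<close>

lemma besE_le_exp_sqrt:
  assumes "\<mu> > -1"
  shows "besE \<mu> \<bar>v\<bar> \<le> exp (6 + 3 * sqrt \<bar>v\<bar>)"
proof -
  let ?Q = "1 + sqrt \<bar>v\<bar>"
  have "besE (0 + (\<mu> + 1) - 1) \<bar>v\<bar> \<le> exp (2 * ?Q + 3 + ?Q) * ?Q powr (- 0)"
    using assms by (intro besE_bound) (auto simp: power2_sum add_pos_nonneg)
  moreover have "2 * ?Q + 3 + ?Q = 6 + 3 * sqrt \<bar>v\<bar>" by simp
  moreover have "?Q \<noteq> 0" using real_sqrt_ge_zero[of "\<bar>v\<bar>"] by linarith
  ultimately show ?thesis by simp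
qed

lemma abs_besE_le_exp_sqrt:
  assumes "\<mu> > -1" "u > 0"
  shows "\<bar>besE \<mu> (\<alpha> * u)\<bar> \<le> exp 6 * exp (3 * sqrt \<bar>\<alpha>\<bar> * sqrt u)"
    and "besE \<mu> \<bar>\<alpha> * u\<bar> \<le> exp 6 * exp (3 * sqrt \<bar>\<alpha>\<bar> * sqrt u)"
proof -
  show 1: "besE \<mu> \<bar>\<alpha> * u\<bar> \<le> exp 6 * exp (3 * sqrt \<bar>\<alpha>\<bar> * sqrt u)"
    using besE_le_exp_sqrt[OF assms(1), of "\<alpha> * u"] assms(2)
    by (simp add: abs_mult real_sqrt_mult mult.assoc flip: exp_add)
  show "\<bar>besE \<mu> (\<alpha> * u)\<bar> \<le> exp 6 * exp (3 * sqrt \<bar>\<alpha>\<bar> * sqrt u)"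
    using abs_besE_le[OF assms(1), of "\<alpha> * u"] 1 by linarith
qed

lemma power_le_exp_sqrt:
  fixes u :: real
  assumes "u > 0"
  shows "u ^ k \<le> fact (2 * k) * exp (sqrt u)"
proof -
  have "sqrt u ^ (2 * k) / fact (2 * k) \<le> exp (sqrt u)"
    using assms sum_le_suminf[OF summable_exp[of "sqrt u"], of "{2 * k}"]
    by (auto simp: exp_def field_simps)
  moreover have "sqrt u ^ (2 * k) = u ^ k" using assms by (simp add: power_mult)
  ultimately show ?thesis by (simp add: field_simps)
qed


lemma exp_sums_real: "(\<lambda>n. x ^ n / fact n) sums exp (x :: real)"
  using exp_converges[of x] by (simp only: real_scaleR_def divide_inverse mult.commute)

text \<open>Kummer's transformation: the series is a multiple of the confluent function
  1F1(\<mu>+1+k; \<mu>+1; A), which equals \<open>exp A\<close> times 1F1(-k; \<mu>+1; -A), a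
  polynomial of degree k. Multiplying that polynomial with the exponential series reduces the claim
  to Vandermonde's identity in each coefficient.\<close>

lemma Gamma_mult_rGamma_sums:
  fixes \<mu> A :: real
  assumes "\<mu> > -1"
  shows "(\<lambda>j. A ^ j / fact j * (Gamma (\<mu> + 1 + real k + real j) * rGamma (\<mu> + real j + 1))) sums
           (exp A * (\<Sum>q\<le>k. real (k choose q) * A ^ q * (Gamma (\<mu> + real k + 1) * rGamma (\<mu> + real q + 1))))"
proof -
  define a where "a q = real (k choose q) * A ^ q * (Gamma (\<mu> + real k + 1) * rGamma (\<mu> + real q + 1))" for q
  define e where "e i = A ^ i / fact i" for i
  have fin: "finite {..k}" "\<And>q. q \<notin> {..k} \<Longrightarrow> a q = 0" by (auto simp: a_def)
  have e: "e sums exp A" unfolding e_def by (rule exp_sums_real)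
  have "summable (\<lambda>k. norm (e k))"
    using summable_exp[of "\<bar>A\<bar>"] by (simp add: e_def power_abs abs_divide field_simps)
  moreover have "summable (\<lambda>k. norm (a k))"
    by (rule summable_finite[OF fin(1)]) (simp add: fin(2))
  ultimately have "(\<lambda>j. \<Sum>q\<le>j. a q * e (j - q)) sums ((\<Sum>q. a q) * (\<Sum>q. e q))"
    by (intro Cauchy_product_sums)
  also have "(\<Sum>q. e q) = exp A" using e by (simp add: sums_iff)
  also have "(\<Sum>q. a q) = (\<Sum>q\<le>k. a q)" by (rule suminf_finite[OF fin])
  also have "(\<lambda>j. \<Sum>q\<le>j. a q * e (j - q)) = (\<lambda>j. A ^ j / fact j * (Gamma (\<mu> + 1 + real k + real j) * rGamma (\<mu> + real j + 1)))"
  proof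
    fix j
    have ni: "x \<notin> \<int>\<^sub>\<le>\<^sub>0" if "x > 0" for x :: real
      using that by (auto elim!: nonpos_Ints_cases)
    have poch: "pochhammer (\<mu> + 1 + real q) n = Gamma (\<mu> + 1 + real q + real n) * rGamma (\<mu> + real q + 1)" for q n
      using assms pochhammer_Gamma[OF ni, of "\<mu> + 1 + real q" n]
      by (simp add: rGamma_inverse_Gamma divide_inverse add_ac)
    have "A ^ j / fact j * (Gamma (\<mu> + 1 + real k + real j) * rGamma (\<mu> + real j + 1))
        = A ^ j / fact j * fact k * (pochhammer (\<mu> + 1 + real j) k / fact k)"
    proof -
      have "\<mu> + 1 + real k + real j = \<mu> + 1 + real j + real k" by simp
      hence "Gamma (\<mu> + 1 + real k + real j) * rGamma (\<mu> + real j + 1) = pochhammer (\<mu> + 1 + real j) k"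
        using poch[of j k] by (simp only:)
      thus ?thesis by (simp only: mult.assoc) simp
    qed
    also have "\<dots> = A ^ j / fact j * fact k * (\<Sum>q\<le>k. real (j choose q) * (pochhammer (\<mu> + 1 + real q) (k - q) / fact (k - q)))"
      by (subst pochhammer_Vandermonde) (rule refl)
    also have "\<dots> = (\<Sum>q\<le>k. A ^ j / fact j * fact k * (real (j choose q) * (pochhammer (\<mu> + 1 + real q) (k - q) / fact (k - q))))"
      by (rule sum_distrib_left)
    \<comment> \<open>The sum is cut at \<open>min j k\<close> because \<open>j choose q\<close>
      vanishes for q > j; it is extended to all q up to j below because \<open>a q\<close> vanishes
      for q > k.\<close>
    also have "\<dots> = (\<Sum>q\<le>min j k. A ^ j / fact j * fact k * (real (j choose q) * (pochhammer (\<mu> + 1 + real q) (k - q) / fact (k - q))))"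
      by (rule sum.mono_neutral_right) auto
    also have "\<dots> = (\<Sum>q\<le>min j k. a q * e (j - q))"
    proof (rule sum.cong)
      fix q assume "q \<in> {..min j k}"
      hence q: "q \<le> j" "q \<le> k" by auto
      have "A ^ j = A ^ q * A ^ (j - q)" using q by (simp flip: power_add)
      moreover have "real (j choose q) = fact j / (fact q * fact (j - q))"
        using q by (simp add: binomial_fact)
      moreover have "real (k choose q) = fact k / (fact q * fact (k - q))"
        using q by (simp add: binomial_fact)
      moreover have "pochhammer (\<mu> + 1 + real q) (k - q) = Gamma (\<mu> + real k + 1) * rGamma (\<mu> + real q + 1)"
      proof -
        have "\<mu> + 1 + real q + real (k - q) = \<mu> + real k + 1" using q by (simp add: of_nat_diff)
        thus ?thesis by (simp only: poch)
      qed
      ultimately show "A ^ j / fact j * fact k * (real (j choose q) * (pochhammer (\<mu> + 1 + real q) (k - q) / fact (k - q))) = a q * e (j - q)"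
        by (simp add: a_def e_def mult_ac)
    qed auto
    also have "\<dots> = (\<Sum>q\<le>j. a q * e (j - q))"
      by (rule sum.mono_neutral_left) (auto simp: fin(2))
    finally show "(\<Sum>q\<le>j. a q * e (j - q)) = A ^ j / fact j * (Gamma (\<mu> + 1 + real k + real j) * rGamma (\<mu> + real j + 1))" ..
  qed
  finally show ?thesis by (simp add: a_def mult.commute)
qed

lemma summable_abs_mult_besE:
  assumes "\<mu> > -1"
  shows "summable (\<lambda>j. \<bar>c * (v ^ j * rGamma (\<mu> + real j + 1) / fact j)\<bar>)"
    and "(\<Sum>j. \<bar>c * (v ^ j * rGamma (\<mu> + real j + 1) / fact j)\<bar>) = \<bar>c\<bar> * besE \<mu> \<bar>v\<bar>"
    and "(\<Sum>j. c * (v ^ j * rGamma (\<mu> + real j + 1) / fact j)) = c * besE \<mu> v"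
proof -
  have eq: "\<bar>c * (v ^ j * rGamma (\<mu> + real j + 1) / fact j)\<bar> = \<bar>c\<bar> * \<bar>v ^ j * rGamma (\<mu> + real j + 1) / fact j\<bar>" for j
    by (rule abs_mult)
  show "summable (\<lambda>j. \<bar>c * (v ^ j * rGamma (\<mu> + real j + 1) / fact j)\<bar>)"
    unfolding eq by (intro summable_mult summable_norm_besE assms)
  show "(\<Sum>j. \<bar>c * (v ^ j * rGamma (\<mu> + real j + 1) / fact j)\<bar>) = \<bar>c\<bar> * besE \<mu> \<bar>v\<bar>"
    unfolding eq by (subst suminf_mult[OF summable_norm_besE[OF assms]]) (simp only: suminf_abs_besE[OF assms])
  show "(\<Sum>j. c * (v ^ j * rGamma (\<mu> + real j + 1) / fact j)) = c * besE \<mu> v"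
    unfolding besE_def by (rule suminf_mult[OF summable_besE[OF assms]])
qed

text \<open>The moments of one Bessel factor, which appear when the other factor of Weber's integral
  is expanded. Termwise Gamma integrals give a confluent series, and Kummer's transformation makes
  it \<open>exp (\<alpha> / p)\<close> times a polynomial in \<open>\<alpha> / p\<close>.\<close>

lemma integral_power_besE:
  fixes \<mu> p \<alpha> :: real
  assumes "\<mu> > -1" "p > 0"
  shows "(LINT u|lborel. indicator {0<..} u * (u powr \<mu> * exp (- p * u)) * (u ^ k * besE \<mu> (\<alpha> * u)))
       = p powr (- (\<mu> + 1 + real k)) * exp (\<alpha> / p) *
         (\<Sum>q\<le>k. real (k choose q) * (\<alpha> / p) ^ q * (Gamma (\<mu> + real k + 1) * rGamma (\<mu> + real q + 1)))"
proof -
  define w where "w u = indicator {0<..} u * (u powr \<mu> * exp (- p * u))" for u :: real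
  define f where "f j u = (w u * u ^ k) * ((\<alpha> * u) ^ j * rGamma (\<mu> + real j + 1) / fact j)" for j u
  note [measurable] = measurable_besE[OF assms(1)]
  have w_meas [measurable]: "w \<in> borel_measurable borel" unfolding w_def[abs_def] by measurable
  have f_meas [measurable]: "f j \<in> borel_measurable lborel" for j
    unfolding f_def[abs_def] by measurable
  have "integrable lborel (\<lambda>u. indicator {0<..} u * (u powr \<mu> * exp (- p * u)) * (u ^ k * besE \<mu> \<bar>\<alpha> * u\<bar>))"
  \<comment> \<open>In D, the 1 comes from bounding \<open>u ^ k\<close> and the rest from the
    Bessel factor.\<close>
  proof (rule integrable_Gamma_weight[OF assms, where C = "fact (2 * k) * exp 6" and D = "1 + 3 * sqrt \<bar>\<alpha>\<bar>"])
    fix u :: real assume u: "u > 0"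
    have "\<bar>u ^ k * besE \<mu> \<bar>\<alpha> * u\<bar>\<bar> \<le> (fact (2 * k) * exp (sqrt u)) * (exp 6 * exp (3 * sqrt \<bar>\<alpha>\<bar> * sqrt u))"
      using u besE_nonneg[OF assms(1), of "\<bar>\<alpha> * u\<bar>"] unfolding abs_mult[of "u ^ k"]
      by (intro mult_mono power_le_exp_sqrt abs_besE_le_exp_sqrt(2) assms) 
         (auto simp: power_le_exp_sqrt abs_besE_le_exp_sqrt(2)[OF assms(1)])
    also have "\<dots> = fact (2 * k) * exp 6 * exp ((1 + 3 * sqrt \<bar>\<alpha>\<bar>) * sqrt u)"
      by (simp add: exp_add ring_distribs)
    finally show "\<bar>u ^ k * besE \<mu> \<bar>\<alpha> * u\<bar>\<bar> \<le> fact (2 * k) * exp 6 * exp ((1 + 3 * sqrt \<bar>\<alpha>\<bar>) * sqrt u)" .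
  qed measurable
  hence "integrable lborel (\<lambda>u. \<Sum>j. \<bar>f j u\<bar>)"
    unfolding f_def summable_abs_mult_besE[OF assms(1)]
    by (rule back_subst[of "integrable lborel"]) (auto simp: w_def indicator_def fun_eq_iff)
  hence "(\<lambda>j. LINT u|lborel. f j u) sums (LINT u|lborel. (\<Sum>j. f j u))"
    unfolding f_def by (intro sums_integral_series summable_abs_mult_besE assms) (auto simp flip: f_def)
  also have "(\<lambda>u. \<Sum>j. f j u) = (\<lambda>u. w u * (u ^ k * besE \<mu> (\<alpha> * u)))"
    unfolding f_def summable_abs_mult_besE[OF assms(1)] by (simp add: mult.assoc)
  finally have 1: "(\<lambda>j. LINT u|lborel. f j u) sums (LINT u|lborel. w u * (u ^ k * besE \<mu> (\<alpha> * u)))" .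
  have "(LINT u|lborel. f j u) = p powr (- (\<mu> + 1 + real k)) * ((\<alpha> / p) ^ j / fact j * (Gamma (\<mu> + 1 + real k + real j) * rGamma (\<mu> + real j + 1)))" for j
  proof -
    let ?s = "\<mu> + 1 + real k + real j"
    have "f j u = (\<alpha> ^ j * rGamma (\<mu> + real j + 1) / fact j) * (indicator {0<..} u * (u powr (?s - 1) * exp (- p * u)))" for u
    proof (cases "u > 0")
      case True
      have "u powr (?s - 1) = u powr \<mu> * u ^ k * u ^ j"
      proof -
        have "?s - 1 = \<mu> + real k + real j" by simp
        thus ?thesis using True by (simp only: powr_add powr_realpow)
      qed
      thus ?thesis using True by (simp add: f_def w_def power_mult_distrib)
    qed (auto simp: f_def w_def)
    hence "(LINT u|lborel. f j u) = (\<alpha> ^ j * rGamma (\<mu> + real j + 1) / fact j) * (Gamma ?s * p powr (- ?s))"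
      using has_bochner_integral_integral_eq[OF has_bochner_integral_Gamma[of ?s p]] assms by simp
    also have "p powr (- ?s) = p powr (- (\<mu> + 1 + real k)) / p ^ j"
      using assms powr_diff[of p "- (\<mu> + 1 + real k)" "real j"] by (simp add: powr_realpow)
    finally show ?thesis by (simp add: power_divide mult_ac)
  qed
  with 1 have "(\<lambda>j. p powr (- (\<mu> + 1 + real k)) * ((\<alpha> / p) ^ j / fact j * (Gamma (\<mu> + 1 + real k + real j) * rGamma (\<mu> + real j + 1))))
       sums (LINT u|lborel. w u * (u ^ k * besE \<mu> (\<alpha> * u)))" by simp
  from sums_unique2[OF this sums_mult[OF Gamma_mult_rGamma_sums[OF assms(1)]]]
  show ?thesis by (simp add: w_def mult.assoc)
qed

text \<open>The absolute values inside the arguments make this a majorant for the termwise expanded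
  integrand, not only for the product itself.\<close>

lemma integrable_Weber:
  fixes \<mu> p \<alpha> \<beta> :: real
  assumes "\<mu> > -1" "p > 0"
  shows "integrable lborel (\<lambda>u. indicator {0<..} u * (u powr \<mu> * exp (- p * u)) * (besE \<mu> \<bar>\<alpha> * u\<bar> * besE \<mu> \<bar>\<beta> * u\<bar>))"
proof -
  note [measurable] = measurable_besE[OF assms(1)]
  show ?thesis
  proof (rule integrable_Gamma_weight[OF assms, where C = "exp 6 * exp 6" and D = "3 * sqrt \<bar>\<alpha>\<bar> + 3 * sqrt \<bar>\<beta>\<bar>"])
    fix u :: real assume u: "u > 0"
    have "\<bar>besE \<mu> \<bar>\<alpha> * u\<bar> * besE \<mu> \<bar>\<beta> * u\<bar>\<bar> = besE \<mu> \<bar>\<alpha> * u\<bar> * besE \<mu> \<bar>\<beta> * u\<bar>"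
      by (intro abs_of_nonneg mult_nonneg_nonneg besE_nonneg assms) auto
    also have "\<dots> \<le> (exp 6 * exp (3 * sqrt \<bar>\<alpha>\<bar> * sqrt u)) * (exp 6 * exp (3 * sqrt \<bar>\<beta>\<bar> * sqrt u))"
      using u by (intro mult_mono abs_besE_le_exp_sqrt(2) assms besE_nonneg) auto
    also have "\<dots> = exp 6 * exp 6 * exp ((3 * sqrt \<bar>\<alpha>\<bar> + 3 * sqrt \<bar>\<beta>\<bar>) * sqrt u)"
      by (simp add: exp_add ring_distribs)
    finally show "\<bar>besE \<mu> \<bar>\<alpha> * u\<bar> * besE \<mu> \<bar>\<beta> * u\<bar>\<bar> \<le> exp 6 * exp 6 * exp ((3 * sqrt \<bar>\<alpha>\<bar> + 3 * sqrt \<bar>\<beta>\<bar>) * sqrt u)" .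
  qed measurable
qed

text \<open>Weber's second exponential integral. Since \<open>\<alpha>\<close> and \<open>\<beta>\<close> may have either sign, it covers both \<open>J\<close> and
  \<open>I\<close> Bessel functions.\<close>

lemma Weber_integral:
  fixes \<mu> p \<alpha> \<beta> :: real
  assumes "\<mu> > -1" "p > 0"
  shows "has_bochner_integral lborel (\<lambda>u. indicator {0<..} u * (u powr \<mu> * exp (- p * u)) * (besE \<mu> (\<alpha> * u) * besE \<mu> (\<beta> * u)))
       (p powr (- (\<mu> + 1)) * exp ((\<alpha> + \<beta>) / p) * besE \<mu> (\<alpha> * \<beta> / p\<^sup>2))"
proof -
  define w where "w u = indicator {0<..} u * (u powr \<mu> * exp (- p * u))" for u :: real
  \<comment> \<open>Only the second Bessel factor is expanded; each term is then a moment of the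
    first.\<close>
  define f where "f k u = (w u * besE \<mu> (\<alpha> * u)) * ((\<beta> * u) ^ k * rGamma (\<mu> + real k + 1) / fact k)" for k u
  define A B where "A = \<alpha> / p" and "B = \<beta> / p"
  note [measurable] = measurable_besE[OF assms(1)]
  have w_meas [measurable]: "w \<in> borel_measurable borel" unfolding w_def[abs_def] by measurable
  have f_meas [measurable]: "f j \<in> borel_measurable lborel" for j
    unfolding f_def[abs_def] by measurable
  have w_nonneg: "w u \<ge> 0" for u by (simp add: w_def)
  have int: "integrable lborel (\<lambda>u. \<Sum>j. \<bar>f j u\<bar>)"
    unfolding f_def summable_abs_mult_besE[OF assms(1)]
  proof (rule Bochner_Integration.integrable_bound[OF integrable_Weber[OF assms, of \<alpha> \<beta>]])
    show "AE u in lborel. norm (\<bar>w u * besE \<mu> (\<alpha> * u)\<bar> * besE \<mu> \<bar>\<beta> * u\<bar>) \<le>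
      norm (indicator {0<..} u * (u powr \<mu> * exp (- p * u)) * (besE \<mu> \<bar>\<alpha> * u\<bar> * besE \<mu> \<bar>\<beta> * u\<bar>))"
    proof (rule AE_I2)
      fix u
      have "\<bar>besE \<mu> (\<alpha> * u)\<bar> * besE \<mu> \<bar>\<beta> * u\<bar> \<le> besE \<mu> \<bar>\<alpha> * u\<bar> * besE \<mu> \<bar>\<beta> * u\<bar>"
        by (intro mult_right_mono abs_besE_le besE_nonneg assms) auto
      hence "w u * (\<bar>besE \<mu> (\<alpha> * u)\<bar> * besE \<mu> \<bar>\<beta> * u\<bar>) \<le> w u * (besE \<mu> \<bar>\<alpha> * u\<bar> * besE \<mu> \<bar>\<beta> * u\<bar>)"
        by (intro mult_left_mono w_nonneg)
      thus "norm (\<bar>w u * besE \<mu> (\<alpha> * u)\<bar> * besE \<mu> \<bar>\<beta> * u\<bar>) \<le>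
        norm (indicator {0<..} u * (u powr \<mu> * exp (- p * u)) * (besE \<mu> \<bar>\<alpha> * u\<bar> * besE \<mu> \<bar>\<beta> * u\<bar>))"
        unfolding w_def[symmetric]
        using w_nonneg[of u] besE_nonneg[OF assms(1), of "\<bar>\<alpha> * u\<bar>"] besE_nonneg[OF assms(1), of "\<bar>\<beta> * u\<bar>"]
        by (simp add: abs_mult mult.assoc)
    qed
  qed measurable
  have "(\<lambda>k. LINT u|lborel. f k u) sums (LINT u|lborel. (\<Sum>j. f j u))"
    using int unfolding f_def by (intro sums_integral_series summable_abs_mult_besE assms) (auto simp flip: f_def)
  also have eq: "(\<lambda>u. \<Sum>j. f j u) = (\<lambda>u. w u * (besE \<mu> (\<alpha> * u) * besE \<mu> (\<beta> * u)))"
    unfolding f_def summable_abs_mult_besE[OF assms(1)] by (simp add: mult.assoc)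
  finally have 1: "(\<lambda>k. LINT u|lborel. f k u) sums (LINT u|lborel. w u * (besE \<mu> (\<alpha> * u) * besE \<mu> (\<beta> * u)))" .
  have int': "integrable lborel (\<lambda>u. w u * (besE \<mu> (\<alpha> * u) * besE \<mu> (\<beta> * u)))"
    unfolding eq[symmetric]
  proof (rule Bochner_Integration.integrable_bound[OF int])
    show "AE u in lborel. norm (\<Sum>j. f j u) \<le> norm (\<Sum>j. \<bar>f j u\<bar>)"
    proof (rule AE_I2)
      fix u
      have "summable (\<lambda>j. \<bar>f j u\<bar>)"
        unfolding f_def by (rule summable_abs_mult_besE[OF assms(1)])
      from summable_rabs[OF this] show "norm (\<Sum>j. f j u) \<le> norm (\<Sum>j. \<bar>f j u\<bar>)" by simp
    qed
  qed measurable
  define c where "c q = (A * B) ^ q * rGamma (\<mu> + real q + 1) / fact q" for q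
  define e where "e i = B ^ i / fact i" for i
  \<comment> \<open>The factor \<open>rGamma (\<mu> + k + 1)\<close> of the series cancels the Gamma
    factor of the moment, and the binomial coefficient splits \<open>B ^ k / fact k\<close>. What is
    left is the k-th Cauchy coefficient of the Bessel series at A * B times the exponential series
    at B.\<close>
  have f_int: "(LINT u|lborel. f k u) = p powr (- (\<mu> + 1)) * exp A * (\<Sum>q\<le>k. c q * e (k - q))" for k
  proof -
    have "(LINT u|lborel. f k u) = (LINT u|lborel. (\<beta> ^ k * rGamma (\<mu> + real k + 1) / fact k) *
        (indicator {0<..} u * (u powr \<mu> * exp (- p * u)) * (u ^ k * besE \<mu> (\<alpha> * u))))"
      by (simp add: f_def w_def power_mult_distrib mult_ac)
    also have "\<dots> = (\<beta> ^ k * rGamma (\<mu> + real k + 1) / fact k) * (p powr (- (\<mu> + 1 + real k)) * exp (\<alpha> / p) *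
         (\<Sum>q\<le>k. real (k choose q) * (\<alpha> / p) ^ q * (Gamma (\<mu> + real k + 1) * rGamma (\<mu> + real q + 1))))"
      by (subst integral_mult_right_zero, subst integral_power_besE[OF assms]) simp
    also have "p powr (- (\<mu> + 1 + real k)) = p powr (- (\<mu> + 1)) / p ^ k"
      using assms powr_diff[of p "- (\<mu> + 1)" "real k"] by (simp add: powr_realpow)
    also have "(\<beta> ^ k * rGamma (\<mu> + real k + 1) / fact k) * (p powr (- (\<mu> + 1)) / p ^ k * exp (\<alpha> / p) *
         (\<Sum>q\<le>k. real (k choose q) * (\<alpha> / p) ^ q * (Gamma (\<mu> + real k + 1) * rGamma (\<mu> + real q + 1))))
       = p powr (- (\<mu> + 1)) * exp A * (B ^ k * rGamma (\<mu> + real k + 1) / fact k *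
           (\<Sum>q\<le>k. real (k choose q) * A ^ q * (Gamma (\<mu> + real k + 1) * rGamma (\<mu> + real q + 1))))"
      by (simp add: A_def B_def power_divide mult_ac)
    also have "B ^ k * rGamma (\<mu> + real k + 1) / fact k *
           (\<Sum>q\<le>k. real (k choose q) * A ^ q * (Gamma (\<mu> + real k + 1) * rGamma (\<mu> + real q + 1)))
         = (\<Sum>q\<le>k. c q * e (k - q))"
      unfolding sum_distrib_left
    proof (rule sum.cong)
      fix q assume "q \<in> {..k}"
      hence q: "q \<le> k" by simp
      have "B ^ k = B ^ q * B ^ (k - q)" using q by (simp flip: power_add)
      moreover have "real (k choose q) = fact k / (fact q * fact (k - q))"
        using q by (simp add: binomial_fact)
      moreover have "rGamma (\<mu> + real k + 1) * Gamma (\<mu> + real k + 1) = 1"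
      proof -
        have "Gamma (\<mu> + real k + 1) > 0" using assms by (intro Gamma_real_pos) auto
        thus ?thesis unfolding rGamma_inverse_Gamma by (intro left_inverse) auto
      qed
      ultimately show "B ^ k * rGamma (\<mu> + real k + 1) / fact k * (real (k choose q) * A ^ q * (Gamma (\<mu> + real k + 1) * rGamma (\<mu> + real q + 1)))
          = c q * e (k - q)"
        by (simp add: c_def e_def power_mult_distrib)
    qed simp
    finally show ?thesis .
  qed
  have "e sums exp B" unfolding e_def by (rule exp_sums_real)
  moreover have "summable (\<lambda>k. norm (e k))"
    using summable_exp[of "\<bar>B\<bar>"] by (simp add: e_def power_abs abs_divide field_simps)
  moreover have "summable (\<lambda>k. norm (c k))"
    unfolding c_def real_norm_def by (rule summable_norm_besE[OF assms(1)])
  moreover have "(\<Sum>k. c k) = besE \<mu> (A * B)" by (simp add: c_def besE_def)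
  ultimately have "(\<lambda>k. \<Sum>q\<le>k. c q * e (k - q)) sums (besE \<mu> (A * B) * exp B)"
    using Cauchy_product_sums[of c e] by (simp add: sums_iff)
  from sums_mult[OF this, of "p powr (- (\<mu> + 1)) * exp A"] 1
  have "(LINT u|lborel. w u * (besE \<mu> (\<alpha> * u) * besE \<mu> (\<beta> * u)))
      = p powr (- (\<mu> + 1)) * exp A * (besE \<mu> (A * B) * exp B)"
    unfolding f_int by (rule sums_unique2[symmetric])
  also have "A * B = \<alpha> * \<beta> / p\<^sup>2" by (simp add: A_def B_def power2_eq_square)
  also have "p powr (- (\<mu> + 1)) * exp A * (besE \<mu> (\<alpha> * \<beta> / p\<^sup>2) * exp B) = p powr (- (\<mu> + 1)) * exp ((\<alpha> + \<beta>) / p) * besE \<mu> (\<alpha> * \<beta> / p\<^sup>2)"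
    by (simp add: A_def B_def add_divide_distrib exp_add)
  finally show ?thesis using int' by (simp add: has_bochner_integral_iff w_def)
qed

section \<open>Polar coordinates\<close>

lemma nn_integral_lborel_scaleR:
  fixes f :: "'a::euclidean_space \<Rightarrow> ennreal"
  assumes [measurable]: "f \<in> borel_measurable borel" and "c > 0"
  shows "(\<integral>\<^sup>+y. f y \<partial>lborel) = ennreal (c ^ DIM('a)) * (\<integral>\<^sup>+y. f (c *\<^sub>R y) \<partial>lborel)"
  using assms(2)
  by (subst lborel_affine[of c 0]) (simp_all add: nn_integral_density nn_integral_distr nn_integral_cmult ennreal_power)

text \<open>The surface integral over the unit sphere, encoded as a volume integral: integrating
  \<open>r ^ (dim - 1)\<close> over [0, 1] contributes 1 / dim, which the factor in front
  undoes.\<close>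

definition sphere_integral :: "('a::euclidean_space \<Rightarrow> real) \<Rightarrow> real" where
  "sphere_integral \<phi> = real DIM('a) * (LINT y|lborel. indicator (cball 0 1) y * \<phi> (sgn y))"

lemma borel_measurable_sgn_vec [measurable (raw)]:
  fixes f :: "'b \<Rightarrow> 'a::euclidean_space"
  assumes [measurable]: "f \<in> borel_measurable M"
  shows "(\<lambda>x. sgn (f x)) \<in> borel_measurable M"
  unfolding sgn_div_norm by measurable

lemma integrable_cball_sgn:
  fixes \<phi> :: "'a::euclidean_space \<Rightarrow> real"
  assumes [measurable]: "\<phi> \<in> borel_measurable borel" and "\<And>y. \<bar>\<phi> (sgn y)\<bar> \<le> C"
  shows "integrable lborel (\<lambda>y. indicator (cball 0 1) y * \<phi> (sgn y))"
proof (rule Bochner_Integration.integrable_bound)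
  have [measurable]: "cball (0::'a) 1 \<in> sets borel" by simp
  show "(\<lambda>y. indicator (cball 0 1) y * \<phi> (sgn y)) \<in> borel_measurable lborel" by measurable
  show "integrable lborel (\<lambda>y::'a. indicator (cball 0 1) y * C)"
    using emeasure_lborel_cball_finite[of "0::'a" 1]
    by (intro integrable_mult_left impI integrable_real_indicator) (auto simp: top_unique)
  show "AE y in lborel. norm (indicator (cball 0 1) y * \<phi> (sgn y)) \<le> norm (indicator (cball 0 1) y * C)"
    using assms(2) by (auto intro!: AE_I2 simp: indicator_def intro: order_trans[OF _ abs_ge_self])
qed

text \<open>The two measures are compared through their distribution functions. The points with
  \<open>norm y powr a\<close> at most u form a ball of radius \<open>u powr (1 / a)\<close>, and
  \<open>\<phi> (sgn y)\<close> is invariant under scaling, so their mass is a constant times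
  \<open>u powr (d / a)\<close>; the density is the derivative of that.\<close>

lemma distr_norm_powr_eq_density:
  fixes \<phi> :: "'a::euclidean_space \<Rightarrow> real" and a :: real
  assumes [measurable]: "\<phi> \<in> borel_measurable borel" and "\<And>y. 0 \<le> \<phi> y" "\<And>y. \<phi> (sgn y) \<le> C" "a > 0"
  shows "distr (density lborel (\<lambda>y. ennreal (\<phi> (sgn y)))) borel (\<lambda>y. norm y powr a) =
         density lborel (\<lambda>u. ennreal (sphere_integral \<phi> / a * (indicator {0<..} u * u powr (real DIM('a) / a - 1))))"
    (is "?M = ?N")
proof -
  define d where "d = real DIM('a)"
  have d: "d > 0" by (simp add: d_def)
  define V where "V = (LINT y|lborel. indicator (cball 0 1) y * \<phi> (sgn y))"
  have V: "ennreal V = (\<integral>\<^sup>+y. ennreal (indicator (cball 0 1) y * \<phi> (sgn y)) \<partial>lborel)"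
    unfolding V_def using assms
    by (intro nn_integral_eq_integral[symmetric] integrable_cball_sgn[of _ C]) auto
  have V_nonneg: "V \<ge> 0" unfolding V_def using assms(2) by (intro integral_nonneg_AE) auto
  have S: "sphere_integral \<phi> = d * V" by (simp add: sphere_integral_def V_def d_def)
  have emM: "emeasure ?M {..u} = (\<integral>\<^sup>+y. ennreal (indicator {..u} (norm y powr a) * \<phi> (sgn y)) \<partial>lborel)" for u
    using assms(2) by (simp add: emeasure_distr emeasure_density vimage_def)
       (auto intro!: nn_integral_cong simp: indicator_def)
  have M_eq: "emeasure ?M {..u} = (if u \<le> 0 then 0 else ennreal (V * u powr (d / a)))" for u
  proof -
    consider "u < 0" | "u = 0" | "u > 0" by linarith
    thus ?thesis
    proof cases
      case 1
      have "\<not> norm y powr a \<le> u" for y :: 'a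
        using 1 powr_ge_zero[of "norm y" a] by linarith
      thus ?thesis using 1 unfolding emM by (simp add: indicator_def)
    next
      case 2
      \<comment> \<open>For u = 0 the set is the origin alone, as \<open>0 powr a = 0\<close>, and a
        point is null.\<close>
      have "AE y in lborel. ennreal (indicator {..u} (norm y powr a) * \<phi> (sgn y)) = 0"
        using AE_lborel_singleton[of "0::'a"] by eventually_elim (use 2 in \<open>auto simp: indicator_def\<close>)
      thus ?thesis using 2 unfolding emM by (subst nn_integral_cong_AE) auto
    next
      case 3
      define R where "R = u powr (1 / a)"
      have R: "R > 0" using 3 by (simp add: R_def)
      have "R powr a = u" using 3 assms(4) by (simp add: R_def powr_powr)
      hence le: "norm (R *\<^sub>R y) powr a \<le> u \<longleftrightarrow> norm y \<le> 1" for y :: 'a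
        using R 3 assms(4) powr_le_cancel_iff[of "norm y" 1 a] powr_mono2[of a "norm y" 1]
          powr_less_mono2[of a 1 "norm y"]
        by (auto simp: powr_mult mult_le_cancel_left1 not_le[symmetric])
      have "emeasure ?M {..u} = ennreal (R ^ DIM('a)) * (\<integral>\<^sup>+y. ennreal (indicator {..u} (norm (R *\<^sub>R y) powr a) * \<phi> (sgn (R *\<^sub>R y))) \<partial>lborel)"
        unfolding emM by (rule nn_integral_lborel_scaleR) (use R in measurable)
      also have "(\<lambda>y. ennreal (indicator {..u} (norm (R *\<^sub>R y) powr a) * \<phi> (sgn (R *\<^sub>R y)))) =
                 (\<lambda>y. ennreal (indicator (cball 0 1) y * \<phi> (sgn y)))"
        using le R by (auto simp: indicator_def sgn_scaleR)
      also have "ennreal (R ^ DIM('a)) * (\<integral>\<^sup>+y. ennreal (indicator (cball 0 1) y * \<phi> (sgn y)) \<partial>lborel) = ennreal (R ^ DIM('a) * V)"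
        using R V_nonneg by (simp add: V[symmetric] ennreal_mult)
      also have "R ^ DIM('a) = u powr (d / a)"
        using R 3 by (simp add: R_def d_def powr_powr flip: powr_realpow)
      finally show ?thesis using 3 by (simp add: mult.commute)
    qed
  qed
  have emN: "emeasure ?N {..u} = (\<integral>\<^sup>+x. ennreal (indicator {0..u} x * (d * V / a * x powr (d / a - 1))) \<partial>lborel)" for u
    unfolding S d_def[symmetric] by (simp add: emeasure_density)
       (auto intro!: nn_integral_cong simp: indicator_def)
  have N_eq: "emeasure ?N {..u} = (if u \<le> 0 then 0 else ennreal (V * u powr (d / a)))" for u
  proof (cases "u \<le> 0")
    case True
    have "ennreal (indicator {0..u} x * (d * V / a * x powr (d / a - 1))) = 0" for x
      using True by (cases "x = 0") (auto simp: indicator_def)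
    thus ?thesis using True unfolding emN by simp
  next
    case False
    have "((\<lambda>x. d * V / a * x powr (d / a - 1)) has_integral (d * V / a * (u powr (d / a - 1 + 1) / (d / a - 1 + 1)))) {0..u}"
      using False d assms by (intro has_integral_mult_right has_integral_powr_from_0) auto
    hence "emeasure ?N {..u} = ennreal (d * V / a * (u powr (d / a - 1 + 1) / (d / a - 1 + 1)))"
      unfolding emN using V_nonneg d assms by (intro nn_integral_has_integral_lebesgue) auto
    thus ?thesis using False d assms by simp
  qed
  show "?M = ?N"
  proof (rule measure_eqI_generator_eq[where E = "range (\<lambda>u. {..u})" and \<Omega> = UNIV and A = "\<lambda>n. {..real n}"])
    show "Int_stable (range (\<lambda>u::real. {..u}))" by (auto simp: Int_stable_def)
    show "sets ?M = sigma_sets UNIV (range (\<lambda>u. {..u}))" by (simp add: borel_eq_atMost)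
    show "sets ?N = sigma_sets UNIV (range (\<lambda>u. {..u}))" by (simp add: borel_eq_atMost)
    show "(\<Union>i. {..real i}) = UNIV" using real_arch_simple by auto
    show "emeasure ?M X = emeasure ?N X" if "X \<in> range (\<lambda>u. {..u})" for X
      using that by (auto simp only: M_eq N_eq)
    show "emeasure ?M {..real i} \<noteq> \<infinity>" for i
      by (simp only: M_eq) simp
  qed auto
qed

lemma polar_integral_nonneg:
  fixes \<phi> :: "'a::euclidean_space \<Rightarrow> real" and a :: real and f :: "real \<Rightarrow> real"
  assumes [measurable]: "\<phi> \<in> borel_measurable borel" "f \<in> borel_measurable borel"
    and "\<And>y. 0 \<le> \<phi> y" "\<And>y. \<phi> (sgn y) \<le> C" "a > 0"
    and int: "has_bochner_integral lborel (\<lambda>u. indicator {0<..} u * u powr (real DIM('a) / a - 1) * f u) I"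
  shows "has_bochner_integral lborel (\<lambda>y. \<phi> (sgn y) * f (norm y powr a)) (sphere_integral \<phi> / a * I)"
proof -
  define M where "M = density lborel (\<lambda>y. ennreal (\<phi> (sgn y)))"
  define N where "N = density lborel (\<lambda>u. ennreal (sphere_integral \<phi> / a * (indicator {0<..} u * u powr (real DIM('a) / a - 1))))"
  have eq: "distr M borel (\<lambda>y. norm y powr a) = N"
    unfolding M_def N_def by (intro distr_norm_powr_eq_density[of _ C] assms)
  have [measurable_cong]: "sets M = sets borel" by (simp add: M_def)
  have nn: "sphere_integral \<phi> \<ge> 0"
    unfolding sphere_integral_def using assms(3) by (intro mult_nonneg_nonneg integral_nonneg_AE) auto
  have "has_bochner_integral lborel (\<lambda>u. sphere_integral \<phi> / a * (indicator {0<..} u * u powr (real DIM('a) / a - 1) * f u)) (sphere_integral \<phi> / a * I)"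
    using int by (rule has_bochner_integral_mult_right)
  hence "has_bochner_integral lborel (\<lambda>u. (sphere_integral \<phi> / a * (indicator {0<..} u * u powr (real DIM('a) / a - 1))) *\<^sub>R f u) (sphere_integral \<phi> / a * I)"
    by (simp add: mult.assoc)
  hence "has_bochner_integral N f (sphere_integral \<phi> / a * I)"
    unfolding N_def using nn assms(5) by (intro has_bochner_integral_density) auto
  hence "has_bochner_integral M (\<lambda>y. f (norm y powr a)) (sphere_integral \<phi> / a * I)"
    unfolding eq[symmetric] by (simp add: has_bochner_integral_iff integrable_distr_eq integral_distr)
  thus ?thesis unfolding M_def has_bochner_integral_iff
    using assms(3) by (simp add: integrable_density integral_density)
qed

lemma sphere_integral_add:
  fixes \<phi> \<psi> :: "'a::euclidean_space \<Rightarrow> real"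
  assumes "\<phi> \<in> borel_measurable borel" "\<And>y. \<bar>\<phi> (sgn y)\<bar> \<le> C"
    and "\<psi> \<in> borel_measurable borel" "\<And>y. \<bar>\<psi> (sgn y)\<bar> \<le> D"
  shows "sphere_integral (\<lambda>y. \<phi> y + \<psi> y) = sphere_integral \<phi> + sphere_integral \<psi>"
  unfolding sphere_integral_def ring_distribs
  by (subst Bochner_Integration.integral_add)
     (auto intro!: integrable_cball_sgn assms simp: ring_distribs)

lemma sphere_integral_cmult: "sphere_integral (\<lambda>y. c * \<phi> y) = c * sphere_integral \<phi>"
proof -
  have "(LINT y|lborel. indicator (cball 0 1) y * (c * \<phi> (sgn y))) = (LINT y|lborel. c * (indicator (cball 0 1) y * \<phi> (sgn y)))"
    by (simp add: mult_ac)
  thus ?thesis by (simp add: sphere_integral_def)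
qed

text \<open>The pushforward argument uses \<phi> as a density, hence nonnegative; a signed \<phi> is
  split into its positive and negative parts.\<close>

lemma polar_integral:
  fixes \<phi> :: "'a::euclidean_space \<Rightarrow> real" and a :: real and f :: "real \<Rightarrow> real"
  assumes [measurable]: "\<phi> \<in> borel_measurable borel" "f \<in> borel_measurable borel"
    and bound: "\<And>y. \<bar>\<phi> (sgn y)\<bar> \<le> C" and "a > 0"
    and int: "has_bochner_integral lborel (\<lambda>u. indicator {0<..} u * u powr (real DIM('a) / a - 1) * f u) I"
  shows "has_bochner_integral lborel (\<lambda>y. \<phi> (sgn y) * f (norm y powr a)) (sphere_integral \<phi> / a * I)"
proof -
  define p where "p y = max 0 (\<phi> y)" for y
  define n where "n y = max 0 (- \<phi> y)" for y
  have m [measurable]: "p \<in> borel_measurable borel" "n \<in> borel_measurable borel"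
    unfolding p_def[abs_def] n_def[abs_def] by measurable
  have b: "p (sgn y) \<le> C" "n (sgn y) \<le> C" "\<bar>p (sgn y)\<bar> \<le> C" "\<bar>- 1 * n (sgn y)\<bar> \<le> C" for y
    using bound[of y] by (auto simp: p_def n_def)
  have eq: "\<phi> y = p y + (- 1) * n y" for y by (simp add: p_def n_def)
  have "sphere_integral (\<lambda>y. p y + (- 1) * n y) = sphere_integral p + sphere_integral (\<lambda>y. (- 1) * n y)"
    using b(3,4) by (intro sphere_integral_add[where \<phi> = p and \<psi> = "\<lambda>y. (- 1) * n y" and C = C and D = C]) auto
  hence S: "sphere_integral \<phi> = sphere_integral p + (- 1) * sphere_integral n"
    unfolding eq[abs_def, symmetric] sphere_integral_cmult .
  have "has_bochner_integral lborel (\<lambda>y. p (sgn y) * f (norm y powr a) - n (sgn y) * f (norm y powr a))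
     (sphere_integral p / a * I - sphere_integral n / a * I)"
    using b(1,2) assms(4) int
    by (intro has_bochner_integral_diff polar_integral_nonneg[where C = C])
       (auto simp: p_def[abs_def] n_def[abs_def])
  thus ?thesis unfolding S eq by (simp add: algebra_simps diff_divide_distrib)
qed

lemma sphere_integral_sum:
  fixes \<phi> :: "'i \<Rightarrow> 'a::euclidean_space \<Rightarrow> real"
  assumes "finite I" and [measurable]: "\<And>i. \<phi> i \<in> borel_measurable borel" and "\<And>i y. \<bar>\<phi> i (sgn y)\<bar> \<le> C i"
  shows "sphere_integral (\<lambda>y. \<Sum>i\<in>I. \<phi> i y) = (\<Sum>i\<in>I. sphere_integral (\<phi> i))"
  using assms(1)
proof (induction I)
  case (insert i I)
  have "\<bar>\<Sum>i\<in>I. \<phi> i (sgn y)\<bar> \<le> (\<Sum>i\<in>I. C i)" for y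
    by (rule order_trans[OF sum_abs sum_mono]) (rule assms)
  thus ?case using insert
    by (simp, subst sphere_integral_add[where C = "C i" and D = "\<Sum>i\<in>I. C i"]) (auto simp: assms)
qed (simp add: sphere_integral_def)

lemma sphere_integral_one_pos: "sphere_integral (\<lambda>_::'a::euclidean_space. 1) > 0"
proof -
  have "measure lborel (cball (0::'a) 1) > 0"
    using content_cball_pos[of 1 "0::'a"] by simp
  thus ?thesis by (simp add: sphere_integral_def)
qed

section \<open>Gaussian moments\<close>

text \<open>Once the lower coefficients vanish, division by \<open>x ^ n\<close> leaves a power
  series that is 0 away from the origin; by continuity it is 0 there too, and its value at the
  origin is c n.\<close>

lemma power_series_zero_imp_zero:
  fixes c :: "nat \<Rightarrow> real"
  assumes "\<And>x. (\<lambda>n. c n * x ^ n) sums 0"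
  shows "c n = 0"
proof (induction n rule: less_induct)
  case (less n)
  define g where "g x = (\<Sum>i. c (i + n) * x ^ i)" for x
  have sums: "(\<lambda>i. c (i + n) * x ^ i) sums 0" if "x \<noteq> 0" for x
  proof -
    have "(\<lambda>i. c (i + n) * x ^ (i + n)) sums 0"
      using assms[of x] less by (subst sums_zero_iff_shift) auto
    from sums_mult[OF this, of "1 / x ^ n"] that show ?thesis
      by (simp add: power_add)
  qed
  have "isCont g 0"
    unfolding g_def[abs_def] using sums[of 1] by (intro isCont_powser[of _ 1]) (auto simp: sums_iff)
  hence "(g \<longlongrightarrow> g 0) (at 0)" by (simp add: isCont_def)
  moreover have "\<forall>\<^sub>F x in at 0. g x = 0"
    using sums by (auto simp: eventually_at_filter g_def sums_iff)
  hence "(g \<longlongrightarrow> 0) (at 0)" by (simp add: tendsto_eventually)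
  ultimately have "g 0 = 0" using tendsto_unique[of "at (0::real)"] by auto
  moreover have "g 0 = c n" by (simp add: g_def)
  ultimately show "c n = 0" by simp
qed

lemma power_series_unique:
  fixes a b :: "nat \<Rightarrow> real"
  assumes "\<And>x. (\<lambda>n. a n * x ^ n) sums F x" "\<And>x. (\<lambda>n. b n * x ^ n) sums F x"
  shows "a n = b n"
proof -
  have "(\<lambda>n. (a n - b n) * x ^ n) sums 0" for x
    using sums_diff[OF assms(1)[of x] assms(2)[of x]] by (simp add: algebra_simps)
  from power_series_zero_imp_zero[OF this, of n] show ?thesis by simp
qed

text \<open>The exponential series may be integrated termwise because \<open>exp |r * X|\<close> is
  at most \<open>exp (r * X) + exp (- r * X)\<close>, so exponential moments for both signs of r
  dominate all partial sums.\<close>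

lemma
  fixes X g :: "'a \<Rightarrow> real"
  assumes [measurable]: "X \<in> borel_measurable M" "g \<in> borel_measurable M"
    and int: "\<And>r. integrable M (\<lambda>x. exp (r * X x) * g x)"
  shows integrable_power_mult: "integrable M (\<lambda>x. X x ^ j * g x)"
    and sums_exp_moments: "(\<lambda>j. (\<integral>x. X x ^ j * g x \<partial>M) / fact j * r ^ j) sums (\<integral>x. exp (r * X x) * g x \<partial>M)"
proof -
  have *: "integrable M (\<lambda>x. (r * X x) ^ j / fact j * g x)"
    "(\<lambda>j. \<integral>x. (r * X x) ^ j / fact j * g x \<partial>M) sums (\<integral>x. exp (r * X x) * g x \<partial>M)" for r j
  proof -
    define f where "f j x = (r * X x) ^ j / fact j * g x" for j x
    have [measurable]: "f j \<in> borel_measurable M" for j unfolding f_def[abs_def] by measurable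
    have abs_f: "\<bar>f j x\<bar> = \<bar>r * X x\<bar> ^ j / fact j * \<bar>g x\<bar>" for j x
      by (simp add: f_def abs_mult power_abs)
    have 1: "(\<lambda>j. f j x) sums (exp (r * X x) * g x)" for x
      unfolding f_def by (intro sums_mult2 exp_sums_real)
    have 2: "(\<lambda>j. \<bar>f j x\<bar>) sums (exp \<bar>r * X x\<bar> * \<bar>g x\<bar>)" for x
      unfolding abs_f by (intro sums_mult2 exp_sums_real)
    have 3: "integrable M (\<lambda>x. \<Sum>j. \<bar>f j x\<bar>)"
    proof (rule Bochner_Integration.integrable_bound)
      show "integrable M (\<lambda>x. \<bar>exp (r * X x) * g x\<bar> + \<bar>exp ((- r) * X x) * g x\<bar>)"
        by (intro Bochner_Integration.integrable_add integrable_abs int)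
      have "exp \<bar>r * X x\<bar> * \<bar>g x\<bar> \<le> exp (r * X x) * \<bar>g x\<bar> + exp (- (r * X x)) * \<bar>g x\<bar>" for x
        by (cases "r * X x \<ge> 0") (auto simp: abs_if)
      thus "AE x in M. norm (\<Sum>j. \<bar>f j x\<bar>) \<le> norm (\<bar>exp (r * X x) * g x\<bar> + \<bar>exp ((- r) * X x) * g x\<bar>)"
        using 2 by (auto simp: sums_iff abs_mult)
    qed measurable
    show "integrable M (\<lambda>x. (r * X x) ^ j / fact j * g x)"
    proof -
      have "integrable M (f j)"
        by (rule integrable_series_term) (use 2 3 in \<open>auto simp: sums_iff\<close>)
      thus ?thesis by (simp only: f_def[abs_def])
    qed
    show "(\<lambda>j. \<integral>x. (r * X x) ^ j / fact j * g x \<partial>M) sums (\<integral>x. exp (r * X x) * g x \<partial>M)"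
    proof -
      have "(\<lambda>j. \<integral>x. f j x \<partial>M) sums (\<integral>x. (\<Sum>j. f j x) \<partial>M)"
        by (rule sums_integral_series) (use 2 3 in \<open>auto simp: sums_iff\<close>)
      also have "(\<lambda>x. \<Sum>j. f j x) = (\<lambda>x. exp (r * X x) * g x)"
        using 1 by (auto simp: sums_iff fun_eq_iff)
      finally show ?thesis by (simp only: f_def)
    qed
  qed
  have "integrable M (\<lambda>x. fact j * ((1 * X x) ^ j / fact j * g x))"
    by (intro integrable_mult_right *)
  thus "integrable M (\<lambda>x. X x ^ j * g x)" by simp
  have "(\<integral>x. (r * X x) ^ j / fact j * g x \<partial>M) = (\<integral>x. X x ^ j * g x \<partial>M) / fact j * r ^ j" for j
  proof -
    have "(\<integral>x. (r * X x) ^ j / fact j * g x \<partial>M) = (\<integral>x. (r ^ j / fact j) * (X x ^ j * g x) \<partial>M)"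
      by (simp add: power_mult_distrib mult_ac)
    thus ?thesis by simp
  qed
  with *(2)[of r] show "(\<lambda>j. (\<integral>x. X x ^ j * g x \<partial>M) / fact j * r ^ j) sums (\<integral>x. exp (r * X x) * g x \<partial>M)"
    by simp
qed

text \<open>Taylor coefficients of exp(r^2/4), the exponential moments of the normalized Gaussian
  weight exp(-|y|^2) in a unit direction.\<close>

definition gauss_coeff :: "nat \<Rightarrow> real" where
  "gauss_coeff n = (if even n then (1 / 4) ^ (n div 2) / fact (n div 2) else 0)"

lemma gauss_coeff_sums: "(\<lambda>n. gauss_coeff n * r ^ n) sums exp (r\<^sup>2 / 4)"
proof -
  have "(\<lambda>n. gauss_coeff (2 * n) * r ^ (2 * n)) sums exp (r\<^sup>2 / 4)"
    using exp_sums_real[of "r\<^sup>2 / 4"] by (simp add: gauss_coeff_def power_mult power_divide)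
  thus ?thesis
    by (subst (asm) sums_mono_reindex[of "\<lambda>n. 2 * n" "\<lambda>n. gauss_coeff n * r ^ n"])
       (auto simp: strict_mono_def gauss_coeff_def elim!: evenE)
qed

lemma gauss_exp_sums:
  "(\<lambda>j. (\<Sum>e\<le>j. x ^ e / fact e * gauss_coeff (j - e)) * r ^ j) sums exp (r * x + r\<^sup>2 / 4)"
proof -
  have "(\<lambda>k. \<Sum>e\<le>k. ((r * x) ^ e / fact e) * (gauss_coeff (k - e) * r ^ (k - e))) sums
      ((\<Sum>k. (r * x) ^ k / fact k) * (\<Sum>k. gauss_coeff k * r ^ k))"
  proof (rule Cauchy_product_sums)
    show "summable (\<lambda>k. norm ((r * x) ^ k / fact k))"
      using sums_summable[OF exp_sums_real[of "\<bar>r * x\<bar>"]] by (simp add: power_abs)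
    show "summable (\<lambda>k. norm (gauss_coeff k * r ^ k))"
      using sums_summable[OF gauss_coeff_sums[of "\<bar>r\<bar>"]]
      by (rule back_subst[of summable]) (auto simp: abs_mult power_abs gauss_coeff_def)
  qed
  also have "(\<Sum>k. (r * x) ^ k / fact k) = exp (r * x)" using exp_sums_real by (rule sums_unique[symmetric])
  also have "(\<Sum>k. gauss_coeff k * r ^ k) = exp (r\<^sup>2 / 4)" using gauss_coeff_sums by (rule sums_unique[symmetric])
  also have "(\<lambda>k. \<Sum>e\<le>k. ((r * x) ^ e / fact e) * (gauss_coeff (k - e) * r ^ (k - e))) =
             (\<lambda>j. (\<Sum>e\<le>j. x ^ e / fact e * gauss_coeff (j - e)) * r ^ j)"
  proof
    fix k
    have "((r * x) ^ e / fact e) * (gauss_coeff (k - e) * r ^ (k - e)) = x ^ e / fact e * gauss_coeff (k - e) * r ^ k"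
      if "e \<le> k" for e
    proof -
      have "r ^ k = r ^ e * r ^ (k - e)" using that by (simp flip: power_add)
      thus ?thesis by (simp add: power_mult_distrib)
    qed
    thus "(\<Sum>e\<le>k. ((r * x) ^ e / fact e) * (gauss_coeff (k - e) * r ^ (k - e))) =
          (\<Sum>e\<le>k. x ^ e / fact e * gauss_coeff (k - e)) * r ^ k"
      unfolding sum_distrib_right by (intro sum.cong) auto
  qed
  finally show ?thesis by (simp add: exp_add)
qed

definition gauss_total :: "'a::euclidean_space itself \<Rightarrow> real" where
  "gauss_total _ = (LINT y|lborel. exp (- (norm (y::'a))\<^sup>2))"

text \<open>Polar coordinates with exponent 2. A function homogeneous of degree n is its value at
  the direction times \<open>norm y ^ n\<close>, so this converts Gaussian moments into spherical
  ones; the Gamma factor depends only on the dimension and the degree n.\<close>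

lemma gauss_polar:
  fixes \<phi> :: "'a::euclidean_space \<Rightarrow> real"
  assumes [measurable]: "\<phi> \<in> borel_measurable borel" and "\<And>y. \<bar>\<phi> (sgn y)\<bar> \<le> C"
  shows "has_bochner_integral lborel (\<lambda>y. \<phi> (sgn y) * (norm y ^ n * exp (- (norm y)\<^sup>2)))
           (sphere_integral \<phi> / 2 * Gamma ((real DIM('a) + real n) / 2))"
proof -
  let ?s = "(real DIM('a) + real n) / 2"
  have "indicator {0<..} u * u powr (real DIM('a) / 2 - 1) * (u powr (real n / 2) * exp (- u)) =
        indicator {0<..} u * (u powr (?s - 1) * exp (- 1 * u))" for u :: real
  proof -
    have "?s - 1 = (real DIM('a) / 2 - 1) + real n / 2" by (simp add: field_simps)
    thus ?thesis by (simp only: powr_add) simp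
  qed
  moreover have "?s > 0" using DIM_positive[where 'a='a] by (simp add: add_pos_nonneg del: DIM_positive)
  ultimately have "has_bochner_integral lborel (\<lambda>u. indicator {0<..} u * u powr (real DIM('a) / 2 - 1) * (u powr (real n / 2) * exp (- u)))
     (Gamma ?s * 1 powr (- ?s))"
    using has_bochner_integral_Gamma[of ?s 1] by (simp only:)
  hence "has_bochner_integral lborel (\<lambda>y. \<phi> (sgn y) * ((norm y powr 2) powr (real n / 2) * exp (- (norm y powr 2))))
      (sphere_integral \<phi> / 2 * (Gamma ?s * 1 powr (- ?s)))"
    using assms(2) by (intro polar_integral[where C = C]) auto
  \<comment> \<open>Equality holds only almost everywhere: at y = 0 with n = 0 the left side
    contains \<open>0 powr 0 = 0\<close> and the right side \<open>0 ^ 0 = 1\<close>.\<close>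
  moreover have "AE y in lborel. \<phi> (sgn y) * ((norm y powr 2) powr (real n / 2) * exp (- (norm y powr 2))) = \<phi> (sgn y) * (norm y ^ n * exp (- (norm y)\<^sup>2))"
    using AE_lborel_singleton[of "0::'a"]
  proof eventually_elim
    case (elim y)
    have "(norm y powr 2) powr (real n / 2) = norm y powr (2 * (real n / 2))" by (rule powr_powr)
    also have "\<dots> = norm y ^ n" using elim by (simp add: powr_realpow)
    finally have "(norm y powr 2) powr (real n / 2) = norm y ^ n" .
    moreover have "norm y powr 2 = (norm y)\<^sup>2" using elim by simp
    ultimately show ?case by (simp only:)
  qed
  ultimately show ?thesis
    by (subst has_bochner_integral_cong_AE[symmetric, rotated 2]) auto
qed

lemma has_bochner_integral_gauss:
  "has_bochner_integral lborel (\<lambda>y::'a::euclidean_space. exp (- (norm y)\<^sup>2)) (gauss_total TYPE('a))"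
  using gauss_polar[where \<phi> = "\<lambda>_::'a. 1" and C = 1 and n = 0]
  unfolding gauss_total_def has_bochner_integral_iff by simp

lemma gauss_total_eq: "gauss_total TYPE('a::euclidean_space) = sphere_integral (\<lambda>_::'a. 1) / 2 * Gamma (real DIM('a) / 2)"
  using gauss_polar[where \<phi> = "\<lambda>_::'a. 1" and C = 1 and n = 0]
  unfolding gauss_total_def has_bochner_integral_iff by simp

text \<open>Completing the square: the Gaussian is translated by w/2.\<close>

lemma has_bochner_integral_exp_gauss:
  fixes w :: "'a::euclidean_space"
  shows "has_bochner_integral lborel (\<lambda>y. exp (w \<bullet> y) * exp (- (norm y)\<^sup>2)) (gauss_total TYPE('a) * exp ((norm w)\<^sup>2 / 4))"
proof -
  have "has_bochner_integral (distr lborel borel ((+) (- (1/2) *\<^sub>R w))) (\<lambda>y::'a. exp (- (norm y)\<^sup>2)) (gauss_total TYPE('a))"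
    unfolding lborel_distr_plus by (rule has_bochner_integral_gauss)
  hence "has_bochner_integral lborel (\<lambda>y::'a. exp (- (norm (- (1/2) *\<^sub>R w + y))\<^sup>2)) (gauss_total TYPE('a))"
    by (simp add: has_bochner_integral_iff integrable_distr_eq integral_distr)
  hence "has_bochner_integral lborel (\<lambda>y::'a. exp ((norm w)\<^sup>2 / 4) * exp (- (norm (- (1/2) *\<^sub>R w + y))\<^sup>2)) (exp ((norm w)\<^sup>2 / 4) * gauss_total TYPE('a))"
    by (rule has_bochner_integral_mult_right)
  moreover have "exp ((norm w)\<^sup>2 / 4) * exp (- (norm (- (1/2) *\<^sub>R w + y))\<^sup>2) = exp (w \<bullet> y) * exp (- (norm y)\<^sup>2)" for y
  proof -
    have "(norm w)\<^sup>2 / 4 - (norm (- (1/2) *\<^sub>R w + y))\<^sup>2 = w \<bullet> y - (norm y)\<^sup>2"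
      by (simp add: power2_norm_eq_inner inner_simps inner_commute algebra_simps)
    thus ?thesis by (simp flip: exp_add)
  qed
  ultimately show ?thesis by (simp add: mult.commute)
qed

text \<open>The coefficient of r^j s^k in exp(r^2/4 + s^2/4 + r s (\<omega> \<bullet> \<zeta>)/2),
  extracted in r and then in s. As in Wick's formula, e counts the pairings between the two linear
  forms.\<close>

lemma gauss_moments:
  fixes \<omega> \<zeta> :: "'a::euclidean_space"
  assumes "norm \<omega> = 1" "norm \<zeta> = 1"
  shows "(LINT y|lborel. (\<omega> \<bullet> y) ^ j * ((\<zeta> \<bullet> y) ^ k * exp (- (norm y)\<^sup>2))) =
     gauss_total TYPE('a) * fact j * fact k *
       (\<Sum>e\<le>min j k. ((\<omega> \<bullet> \<zeta>) / 2) ^ e / fact e * gauss_coeff (j - e) * gauss_coeff (k - e))"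
proof -
  let ?t = "\<omega> \<bullet> \<zeta>" and ?T = "gauss_total TYPE('a)"
  have nrm: "(norm (r *\<^sub>R \<omega> + s *\<^sub>R \<zeta>))\<^sup>2 / 4 = r\<^sup>2 / 4 + s\<^sup>2 / 4 + r * (s * ?t / 2)" for r s
    using assms unfolding power2_norm_eq_inner norm_eq_1
    by (simp add: inner_simps inner_commute power2_eq_square algebra_simps)
  have base: "has_bochner_integral lborel (\<lambda>y. exp (r * (\<omega> \<bullet> y)) * (exp (s * (\<zeta> \<bullet> y)) * exp (- (norm y)\<^sup>2)))
       (?T * exp (s\<^sup>2 / 4) * exp (r * (s * ?t / 2) + r\<^sup>2 / 4))" for r s
    using has_bochner_integral_exp_gauss[of "r *\<^sub>R \<omega> + s *\<^sub>R \<zeta>"]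
    unfolding nrm by (simp add: inner_simps exp_add mult_ac)
  \<comment> \<open>A moment in \<omega> must still have exponential moments in \<zeta>, so that
    coefficients in s can be extracted as well.\<close>
  have 1: "integrable lborel (\<lambda>y. (\<omega> \<bullet> y) ^ j * (exp (s * (\<zeta> \<bullet> y)) * exp (- (norm y)\<^sup>2)))" for j s
    by (rule integrable_power_mult) (use base in \<open>auto simp: has_bochner_integral_iff\<close>)
  have "(LINT y|lborel. (\<omega> \<bullet> y) ^ j * (exp (s * (\<zeta> \<bullet> y)) * exp (- (norm y)\<^sup>2))) / fact j =
      ?T * exp (s\<^sup>2 / 4) * (\<Sum>e\<le>j. (s * ?t / 2) ^ e / fact e * gauss_coeff (j - e))" for s
  proof (rule power_series_unique[where F = "\<lambda>r. ?T * exp (s\<^sup>2 / 4) * exp (r * (s * ?t / 2) + r\<^sup>2 / 4)"])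
    fix r
    show "(\<lambda>j. (LINT y|lborel. (\<omega> \<bullet> y) ^ j * (exp (s * (\<zeta> \<bullet> y)) * exp (- (norm y)\<^sup>2))) / fact j * r ^ j) sums
       (?T * exp (s\<^sup>2 / 4) * exp (r * (s * ?t / 2) + r\<^sup>2 / 4))"
      using base sums_exp_moments[of "\<lambda>y. \<omega> \<bullet> y" lborel "\<lambda>y. exp (s * (\<zeta> \<bullet> y)) * exp (- (norm y)\<^sup>2)" r]
      by (auto simp: has_bochner_integral_iff)
    show "(\<lambda>j. ?T * exp (s\<^sup>2 / 4) * (\<Sum>e\<le>j. (s * ?t / 2) ^ e / fact e * gauss_coeff (j - e)) * r ^ j) sums
       (?T * exp (s\<^sup>2 / 4) * exp (r * (s * ?t / 2) + r\<^sup>2 / 4))"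
      using sums_mult[OF gauss_exp_sums[of "s * ?t / 2" r], of "?T * exp (s\<^sup>2 / 4)"] by (simp only: mult.assoc)
  qed
  hence 2: "(LINT y|lborel. exp (s * (\<zeta> \<bullet> y)) * ((\<omega> \<bullet> y) ^ j * exp (- (norm y)\<^sup>2))) =
      ?T * fact j * (\<Sum>e\<le>j. (?t / 2) ^ e / fact e * gauss_coeff (j - e) * (s ^ e * exp (s\<^sup>2 / 4)))" for s
    by (simp add: field_simps sum_distrib_left sum_distrib_right power_mult_distrib power_divide)
  have "(LINT y|lborel. (\<zeta> \<bullet> y) ^ k * ((\<omega> \<bullet> y) ^ j * exp (- (norm y)\<^sup>2))) / fact k =
     ?T * fact j * (\<Sum>e\<le>j. (?t / 2) ^ e / fact e * gauss_coeff (j - e) * (if e \<le> k then gauss_coeff (k - e) else 0))"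
  proof (rule power_series_unique[where n = k and a = "\<lambda>k. (LINT y|lborel. (\<zeta> \<bullet> y) ^ k * ((\<omega> \<bullet> y) ^ j * exp (- (norm y)\<^sup>2))) / fact k"
      and b = "\<lambda>k. ?T * fact j * (\<Sum>e\<le>j. (?t / 2) ^ e / fact e * gauss_coeff (j - e) * (if e \<le> k then gauss_coeff (k - e) else 0))" and F = "\<lambda>s. ?T * fact j * (\<Sum>e\<le>j. (?t / 2) ^ e / fact e * gauss_coeff (j - e) * (s ^ e * exp (s\<^sup>2 / 4)))"])
    fix s
    show "(\<lambda>k. (LINT y|lborel. (\<zeta> \<bullet> y) ^ k * ((\<omega> \<bullet> y) ^ j * exp (- (norm y)\<^sup>2))) / fact k * s ^ k) sums
       (?T * fact j * (\<Sum>e\<le>j. (?t / 2) ^ e / fact e * gauss_coeff (j - e) * (s ^ e * exp (s\<^sup>2 / 4))))"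
      unfolding 2[symmetric]
    proof (rule sums_exp_moments)
      show "integrable lborel (\<lambda>y. exp (r * (\<zeta> \<bullet> y)) * ((\<omega> \<bullet> y) ^ j * exp (- (norm y)\<^sup>2)))" for r
        using 1[of j r] by (simp add: mult_ac)
    qed auto
    \<comment> \<open>The factor \<open>s ^ e\<close> shifts the index by e, so the coefficients
      with k < e are 0.\<close>
    have shift: "(\<lambda>k. (if e \<le> k then gauss_coeff (k - e) else 0) * s ^ k) sums (s ^ e * exp (s\<^sup>2 / 4))" for e
    proof -
      have "(\<lambda>i. (if e \<le> i + e then gauss_coeff (i + e - e) else 0) * s ^ (i + e)) sums (s ^ e * exp (s\<^sup>2 / 4))"
        using sums_mult[OF gauss_coeff_sums[of s], of "s ^ e"] by (simp add: power_add mult_ac)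
      thus ?thesis by (subst (asm) sums_zero_iff_shift) auto
    qed
    have "(\<lambda>k. ?T * fact j * (\<Sum>e\<le>j. (?t / 2) ^ e / fact e * gauss_coeff (j - e) * ((if e \<le> k then gauss_coeff (k - e) else 0) * s ^ k)))
      sums (?T * fact j * (\<Sum>e\<le>j. (?t / 2) ^ e / fact e * gauss_coeff (j - e) * (s ^ e * exp (s\<^sup>2 / 4))))"
      by (intro sums_mult sums_sum shift)
    thus "(\<lambda>k. ?T * fact j * (\<Sum>e\<le>j. (?t / 2) ^ e / fact e * gauss_coeff (j - e) * (if e \<le> k then gauss_coeff (k - e) else 0)) * s ^ k)
      sums (?T * fact j * (\<Sum>e\<le>j. (?t / 2) ^ e / fact e * gauss_coeff (j - e) * (s ^ e * exp (s\<^sup>2 / 4))))"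
      by (simp only: sum_distrib_right mult.assoc)
  qed
  also have "(\<Sum>e\<le>j. (?t / 2) ^ e / fact e * gauss_coeff (j - e) * (if e \<le> k then gauss_coeff (k - e) else 0)) =
      (\<Sum>e\<le>min j k. (?t / 2) ^ e / fact e * gauss_coeff (j - e) * gauss_coeff (k - e))"
    by (rule sum.mono_neutral_cong_right) auto
  finally show ?thesis by (simp add: field_simps)
qed

section \<open>Gegenbauer polynomials\<close>

text \<open>The classical Gegenbauer polynomials. All computations are done with them at \<kappa> =
  \<nu> + 1, since each \<open>norm_Gegenbauer\<close> is a difference of two of them.\<close>

definition gegenbauer_U :: "real \<Rightarrow> real \<Rightarrow> nat \<Rightarrow> real" where
  "gegenbauer_U \<kappa> t m = fps_nth (fps_binomial (- \<kappa>) oo (fps_X ^ 2 - fps_const (2 * t) * fps_X)) m"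

lemma norm_Gegenbauer_eq:
  "norm_Gegenbauer \<nu> m t = gegenbauer_U (\<nu> + 1) t m - (if m < 2 then 0 else gegenbauer_U (\<nu> + 1) t (m - 2))"
  unfolding norm_Gegenbauer_def gegenbauer_U_def
  by (simp add: left_diff_distrib fps_X_power_mult_nth)

text \<open>Coefficients of x^(m+1) in the differential equation (1 + Q) W' = -\<kappa> Q' W for the
  generating function W, the power -\<kappa> of 1 + Q.\<close>

lemma gegenbauer_U_rec:
  "real (m + 2) * gegenbauer_U \<kappa> t (m + 2) =
     2 * (real m + 1 + \<kappa>) * t * gegenbauer_U \<kappa> t (m + 1) - (real m + 2 * \<kappa>) * gegenbauer_U \<kappa> t m"
  and gegenbauer_U_0: "gegenbauer_U \<kappa> t 0 = 1"
  and gegenbauer_U_1: "gegenbauer_U \<kappa> t 1 = 2 * \<kappa> * t"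
proof -
  define Q :: "real fps" where "Q = fps_X ^ 2 - fps_const (2 * t) * fps_X"
  define W where "W = fps_binomial (- \<kappa>) oo Q"
  have Q0: "fps_nth Q 0 = 0" by (simp add: Q_def)
  \<comment> \<open>The equation is known for the binomial series itself; composing with Q and
    multiplying by Q' gives the one for W by the chain rule.\<close>
  have "(1 + fps_X) * fps_deriv (fps_binomial (- \<kappa>)) = fps_const (- \<kappa>) * fps_binomial (- \<kappa>)"
    unfolding fps_binomial_deriv by (simp add: fps_divide_unit mult.commute[of "1 + fps_X"] mult.assoc inverse_mult_eq_1)
  hence "((1 + fps_X) * fps_deriv (fps_binomial (- \<kappa>))) oo Q = (fps_const (- \<kappa>) * fps_binomial (- \<kappa>)) oo Q"
    by simp
  hence "(1 + Q) * (fps_deriv (fps_binomial (- \<kappa>)) oo Q) = fps_const (- \<kappa>) * W"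
    using Q0 by (simp add: fps_compose_mult_distrib fps_compose_add_distrib W_def)
  hence "(1 + Q) * fps_deriv W = fps_const (- \<kappa>) * W * fps_deriv Q"
    using Q0 by (simp add: W_def fps_compose_deriv flip: mult.assoc)
  moreover have "fps_deriv Q = 2 * fps_X - fps_const (2 * t)"
    by (simp add: Q_def fps_deriv_power numeral_fps_const)
  ultimately have eq: "(1 + Q) * fps_deriv W = fps_const (- \<kappa>) * W * (2 * fps_X - fps_const (2 * t))"
    by simp
  have U: "gegenbauer_U \<kappa> t m = fps_nth W m" for m by (simp add: gegenbauer_U_def W_def Q_def)
  show U0: "gegenbauer_U \<kappa> t 0 = 1" by (simp add: U W_def)
  have L: "(1 + Q) * fps_deriv W = fps_deriv W + fps_X ^ 2 * fps_deriv W - fps_const (2 * t) * (fps_X * fps_deriv W)"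
    by (simp add: Q_def algebra_simps)
  have R: "fps_const (- \<kappa>) * W * (2 * fps_X - fps_const (2 * t)) = fps_const (- 2 * \<kappa>) * (fps_X * W) + fps_const (2 * \<kappa> * t) * W"
    by (simp add: algebra_simps numeral_fps_const fps_const_mult[symmetric] fps_const_neg[symmetric] del: fps_const_mult fps_const_neg)
  have "fps_nth ((1 + Q) * fps_deriv W) n = fps_nth (fps_const (- \<kappa>) * W * (2 * fps_X - fps_const (2 * t))) n" for n
    using eq by simp
  hence coeff: "fps_nth (fps_deriv W) n + fps_nth (fps_X ^ 2 * fps_deriv W) n - 2 * t * fps_nth (fps_X * fps_deriv W) n
       = - 2 * \<kappa> * fps_nth (fps_X * W) n + 2 * \<kappa> * t * fps_nth W n" for n
    unfolding L R by simp
  show "gegenbauer_U \<kappa> t 1 = 2 * \<kappa> * t"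
    using coeff[of 0] U0 by (simp add: U fps_X_power_mult_nth)
  show "real (m + 2) * gegenbauer_U \<kappa> t (m + 2) =
     2 * (real m + 1 + \<kappa>) * t * gegenbauer_U \<kappa> t (m + 1) - (real m + 2 * \<kappa>) * gegenbauer_U \<kappa> t m"
  proof -
    have "fps_nth (fps_deriv W) (m + 1) = real (m + 2) * fps_nth W (m + 2)"
      by simp
    moreover have "fps_nth (fps_X ^ 2 * fps_deriv W) (m + 1) = real m * fps_nth W m"
      by (cases m) (simp_all add: fps_X_power_mult_nth)
    moreover have "fps_nth (fps_X * fps_deriv W) (m + 1) = real (m + 1) * fps_nth W (m + 1)"
      by simp
    moreover have "fps_nth (fps_X * W) (m + 1) = fps_nth W m" by simp
    ultimately show ?thesis using coeff[of "m + 1"] unfolding U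
      by (simp only: of_nat_add of_nat_1) (simp add: algebra_simps)
  qed
qed

lemma continuous_on_gegenbauer_U: "continuous_on UNIV (\<lambda>t. gegenbauer_U \<kappa> t m)"
proof (induction m rule: less_induct)
  case (less m)
  consider "m = 0" | "m = 1" | n where "m = n + 2"
    by (metis One_nat_def add_2_eq_Suc' not0_implies_Suc)
  thus ?case
  proof cases
    case 3
    have "gegenbauer_U \<kappa> t m = (2 * (real n + 1 + \<kappa>) * t * gegenbauer_U \<kappa> t (n + 1) - (real n + 2 * \<kappa>) * gegenbauer_U \<kappa> t n) / real (n + 2)" for t
      using gegenbauer_U_rec[of n \<kappa> t] 3 by (simp add: field_simps)
    thus ?thesis using less[of n] less[of "n + 1"] 3
      by (simp only:) (intro continuous_intros, auto)
  qed (auto simp: gegenbauer_U_0 gegenbauer_U_1[simplified] intro!: continuous_intros)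
qed

lemma continuous_on_norm_Gegenbauer: "continuous_on UNIV (norm_Gegenbauer \<nu> m)"
proof -
  have "norm_Gegenbauer \<nu> m = (\<lambda>t. gegenbauer_U (\<nu> + 1) t m - (if m < 2 then 0 else gegenbauer_U (\<nu> + 1) t (m - 2)))"
    by (rule ext) (rule norm_Gegenbauer_eq)
  thus ?thesis by (cases "m < 2") (auto intro!: continuous_intros continuous_on_gegenbauer_U)
qed

lemma measurable_norm_Gegenbauer [measurable]: "norm_Gegenbauer \<nu> m \<in> borel_measurable borel"
  by (rule borel_measurable_continuous_onI[OF continuous_on_norm_Gegenbauer])

text \<open>A crude bound read off the recurrence. The true growth on [-1, 1] is polynomial in m,
  but for fixed argument the Bessel factors decay faster than any geometric sequence.\<close>

lemma abs_gegenbauer_U_le: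
  assumes "\<bar>t\<bar> \<le> 1" "\<kappa> > 0"
  shows "\<bar>gegenbauer_U \<kappa> t m\<bar> \<le> (3 + 4 * \<kappa>) ^ m"
proof (induction m rule: less_induct)
  case (less m)
  consider "m = 0" | "m = 1" | n where "m = n + 2"
    by (metis One_nat_def add_2_eq_Suc' not0_implies_Suc)
  thus ?case
  proof cases
    case 2
    have "2 * \<kappa> * \<bar>t\<bar> \<le> 2 * \<kappa> * 1" using assms by (intro mult_left_mono) auto
    moreover have "\<bar>gegenbauer_U \<kappa> t m\<bar> = 2 * \<kappa> * \<bar>t\<bar>"
      unfolding 2 gegenbauer_U_1 using assms by (simp add: abs_mult)
    ultimately have "\<bar>gegenbauer_U \<kappa> t m\<bar> \<le> 3 + 4 * \<kappa>" using assms by linarith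
    thus ?thesis using 2 by simp
  next
    case 3
    let ?K = "3 + 4 * \<kappa>"
    have K: "?K \<ge> 1" using assms by simp
    have "real (n + 2) * \<bar>gegenbauer_U \<kappa> t (n + 2)\<bar> = \<bar>2 * (real n + 1 + \<kappa>) * t * gegenbauer_U \<kappa> t (n + 1) - (real n + 2 * \<kappa>) * gegenbauer_U \<kappa> t n\<bar>"
      using gegenbauer_U_rec[of n \<kappa> t] by (metis abs_mult abs_of_nat)
    also have "\<dots> \<le> \<bar>2 * (real n + 1 + \<kappa>) * t * gegenbauer_U \<kappa> t (n + 1)\<bar> + \<bar>(real n + 2 * \<kappa>) * gegenbauer_U \<kappa> t n\<bar>"
      by (rule abs_triangle_ineq4)
    also have "\<dots> = 2 * (real n + 1 + \<kappa>) * \<bar>t\<bar> * \<bar>gegenbauer_U \<kappa> t (n + 1)\<bar> + (real n + 2 * \<kappa>) * \<bar>gegenbauer_U \<kappa> t n\<bar>"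
      using assms by (simp add: abs_mult)
    also have "\<dots> \<le> 2 * (real n + 1 + \<kappa>) * 1 * ?K ^ (n + 1) + (real n + 2 * \<kappa>) * ?K ^ (n + 1)"
    proof -
      have "\<bar>gegenbauer_U \<kappa> t n\<bar> \<le> ?K ^ n" using less[of n] 3 by simp
      also have "\<dots> \<le> ?K ^ (n + 1)" using K by (intro power_increasing) auto
      finally show ?thesis using less[of "n + 1"] 3 assms
        by (intro add_mono mult_mono) auto
    qed
    also have "\<dots> = (2 * (real n + 1 + \<kappa>) + (real n + 2 * \<kappa>)) * ?K ^ (n + 1)"
      by (simp add: algebra_simps)
    \<comment> \<open>The base is chosen for this step: the coefficients sum to 3n + 2 + 4\<kappa>,
      which is at most (n + 2)(3 + 4\<kappa>).\<close>
    also have "\<dots> \<le> (real (n + 2) * ?K) * ?K ^ (n + 1)"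
    proof (rule mult_right_mono)
      have "0 \<le> real n * \<kappa>" using assms by simp
      thus "2 * (real n + 1 + \<kappa>) + (real n + 2 * \<kappa>) \<le> real (n + 2) * ?K"
        using assms by (simp add: algebra_simps)
    qed (use K in auto)
    also have "\<dots> = real (n + 2) * ?K ^ (n + 2)" by simp
    finally have "\<bar>gegenbauer_U \<kappa> t (n + 2)\<bar> \<le> ?K ^ (n + 2)"
      by (rule mult_left_le_imp_le) simp
    thus ?thesis using 3 by simp
  qed (simp add: gegenbauer_U_0)
qed

lemma abs_norm_Gegenbauer_le:
  assumes "\<bar>t\<bar> \<le> 1" "\<nu> > -1"
  shows "\<bar>norm_Gegenbauer \<nu> m t\<bar> \<le> 2 * (7 + 4 * \<nu>) ^ m"
proof -
  have K: "3 + 4 * (\<nu> + 1) = 7 + 4 * \<nu>" by simp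
  have "\<bar>gegenbauer_U (\<nu> + 1) t k\<bar> \<le> (7 + 4 * \<nu>) ^ m" if "k \<le> m" for k
  proof -
    have "\<bar>gegenbauer_U (\<nu> + 1) t k\<bar> \<le> (7 + 4 * \<nu>) ^ k"
      using abs_gegenbauer_U_le[OF assms(1), of "\<nu> + 1" k] assms(2) unfolding K by simp
    also have "\<dots> \<le> (7 + 4 * \<nu>) ^ m" using assms(2) that by (intro power_increasing) auto
    finally show ?thesis .
  qed
  from this[of m] this[of "m - 2"] show ?thesis
    unfolding norm_Gegenbauer_eq by (auto split: if_splits)
qed

section \<open>Expansion of monomials in Gegenbauer polynomials\<close>

definition geg_coeff :: "real \<Rightarrow> nat \<Rightarrow> nat \<Rightarrow> real" where
  "geg_coeff \<kappa> m j = (if m \<le> j \<and> even (j - m)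
     then (1 / 2) ^ j / (fact ((j - m) div 2) * pochhammer \<kappa> (m + (j - m) div 2)) else 0)"

text \<open>The coefficient of r^j in \<Gamma>(\<kappa>) (r/2)^m times the normalized Bessel
  function of order \<kappa> + m at r; \<open>geg_coeff\<close> is the same with order \<kappa> + m
  - 1. Both come from Gegenbauer's expansion of exp(r t) into Bessel functions times Gegenbauer
  polynomials.\<close>

definition geg_aux :: "real \<Rightarrow> nat \<Rightarrow> nat \<Rightarrow> real" where
  "geg_aux \<kappa> m j = (if m \<le> j \<and> even (j - m)
     then (1 / 2) ^ j / (fact ((j - m) div 2) * pochhammer \<kappa> (m + (j - m) div 2 + 1)) else 0)"

lemma even_diff_cases:
  fixes m j :: nat
  obtains i where "j = m + 2 * i" | "\<not> (m \<le> j \<and> even (j - m))"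
proof (cases "m \<le> j \<and> even (j - m)")
  case True
  then obtain i where "j - m = 2 * i" using evenE by blast
  with True have "j = m + 2 * i" by auto
  thus thesis by (rule that(1))
qed (rule that(2))

lemma geg_coeff_even: "geg_coeff \<kappa> m (m + 2 * i) = (1 / 2) ^ (m + 2 * i) / (fact i * pochhammer \<kappa> (m + i))"
  by (simp add: geg_coeff_def)

lemma geg_coeff_eq_0: "\<not> (m \<le> j \<and> even (j - m)) \<Longrightarrow> geg_coeff \<kappa> m j = 0"
  by (simp only: geg_coeff_def if_False)

lemma geg_aux_even: "geg_aux \<kappa> m (m + 2 * i) = (1 / 2) ^ (m + 2 * i) / (fact i * pochhammer \<kappa> (m + i + 1))"
  by (simp add: geg_aux_def)

lemma geg_aux_eq_0: "\<not> (m \<le> j \<and> even (j - m)) \<Longrightarrow> geg_aux \<kappa> m j = 0"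
  by (simp only: geg_aux_def if_False)

lemma pochhammer_neq_0_of_pos: "\<kappa> > 0 \<Longrightarrow> pochhammer \<kappa> n \<noteq> (0::real)"
  using pochhammer_pos[of \<kappa> n] by simp

text \<open>The Bessel recurrence
  \<open>I(\<mu> - 1) - I(\<mu> + 1) = (2 * \<mu> / r) * I(\<mu>)\<close> at \<mu> = \<kappa> + m,
  read coefficientwise.\<close>

lemma geg_coeff_diff:
  assumes "\<kappa> > 0"
  shows "geg_coeff \<kappa> m j - geg_coeff \<kappa> (m + 2) j = (\<kappa> + real m) * geg_aux \<kappa> m j"
proof (cases rule: even_diff_cases[where m = m and j = j])
  case (1 i)
  show ?thesis
  proof (cases i)
    case 0
    hence "geg_coeff \<kappa> (m + 2) j = 0" using 1 by (intro geg_coeff_eq_0) auto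
    moreover have "\<kappa> + real m \<noteq> 0" using assms by auto
    ultimately show ?thesis
      using 1 0 geg_coeff_even[of \<kappa> m 0] geg_aux_even[of \<kappa> m 0] pochhammer_neq_0_of_pos[OF assms, of m]
      by (simp add: pochhammer_Suc)
  next
    case (Suc i')
    have j: "j = (m + 2) + 2 * i'" using 1 Suc by simp
    have 2: "geg_coeff \<kappa> (m + 2) j = (1 / 2) ^ j / (fact i' * pochhammer \<kappa> (m + i + 1))"
      unfolding j geg_coeff_even using Suc by simp
    have 3: "geg_coeff \<kappa> m j = (1 / 2) ^ j / (fact i * pochhammer \<kappa> (m + i))"
      using 1 geg_coeff_even[of \<kappa> m i] by simp
    have 4: "geg_aux \<kappa> m j = (1 / 2) ^ j / (fact i * pochhammer \<kappa> (m + i + 1))"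
      using 1 geg_aux_even[of \<kappa> m i] by simp
    have P: "pochhammer \<kappa> (m + i + 1) = pochhammer \<kappa> (m + i) * (\<kappa> + real (m + i))"
      by (simp add: pochhammer_Suc)
    have F: "(fact i :: real) = real i * fact i'" using Suc by simp
    have "\<kappa> + real (m + i) \<noteq> 0" "real i \<noteq> 0" using assms Suc by auto
    thus ?thesis unfolding 2 3 4 P F using pochhammer_neq_0_of_pos[OF assms, of "m + i"]
      by (simp add: divide_simps)
  qed
next
  case 2
  hence 3: "\<not> (m + 2 \<le> j \<and> even (j - (m + 2)))" by auto
  show ?thesis unfolding geg_coeff_eq_0[OF 2] geg_coeff_eq_0[OF 3] geg_aux_eq_0[OF 2] by simp
qed

text \<open>The derivative in r of the series behind \<open>geg_aux\<close>, again by the Bessel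
  recurrences read coefficientwise. At M = 0 the truncated \<open>M - 1\<close> is harmless because
  it is multiplied by \<open>real M\<close>.\<close>

lemma geg_aux_rec:
  assumes "\<kappa> > 0"
  shows "(real M * geg_aux \<kappa> (M - 1) j + (real M + 2 * \<kappa>) * geg_aux \<kappa> (M + 1) j) / 2 =
         real (j + 1) * (\<kappa> + real M) * geg_aux \<kappa> M (j + 1)"
proof (cases rule: even_diff_cases[where m = M and j = "j + 1"])
  case (1 i)
  have A: "geg_aux \<kappa> M (j + 1) = (1 / 2) ^ (j + 1) / (fact i * pochhammer \<kappa> (M + i + 1))"
    unfolding 1 by (rule geg_aux_even)
  have B: "real M * geg_aux \<kappa> (M - 1) j = real M * ((1 / 2) ^ j / (fact i * pochhammer \<kappa> (M + i)))"
  proof (cases M)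
    case (Suc M')
    hence "j = M' + 2 * i" using 1 by simp
    thus ?thesis using geg_aux_even[of \<kappa> M' i] Suc by simp
  qed simp
  have P: "pochhammer \<kappa> (M + i + 1) = pochhammer \<kappa> (M + i) * (\<kappa> + real (M + i))"
    by (simp add: pochhammer_Suc)
  have nz: "\<kappa> + real (M + i) \<noteq> 0" using assms by auto
  note pp = pochhammer_neq_0_of_pos[OF assms, of "M + i"]
  show ?thesis
  proof (cases i)
    case 0
    have C: "geg_aux \<kappa> (M + 1) j = 0" using 1 0 by (intro geg_aux_eq_0) auto
    have j: "real (j + 1) = real M" using 1 0 by simp
    show ?thesis unfolding A B C P j using 0 nz pp by simp
  next
    case (Suc i')
    have j: "j = (M + 1) + 2 * i'" using 1 Suc by simp
    have C: "geg_aux \<kappa> (M + 1) j = (1 / 2) ^ j / (fact i' * pochhammer \<kappa> (M + i + 1))"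
      unfolding j geg_aux_even using Suc by simp
    have F: "(fact i :: real) = real i * fact i'" using Suc by simp
    have j': "real (j + 1) = real M + 2 * real i" using 1 by simp
    have i: "real i \<noteq> 0" using Suc by simp
    show ?thesis unfolding A B C P F j' using nz pp i
      by (simp add: divide_simps) (simp add: algebra_simps)
  qed
next
  case 2
  have A: "geg_aux \<kappa> M (j + 1) = 0" using 2 by (rule geg_aux_eq_0)
  have "real M * geg_aux \<kappa> (M - 1) j = 0"
  proof (cases M)
    case (Suc M')
    hence "\<not> (M' \<le> j \<and> even (j - M'))" using 2 by auto
    thus ?thesis using Suc by (simp add: geg_aux_eq_0)
  qed simp
  moreover have "geg_aux \<kappa> (M + 1) j = 0" using 2 by (intro geg_aux_eq_0) auto
  ultimately show ?thesis using A by simp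
qed

lemma mult_gegenbauer_U:
  assumes "\<kappa> > 0"
  shows "2 * (real m + \<kappa>) * (t * gegenbauer_U \<kappa> t m) = real (m + 1) * gegenbauer_U \<kappa> t (m + 1) +
     (if m = 0 then 0 else (real m - 1 + 2 * \<kappa>) * gegenbauer_U \<kappa> t (m - 1))"
proof (cases m)
  case 0
  thus ?thesis using gegenbauer_U_1[of \<kappa> t] by (simp add: gegenbauer_U_0)
next
  case (Suc n)
  thus ?thesis using gegenbauer_U_rec[of n \<kappa> t] by (simp add: algebra_simps)
qed

text \<open>Induction on j by multiplication with t, which sends each polynomial to its two
  neighbours; after the index shifts the coefficients match by \<open>geg_aux_rec\<close>.\<close>

lemma power_eq_sum_gegenbauer_U:
  assumes "\<kappa> > 0"
  shows "t ^ j / fact j = (\<Sum>m\<le>j. (\<kappa> + real m) * geg_aux \<kappa> m j * gegenbauer_U \<kappa> t m)"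
proof (induction j)
  case 0
  show ?case using assms geg_aux_even[of \<kappa> 0 0] by (simp add: gegenbauer_U_0)
next
  case (Suc j)
  let ?U = "gegenbauer_U \<kappa> t" and ?h = "\<lambda>m. geg_aux \<kappa> m j"
  have "real (j + 1) * (t ^ Suc j / fact (Suc j)) = t * (t ^ j / fact j)"
    by (simp add: field_simps del: of_nat_Suc)
  also have "\<dots> = (\<Sum>m\<le>j. ?h m / 2 * (2 * (real m + \<kappa>) * (t * ?U m)))"
    unfolding Suc.IH sum_distrib_left by (intro sum.cong) (auto simp: algebra_simps)
  also have "\<dots> = (\<Sum>m\<le>j. ?h m / 2 * (real (m + 1) * ?U (m + 1))) +
      (\<Sum>m\<le>j. ?h m / 2 * (if m = 0 then 0 else (real m - 1 + 2 * \<kappa>) * ?U (m - 1)))"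
    unfolding mult_gegenbauer_U[OF assms] by (simp only: ring_distribs sum.distrib)
  also have "(\<Sum>m\<le>j. ?h m / 2 * (real (m + 1) * ?U (m + 1))) = (\<Sum>M\<le>Suc j. real M * ?h (M - 1) / 2 * ?U M)"
    by (subst sum.atMost_Suc_shift) (simp add: mult_ac)
  \<comment> \<open>The two added terms vanish, since \<open>geg_aux\<close> is 0 for m > j; they
    make room for the shift m = M + 1 with M running up to j + 1.\<close>
  also have "(\<Sum>m\<le>j. ?h m / 2 * (if m = 0 then 0 else (real m - 1 + 2 * \<kappa>) * ?U (m - 1))) =
     (\<Sum>m\<le>Suc (Suc j). ?h m / 2 * (if m = 0 then 0 else (real m - 1 + 2 * \<kappa>) * ?U (m - 1)))"
    by (rule sum.mono_neutral_left) (auto simp: geg_aux_eq_0)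
  also have "\<dots> = (\<Sum>M\<le>Suc j. (real M + 2 * \<kappa>) * ?h (M + 1) / 2 * ?U M)"
    by (subst sum.atMost_Suc_shift) (simp add: mult_ac del: sum.atMost_Suc)
  also have "(\<Sum>M\<le>Suc j. real M * ?h (M - 1) / 2 * ?U M) + (\<Sum>M\<le>Suc j. (real M + 2 * \<kappa>) * ?h (M + 1) / 2 * ?U M)
     = (\<Sum>M\<le>Suc j. (real M * ?h (M - 1) + (real M + 2 * \<kappa>) * ?h (M + 1)) / 2 * ?U M)"
    by (simp only: sum.distrib[symmetric] add_divide_distrib distrib_right)
  also have "\<dots> = real (j + 1) * (\<Sum>m\<le>Suc j. (\<kappa> + real m) * geg_aux \<kappa> m (Suc j) * ?U m)"
    unfolding geg_aux_rec[OF assms] sum_distrib_left by (simp only: mult.assoc Suc_eq_plus1)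
  finally show ?case by (simp only: mult_cancel_left) simp
qed

text \<open>Summation by parts: the difference that defines the normalized polynomials is moved onto
  the coefficients, where \<open>geg_coeff_diff\<close> evaluates it.\<close>

lemma power_eq_sum_norm_Gegenbauer:
  assumes "\<kappa> > 0"
  shows "t ^ j / fact j = (\<Sum>m\<le>j. geg_coeff \<kappa> m j * norm_Gegenbauer (\<kappa> - 1) m t)"
proof -
  let ?U = "gegenbauer_U \<kappa> t" and ?f = "\<lambda>m. geg_coeff \<kappa> m j"
  let ?g = "\<lambda>m. ?f m * (if m < 2 then 0 else ?U (m - 2))"
  have "(\<Sum>m\<le>j. ?g m) = (\<Sum>m\<le>Suc (Suc j). ?g m)"
    by (rule sum.mono_neutral_left) (auto simp: geg_coeff_eq_0)
  also have "\<dots> = (\<Sum>m\<le>j. ?f (m + 2) * ?U m)"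
    by (simp only: sum.atMost_Suc_shift) simp
  finally have g: "(\<Sum>m\<le>j. ?g m) = (\<Sum>m\<le>j. ?f (m + 2) * ?U m)" .
  have "t ^ j / fact j = (\<Sum>m\<le>j. (?f m - ?f (m + 2)) * ?U m)"
    unfolding geg_coeff_diff[OF assms] by (rule power_eq_sum_gegenbauer_U[OF assms])
  also have "\<dots> = (\<Sum>m\<le>j. ?f m * ?U m) - (\<Sum>m\<le>j. ?g m)"
    unfolding g by (simp add: left_diff_distrib sum_subtractf)
  also have "\<dots> = (\<Sum>m\<le>j. ?f m * norm_Gegenbauer (\<kappa> - 1) m t)"
  proof -
    have "\<kappa> - 1 + 1 = \<kappa>" by simp
    thus ?thesis unfolding norm_Gegenbauer_eq by (simp only: right_diff_distrib sum_subtractf)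
  qed
  finally show ?thesis .
qed

section \<open>The reproducing property of zonal harmonics\<close>

lemma gauss_coeff_even: "gauss_coeff (2 * i) = (1 / 4) ^ i / fact i"
  by (simp add: gauss_coeff_def)

lemma gauss_coeff_odd: "odd n \<Longrightarrow> gauss_coeff n = 0"
  by (simp add: gauss_coeff_def)

text \<open>Vandermonde's identity at \<kappa> + m, arranged symmetrically in i and l. This is the
  shape in which two Gaussian coefficients and one expansion coefficient get multiplied.\<close>

lemma pochhammer_Vandermonde':
  fixes \<kappa> :: real
  assumes "\<kappa> > 0"
  shows "pochhammer \<kappa> (m + i + l) / (fact i * fact l * pochhammer \<kappa> (m + i) * pochhammer \<kappa> (m + l)) =
         (\<Sum>q\<le>min i l. 1 / (fact q * fact (i - q) * fact (l - q) * pochhammer \<kappa> (m + q)))"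
proof -
  note nz = pochhammer_neq_0_of_pos[OF assms]
  have P: "pochhammer (\<kappa> + real m + real q) n = pochhammer \<kappa> (m + q + n) / pochhammer \<kappa> (m + q)" for q n
    using nz[of "m + q"] pochhammer_product'[of \<kappa> "m + q" n] by (simp add: add.assoc)
  have "pochhammer \<kappa> (m + i + l) / (fact i * fact l * pochhammer \<kappa> (m + i) * pochhammer \<kappa> (m + l)) =
        (pochhammer (\<kappa> + real m + real l) i / fact i) / (fact l * pochhammer \<kappa> (m + i))"
    unfolding P by (simp add: add_ac)
  also have "\<dots> = (\<Sum>q\<le>i. real (l choose q) * (pochhammer (\<kappa> + real m + real q) (i - q) / fact (i - q))) / (fact l * pochhammer \<kappa> (m + i))"
    by (subst pochhammer_Vandermonde) (rule refl)
  also have "\<dots> = (\<Sum>q\<le>i. real (l choose q) * (pochhammer (\<kappa> + real m + real q) (i - q) / fact (i - q)) / (fact l * pochhammer \<kappa> (m + i)))"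
    by (rule sum_divide_distrib)
  also have "\<dots> = (\<Sum>q\<le>min i l. 1 / (fact q * fact (i - q) * fact (l - q) * pochhammer \<kappa> (m + q)))"
  proof (rule sum.mono_neutral_cong_right)
    fix q assume "q \<in> {..min i l}"
    hence q: "q \<le> i" "q \<le> l" by auto
    have "pochhammer (\<kappa> + real m + real q) (i - q) = pochhammer \<kappa> (m + i) / pochhammer \<kappa> (m + q)"
      unfolding P using q by simp
    moreover have "real (l choose q) = fact l / (fact q * fact (l - q))"
      using q by (simp add: binomial_fact)
    ultimately show "real (l choose q) * (pochhammer (\<kappa> + real m + real q) (i - q) / fact (i - q)) / (fact l * pochhammer \<kappa> (m + i))
       = 1 / (fact q * fact (i - q) * fact (l - q) * pochhammer \<kappa> (m + q))"
      using nz[of "m + i"] by simp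
  qed auto
  finally show ?thesis .
qed

text \<open>The key factorization: up to a Gamma factor the sum separates into a function of j times
  a function of k, and that Gamma factor is the radial one of \<open>gauss_polar\<close>. This is
  what makes the spherical moments diagonal in m.\<close>

lemma sum_gauss_coeff_geg_coeff:
  fixes \<kappa> :: real
  assumes "\<kappa> > 0"
  shows "(\<Sum>e\<le>min j k. (1 / 2) ^ e * gauss_coeff (j - e) * gauss_coeff (k - e) * geg_coeff \<kappa> m e) =
         Gamma (\<kappa> + (real j + real k) / 2) / Gamma \<kappa> * geg_coeff \<kappa> m j * geg_coeff \<kappa> m k"
proof -
  let ?F = "\<lambda>e. (1 / 2) ^ e * gauss_coeff (j - e) * gauss_coeff (k - e) * geg_coeff \<kappa> m e"
  have zero: "?F e = 0" if "e \<le> j" "e \<le> k" "\<not> (m \<le> e \<and> even (j - e) \<and> even (k - e) \<and> even (e - m))" for e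
    using that gauss_coeff_odd[of "j - e"] gauss_coeff_odd[of "k - e"] geg_coeff_eq_0[of m e \<kappa>] by auto
  show ?thesis
  proof (cases "(m \<le> j \<and> even (j - m)) \<and> (m \<le> k \<and> even (k - m))")
    case False
    have "?F e = 0" if "e \<le> min j k" for e
      using that False by (intro zero) auto
    hence "(\<Sum>e\<le>min j k. ?F e) = 0" by (intro sum.neutral) auto
    moreover have "geg_coeff \<kappa> m j * geg_coeff \<kappa> m k = 0"
      using False geg_coeff_eq_0[of m j \<kappa>] geg_coeff_eq_0[of m k \<kappa>] by auto
    ultimately show ?thesis by (simp only: mult.assoc mult_zero_right)
  next
    case True
    obtain i where j: "j = m + 2 * i" using True even_diff_cases[of j m] by metis
    obtain l where k: "k = m + 2 * l" using True even_diff_cases[of k m] by metis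
    \<comment> \<open>The expansion coefficient vanishes unless e = m + 2q.\<close>
    have "(\<Sum>e\<le>min j k. ?F e) = (\<Sum>e\<in>(\<lambda>q. m + 2 * q) ` {..min i l}. ?F e)"
    proof (rule sum.mono_neutral_right)
      show "(\<lambda>q. m + 2 * q) ` {..min i l} \<subseteq> {..min j k}" using j k by auto
      show "\<forall>e\<in>{..min j k} - (\<lambda>q. m + 2 * q) ` {..min i l}. ?F e = 0"
      proof
        fix e assume e: "e \<in> {..min j k} - (\<lambda>q. m + 2 * q) ` {..min i l}"
        have "\<not> (m \<le> e \<and> even (e - m))"
        proof
          assume "m \<le> e \<and> even (e - m)"
          then obtain q where q: "e = m + 2 * q" using even_diff_cases[of e m] by metis
          hence "q \<le> min i l" using e j k by auto
          thus False using e q by auto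
        qed
        thus "?F e = 0" using e by (intro zero) auto
      qed
    qed auto
    also have "\<dots> = (\<Sum>q\<le>min i l. ?F (m + 2 * q))"
      by (subst sum.reindex) (auto simp: inj_on_def)
    also have "\<dots> = (\<Sum>q\<le>min i l. (1 / 2) ^ (m + 2 * i) * (1 / 2) ^ (m + 2 * l) * (1 / (fact q * fact (i - q) * fact (l - q) * pochhammer \<kappa> (m + q))))"
    proof (rule sum.cong)
      fix q assume "q \<in> {..min i l}"
      hence q: "q \<le> i" "q \<le> l" by auto
      have d: "j - (m + 2 * q) = 2 * (i - q)" "k - (m + 2 * q) = 2 * (l - q)" using q j k by auto
      have "(1 / 4) ^ (i - q) = (1 / 2 :: real) ^ (2 * (i - q))" "(1 / 4) ^ (l - q) = (1 / 2 :: real) ^ (2 * (l - q))"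
        by (simp_all add: power_mult power_divide)
      \<comment> \<open>The exponents of 1/2 add up to e + (j - e) + (k - e) + e = j + k.\<close>
      moreover have "(1 / 2) ^ (m + 2 * q) * (1 / 2 :: real) ^ (2 * (i - q)) * (1 / 2) ^ (2 * (l - q)) * (1 / 2) ^ (m + 2 * q) =
          (1 / 2) ^ (m + 2 * i) * (1 / 2) ^ (m + 2 * l)"
      proof -
        have "(m + 2 * q) + 2 * (i - q) + 2 * (l - q) + (m + 2 * q) = (m + 2 * i) + (m + 2 * l)" using q by auto
        thus ?thesis by (simp only: power_add[symmetric])
      qed
      ultimately show "?F (m + 2 * q) = (1 / 2) ^ (m + 2 * i) * (1 / 2) ^ (m + 2 * l) * (1 / (fact q * fact (i - q) * fact (l - q) * pochhammer \<kappa> (m + q)))"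
        unfolding d gauss_coeff_even geg_coeff_even
        by (simp only: times_divide_eq_left times_divide_eq_right mult.assoc divide_divide_eq_left mult_1_right) (simp add: mult_ac)
    qed simp
    also have "\<dots> = (1 / 2) ^ (m + 2 * i) * (1 / 2) ^ (m + 2 * l) * (pochhammer \<kappa> (m + i + l) / (fact i * fact l * pochhammer \<kappa> (m + i) * pochhammer \<kappa> (m + l)))"
      by (simp only: pochhammer_Vandermonde'[OF assms] sum_distrib_left)
    also have "pochhammer \<kappa> (m + i + l) = Gamma (\<kappa> + (real j + real k) / 2) / Gamma \<kappa>"
    proof -
      have ni: "\<kappa> \<notin> \<int>\<^sub>\<le>\<^sub>0" using assms by (auto elim!: nonpos_Ints_cases)
      have "\<kappa> + (real j + real k) / 2 = \<kappa> + real (m + i + l)" using j k by simp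
      thus ?thesis using pochhammer_Gamma[OF ni, of "m + i + l"] by (simp only:)
    qed
    finally show ?thesis unfolding j k geg_coeff_even by (simp add: mult_ac)
  qed
qed

lemma triangular_zero:
  fixes f :: "nat \<Rightarrow> nat \<Rightarrow> real"
  assumes "\<And>j. (\<Sum>m\<le>j. f m j * x m) = 0" "\<And>j. f j j \<noteq> 0"
  shows "x m = 0"
proof (induction m rule: less_induct)
  case (less m)
  have "(\<Sum>i\<le>m. f i m * x i) = (\<Sum>i\<in>{m}. f i m * x i)"
    by (rule sum.mono_neutral_right) (use less in auto)
  thus ?case using assms(1)[of m] assms(2)[of m] by simp
qed

text \<open>The moment \<open>S j k\<close> is computed twice, from the Gaussian
  (\<open>moment\<close>, \<open>diag\<close>) and by expanding both powers (\<open>expand\<close>).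
  The results are the same bilinear combination of the claimed values and of the integrals
  \<open>A m n\<close>, so their differences solve a homogeneous system, triangular in each index
  separately.\<close>

lemma sphere_integral_Gegenbauer:
  fixes \<omega> \<zeta> :: "'a::euclidean_space"
  assumes unit: "norm \<omega> = 1" "norm \<zeta> = 1" and \<kappa>_def: "\<kappa> = real DIM('a) / 2"
  shows "sphere_integral (\<lambda>\<xi>. norm_Gegenbauer (\<kappa> - 1) m (\<omega> \<bullet> \<xi>) * norm_Gegenbauer (\<kappa> - 1) n (\<xi> \<bullet> \<zeta>)) =
         (if m = n then norm_Gegenbauer (\<kappa> - 1) m (\<omega> \<bullet> \<zeta>) else 0) * sphere_integral (\<lambda>_::'a. 1)"
proof -
  have \<kappa>: "\<kappa> > 0" using DIM_positive[where 'a='a] by (simp add: \<kappa>_def del: DIM_positive)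
  let ?C = "norm_Gegenbauer (\<kappa> - 1)" and ?f = "geg_coeff \<kappa>" and ?t = "\<omega> \<bullet> \<zeta>"
  let ?\<sigma> = "sphere_integral (\<lambda>_::'a. 1)"
  define A where "A m n = sphere_integral (\<lambda>\<xi>. ?C m (\<omega> \<bullet> \<xi>) * ?C n (\<xi> \<bullet> \<zeta>))" for m n
  define S where "S j k = sphere_integral (\<lambda>\<xi>. (\<omega> \<bullet> \<xi>) ^ j * (\<xi> \<bullet> \<zeta>) ^ k)" for j k
  have in1: "\<bar>\<omega> \<bullet> sgn y\<bar> \<le> 1" "\<bar>sgn y \<bullet> \<zeta>\<bar> \<le> 1" for y
    using Cauchy_Schwarz_ineq2[of \<omega> "sgn y"] Cauchy_Schwarz_ineq2[of "sgn y" \<zeta>] unit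
    by (auto simp: norm_sgn split: if_splits)
  have moment: "S j k * Gamma (\<kappa> + (real j + real k) / 2) = ?\<sigma> * Gamma \<kappa> * fact j * fact k *
       (\<Sum>e\<le>min j k. (?t / 2) ^ e / fact e * gauss_coeff (j - e) * gauss_coeff (k - e))" for j k
  proof -
    have "has_bochner_integral lborel (\<lambda>y. ((\<omega> \<bullet> sgn y) ^ j * (sgn y \<bullet> \<zeta>) ^ k) * (norm y ^ (j + k) * exp (- (norm y)\<^sup>2)))
           (S j k / 2 * Gamma ((real DIM('a) + real (j + k)) / 2))"
      unfolding S_def
    proof (rule gauss_polar[where C = 1])
      show "\<bar>(\<omega> \<bullet> sgn y) ^ j * (sgn y \<bullet> \<zeta>) ^ k\<bar> \<le> 1" for y
        using in1[of y] by (auto simp: abs_mult power_abs intro!: mult_le_one power_le_one)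
    qed measurable
    moreover have "((\<omega> \<bullet> sgn y) ^ j * (sgn y \<bullet> \<zeta>) ^ k) * (norm y ^ (j + k) * exp (- (norm y)\<^sup>2)) =
        (\<omega> \<bullet> y) ^ j * ((\<zeta> \<bullet> y) ^ k * exp (- (norm y)\<^sup>2))" for y
    proof -
      have y: "y = norm y *\<^sub>R sgn y" by (cases "y = 0") (auto simp: sgn_div_norm)
      have "\<omega> \<bullet> y = norm y * (\<omega> \<bullet> sgn y)" "\<zeta> \<bullet> y = norm y * (sgn y \<bullet> \<zeta>)"
        by (subst y, simp add: inner_commute)+
      thus ?thesis by (simp add: power_mult_distrib power_add mult_ac)
    qed
    ultimately have "S j k / 2 * Gamma ((real DIM('a) + real (j + k)) / 2) =
       gauss_total TYPE('a) * fact j * fact k *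
       (\<Sum>e\<le>min j k. (?t / 2) ^ e / fact e * gauss_coeff (j - e) * gauss_coeff (k - e))"
      using gauss_moments[OF unit, of j k] by (simp add: has_bochner_integral_iff)
    moreover have "(real DIM('a) + real (j + k)) / 2 = \<kappa> + (real j + real k) / 2"
      by (simp add: \<kappa>_def add_divide_distrib)
    moreover have "gauss_total TYPE('a) = ?\<sigma> / 2 * Gamma \<kappa>" by (simp add: gauss_total_eq \<kappa>_def)
    ultimately have "S j k / 2 * Gamma (\<kappa> + (real j + real k) / 2) = ?\<sigma> / 2 * Gamma \<kappa> * fact j * fact k *
       (\<Sum>e\<le>min j k. (?t / 2) ^ e / fact e * gauss_coeff (j - e) * gauss_coeff (k - e))"
      by (simp only:)
    thus ?thesis by (simp only: times_divide_eq_left divide_cancel_right) simp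
  qed
  have expand: "S j k = fact j * fact k * (\<Sum>m\<le>j. \<Sum>n\<le>k. ?f m j * ?f n k * A m n)" for j k
  proof -
    define B :: "nat \<Rightarrow> real" where "B m = 2 * (7 + 4 * (\<kappa> - 1)) ^ m" for m
    have C: "\<bar>?C m (\<omega> \<bullet> sgn y) * ?C n (sgn y \<bullet> \<zeta>)\<bar> \<le> B m * B n" for m n y
      unfolding abs_mult B_def using \<kappa> in1[of y]
      by (intro mult_mono abs_norm_Gegenbauer_le) auto
    have pow: "x ^ j = fact j * (\<Sum>m\<le>j. ?f m j * ?C m x)" for x j
      using power_eq_sum_norm_Gegenbauer[OF \<kappa>, of x j] by (simp add: field_simps)
    have "S j k = sphere_integral (\<lambda>\<xi>. \<Sum>(m,n)\<in>{..j} \<times> {..k}. (fact j * fact k * (?f m j * ?f n k)) * (?C m (\<omega> \<bullet> \<xi>) * ?C n (\<xi> \<bullet> \<zeta>)))"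
    proof -
      have "x ^ j * y ^ k = (\<Sum>(m,n)\<in>{..j} \<times> {..k}. (fact j * fact k * (?f m j * ?f n k)) * (?C m x * ?C n y))" for x y
      proof -
        have "x ^ j * y ^ k = fact j * fact k * ((\<Sum>m\<le>j. ?f m j * ?C m x) * (\<Sum>n\<le>k. ?f n k * ?C n y))"
          unfolding pow by simp
        also have "\<dots> = (\<Sum>m\<le>j. \<Sum>n\<le>k. fact j * fact k * ((?f m j * ?C m x) * (?f n k * ?C n y)))"
          by (simp only: sum_product) (simp only: sum_distrib_left)
        also have "\<dots> = (\<Sum>m\<le>j. \<Sum>n\<le>k. (fact j * fact k * (?f m j * ?f n k)) * (?C m x * ?C n y))"
          by (intro sum.cong) (simp_all add: mult_ac)
        finally show ?thesis by (simp only: sum.cartesian_product)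
      qed
      thus ?thesis unfolding S_def by (simp only:)
    qed
    also have "\<dots> = sphere_integral (\<lambda>\<xi>. \<Sum>p\<in>{..j} \<times> {..k}. (fact j * fact k * (?f (fst p) j * ?f (snd p) k)) * (?C (fst p) (\<omega> \<bullet> \<xi>) * ?C (snd p) (\<xi> \<bullet> \<zeta>)))"
      by (simp only: case_prod_unfold)
    also have "\<dots> = (\<Sum>p\<in>{..j} \<times> {..k}. sphere_integral (\<lambda>\<xi>. (fact j * fact k * (?f (fst p) j * ?f (snd p) k)) * (?C (fst p) (\<omega> \<bullet> \<xi>) * ?C (snd p) (\<xi> \<bullet> \<zeta>))))"
    proof (rule sphere_integral_sum[where C = "\<lambda>p. \<bar>fact j * fact k * (?f (fst p) j * ?f (snd p) k)\<bar> * (B (fst p) * B (snd p))"])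
      show "\<bar>(fact j * fact k * (?f (fst p) j * ?f (snd p) k)) * (?C (fst p) (\<omega> \<bullet> sgn y) * ?C (snd p) (sgn y \<bullet> \<zeta>))\<bar>
         \<le> \<bar>fact j * fact k * (?f (fst p) j * ?f (snd p) k)\<bar> * (B (fst p) * B (snd p))" for p y
        unfolding abs_mult[of "fact j * fact k * (?f (fst p) j * ?f (snd p) k)"]
        by (intro mult_left_mono C) auto
    qed (auto intro!: borel_measurable_times measurable_compose[OF _ measurable_norm_Gegenbauer])
    also have "\<dots> = (\<Sum>p\<in>{..j} \<times> {..k}. (fact j * fact k * (?f (fst p) j * ?f (snd p) k)) * A (fst p) (snd p))"
      by (simp only: sphere_integral_cmult A_def)
    also have "\<dots> = fact j * fact k * (\<Sum>p\<in>{..j} \<times> {..k}. ?f (fst p) j * ?f (snd p) k * A (fst p) (snd p))"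
      by (simp only: sum_distrib_left mult.assoc)
    also have "(\<Sum>p\<in>{..j} \<times> {..k}. ?f (fst p) j * ?f (snd p) k * A (fst p) (snd p)) = (\<Sum>m\<le>j. \<Sum>n\<le>k. ?f m j * ?f n k * A m n)"
      by (simp add: sum.cartesian_product case_prod_unfold)
    finally show ?thesis .
  qed
  \<comment> \<open>The powers of \<omega> \<bullet> \<zeta> are expanded too; summing over e by the
    factorization leaves one index m for both j and k.\<close>
  have diag: "(\<Sum>e\<le>min j k. (?t / 2) ^ e / fact e * gauss_coeff (j - e) * gauss_coeff (k - e)) =
     Gamma (\<kappa> + (real j + real k) / 2) / Gamma \<kappa> * (\<Sum>m\<le>j. \<Sum>n\<le>k. ?f m j * ?f n k * (if m = n then ?C m ?t else 0))" for j k
  proof -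
    have "(\<Sum>e\<le>min j k. (?t / 2) ^ e / fact e * gauss_coeff (j - e) * gauss_coeff (k - e)) =
        (\<Sum>e\<le>min j k. \<Sum>m\<le>min j k. (1 / 2) ^ e * gauss_coeff (j - e) * gauss_coeff (k - e) * ?f m e * ?C m ?t)"
    proof (rule sum.cong)
      fix e assume e: "e \<in> {..min j k}"
      have "(?t / 2) ^ e / fact e = (1 / 2) ^ e * (?t ^ e / fact e)" by (simp add: power_divide)
      also have "\<dots> = (1 / 2) ^ e * (\<Sum>m\<le>e. ?f m e * ?C m ?t)"
        by (simp only: power_eq_sum_norm_Gegenbauer[OF \<kappa>])
      \<comment> \<open>Padding with zero terms makes the range of m independent of e, so that the
        two sums can be swapped.\<close>
      also have "(\<Sum>m\<le>e. ?f m e * ?C m ?t) = (\<Sum>m\<le>min j k. ?f m e * ?C m ?t)"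
        using e by (intro sum.mono_neutral_left) (auto simp: geg_coeff_eq_0)
      finally show "(?t / 2) ^ e / fact e * gauss_coeff (j - e) * gauss_coeff (k - e) =
          (\<Sum>m\<le>min j k. (1 / 2) ^ e * gauss_coeff (j - e) * gauss_coeff (k - e) * ?f m e * ?C m ?t)"
        by (simp add: sum_distrib_left sum_distrib_right mult_ac)
    qed simp
    also have "\<dots> = (\<Sum>m\<le>min j k. \<Sum>e\<le>min j k. (1 / 2) ^ e * gauss_coeff (j - e) * gauss_coeff (k - e) * ?f m e * ?C m ?t)"
      by (rule sum.swap)
    also have "\<dots> = (\<Sum>m\<le>min j k. Gamma (\<kappa> + (real j + real k) / 2) / Gamma \<kappa> * ?f m j * ?f m k * ?C m ?t)"
      unfolding sum_distrib_right[symmetric] sum_gauss_coeff_geg_coeff[OF \<kappa>] ..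
    also have "\<dots> = Gamma (\<kappa> + (real j + real k) / 2) / Gamma \<kappa> * (\<Sum>m\<le>min j k. ?f m j * ?f m k * ?C m ?t)"
      by (simp only: sum_distrib_left mult.assoc)
    also have "(\<Sum>m\<le>min j k. ?f m j * ?f m k * ?C m ?t) = (\<Sum>m\<le>j. \<Sum>n\<le>k. ?f m j * ?f n k * (if m = n then ?C m ?t else 0))"
    proof -
      have "(\<Sum>n\<le>k. ?f m j * ?f n k * (if m = n then ?C m ?t else 0)) = (if m \<le> k then ?f m j * ?f m k * ?C m ?t else 0)" for m
        by (simp add: if_distrib[of "\<lambda>x. _ * x"] cong: if_cong)
      thus ?thesis by (simp only:) (rule sum.mono_neutral_cong_left, auto)
    qed
    finally show ?thesis .
  qed
  \<comment> \<open>The deviation from the claim. The system is inverted in m for fixed k, and then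
    in n for fixed m.\<close>
  define D where "D m n = A m n - (if m = n then ?C m ?t else 0) * ?\<sigma>" for m n
  have "(\<Sum>m\<le>j. \<Sum>n\<le>k. ?f m j * ?f n k * D m n) = 0" for j k
  proof -
    have G: "Gamma \<kappa> > 0" "Gamma (\<kappa> + (real j + real k) / 2) > 0" using \<kappa> by (auto intro!: Gamma_real_pos add_pos_nonneg)
    have "(\<Sum>m\<le>j. \<Sum>n\<le>k. ?f m j * ?f n k * A m n) = (\<Sum>m\<le>j. \<Sum>n\<le>k. ?f m j * ?f n k * (if m = n then ?C m ?t else 0)) * ?\<sigma>"
      using moment[of j k] G unfolding expand diag by (simp add: field_simps)
    thus ?thesis unfolding D_def
      by (simp add: right_diff_distrib sum_subtractf sum_distrib_right mult.assoc)
  qed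
  hence "(\<Sum>m\<le>j. ?f m j * (\<Sum>n\<le>k. ?f n k * D m n)) = 0" for j k
    by (simp add: sum_distrib_left mult.assoc)
  moreover have nz: "?f j j \<noteq> 0" for j
    using geg_coeff_even[of \<kappa> j 0] pochhammer_neq_0_of_pos[OF \<kappa>, of j] by simp
  ultimately have "(\<Sum>n\<le>k. ?f n k * D m n) = 0" for m k
    by (rule triangular_zero)
  from this nz have "D m n = 0" by (rule triangular_zero)
  thus ?thesis by (simp add: D_def A_def)
qed

section \<open>Convolution of kernel series\<close>

text \<open>The dimension is a real number here and is tied to a space only by the assumptions
  called \<open>dim\<close>. The last assumption is a > 2 - N.\<close>

locale deformation =
  fixes a d :: real
  assumes a_pos: "a > 0" and d_ge: "d \<ge> 1" and ad: "a + d > 2"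
begin

abbreviation \<nu> :: real where "\<nu> \<equiv> (d - 2) / 2"

definition bindex :: "nat \<Rightarrow> real" where
  "bindex m = 2 / a * (real m + \<nu>)"

text \<open>q is the product of two radii. In the end \<alpha> is -1/a^2 for the kernel
  \<open>B\<close> and 1/(a t)^2 for the heat kernel.\<close>

definition kterm :: "real \<Rightarrow> real \<Rightarrow> real \<Rightarrow> nat \<Rightarrow> real" where
  "kterm \<alpha> q \<tau> m = q ^ m * besE (bindex m) (\<alpha> * q powr a) * norm_Gegenbauer \<nu> m \<tau>"

text \<open>All complex phases sit in the coefficients; the terms themselves are real, so their
  integrals are computed over the reals.\<close>

definition kseries :: "(nat \<Rightarrow> complex) \<Rightarrow> real \<Rightarrow> real \<Rightarrow> real \<Rightarrow> complex" where
  "kseries c \<alpha> q \<tau> = (\<Sum>m. c m * of_real (kterm \<alpha> q \<tau> m))"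

lemma bindex_add: "bindex m = 2 / a * real m + bindex 0"
  using a_pos by (simp add: bindex_def field_simps)

lemma bindex_0: "bindex 0 > -1"
  using a_pos ad by (simp add: bindex_def field_simps)

lemma bindex_gt: "bindex m > -1"
proof -
  have "2 / a * real m \<ge> 0" using a_pos by simp
  with bindex_0 show ?thesis unfolding bindex_add[of m] by linarith
qed

text \<open>Choosing \<open>R\<close> in \<open>besE_bound\<close> of the size of the square root of the argument keeps the growth of order
  \<open>exp (D * q powr (a / 2))\<close>, which the weight \<open>exp (- p * q powr a)\<close> absorbs.\<close>

lemma kterm_bound:
  assumes "K > 0"
  obtains C D where "C \<ge> 0" "D \<ge> 0"
    "\<And>m q \<tau>. q \<ge> 0 \<Longrightarrow> \<bar>\<tau>\<bar> \<le> 1 \<Longrightarrow> K ^ m * \<bar>kterm \<alpha> q \<tau> m\<bar> \<le> C * exp (D * q powr (a / 2)) * (1 / 2) ^ m"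
proof -
  define L where "L = 7 + 4 * \<nu>"
  have L: "L > 0" using d_ge by (simp add: L_def field_simps)
  \<comment> \<open>With R = M * Q the Bessel factor decays like (2KL + 1)^(-m), against the growth
    (KL)^m of the other factors; the quotient is at most 1/2.\<close>
  define M where "M = (2 * K * L + 1) powr (a / 2)"
  have KL: "K * L > 0" using assms L by simp
  have M1: "M \<ge> 1" unfolding M_def using KL a_pos by (intro ge_one_powr_ge_zero) auto
  have Mb: "M powr (2 / a) = 2 * K * L + 1" unfolding M_def using KL a_pos by (simp add: powr_powr)
  \<comment> \<open>With this B, Q = B (1 + x) dominates x, hence q through
    \<open>Q powr (2 / a)\<close>, as well as \<open>sqrt |\<alpha>| * x\<close>, hence the argument
    of \<open>besE\<close>.\<close>
  define B where "B = 1 + sqrt \<bar>\<alpha>\<bar>"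
  have B: "B \<ge> 1" by (simp add: B_def)
  define C where "C = 2 * exp (3 + (2 * M + 1) * B)"
  define D where "D = (2 * M + 1) * B"
  show thesis
  proof (rule that[of C D])
    show "C \<ge> 0" by (simp add: C_def)
    show "D \<ge> 0" using M1 B by (simp add: D_def)
    fix m :: nat and q \<tau> :: real
    assume q: "q \<ge> 0" and \<tau>: "\<bar>\<tau>\<bar> \<le> 1"
    define x where "x = q powr (a / 2)"
    have x: "x \<ge> 0" by (simp add: x_def)
    define Q where "Q = B * (1 + x)"
    have Qx: "x \<le> Q"
    proof -
      have "1 * (1 + x) \<le> B * (1 + x)" using B x by (intro mult_right_mono) auto
      thus ?thesis by (simp add: Q_def)
    qed
    have Q: "Q > 0" unfolding Q_def using B x by (intro mult_pos_pos) auto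
    have qa: "q powr a = x\<^sup>2" using powr_powr[of q "a / 2" 2] by (simp add: x_def)
    have "sqrt \<bar>\<alpha>\<bar> * x \<le> Q"
      unfolding Q_def B_def using x by (intro mult_mono) auto
    hence "(sqrt \<bar>\<alpha>\<bar> * x)\<^sup>2 \<le> Q\<^sup>2" using x by (intro power_mono) auto
    hence v: "\<bar>\<alpha> * q powr a\<bar> \<le> Q\<^sup>2" by (simp add: qa power_mult_distrib abs_mult)
    have "q = x powr (2 / a)" using q a_pos by (simp add: x_def powr_powr)
    also have "\<dots> \<le> Q powr (2 / a)" using Qx x a_pos by (intro powr_mono2) auto
    finally have qQ: "q \<le> Q powr (2 / a)" .
    have MQ: "M * Q \<ge> Q" using mult_right_mono[OF M1, of Q] Q by simp
    have idx: "2 / a * real m + (bindex 0 + 1) - 1 = bindex m" using bindex_add[of m] by simp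
    have "\<bar>besE (bindex m) (\<alpha> * q powr a)\<bar> \<le> besE (bindex m) \<bar>\<alpha> * q powr a\<bar>"
      by (rule abs_besE_le[OF bindex_gt])
    also have "\<dots> \<le> exp (2 * (M * Q) + 3 + Q) * (M * Q) powr (- (2 / a * real m))"
      using besE_bound[of "bindex 0 + 1" "2 / a * real m" Q "M * Q" "\<alpha> * q powr a"] bindex_0 a_pos Q MQ v
      unfolding idx by simp
    finally have b1: "\<bar>besE (bindex m) (\<alpha> * q powr a)\<bar> \<le> exp (2 * (M * Q) + 3 + Q) * (M * Q) powr (- (2 / a * real m))" .
    have b2: "\<bar>norm_Gegenbauer \<nu> m \<tau>\<bar> \<le> 2 * L ^ m"
      unfolding L_def using \<tau> d_ge by (intro abs_norm_Gegenbauer_le) auto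
    have b3: "q ^ m \<le> (Q powr (2 / a)) ^ m" using q qQ by (intro power_mono) auto
    \<comment> \<open>The power of Q split off here cancels the bound for \<open>q ^ m\<close>, so
      that q survives only in the exponential.\<close>
    have MQ': "(M * Q) powr (- (2 / a * real m)) = 1 / ((2 * K * L + 1) ^ m * (Q powr (2 / a)) ^ m)"
    proof -
      have "(M * Q) powr (2 / a * real m) = ((M * Q) powr (2 / a)) ^ m"
        using M1 Q by (simp add: powr_powr flip: powr_realpow)
      also have "(M * Q) powr (2 / a) = (2 * K * L + 1) * Q powr (2 / a)"
        using M1 Q Mb by (simp add: powr_mult)
      finally show ?thesis by (simp add: powr_minus power_mult_distrib inverse_eq_divide)
    qed
    have "K ^ m * \<bar>kterm \<alpha> q \<tau> m\<bar> = K ^ m * (q ^ m * \<bar>besE (bindex m) (\<alpha> * q powr a)\<bar> * \<bar>norm_Gegenbauer \<nu> m \<tau>\<bar>)"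
      using q by (simp add: kterm_def abs_mult)
    also have "\<dots> \<le> K ^ m * ((Q powr (2 / a)) ^ m * (exp (2 * (M * Q) + 3 + Q) * (M * Q) powr (- (2 / a * real m))) * (2 * L ^ m))"
      using assms q by (intro mult_left_mono mult_mono b1 b2 b3) auto
    also have "\<dots> = 2 * exp (2 * (M * Q) + 3 + Q) * ((K * L) / (2 * K * L + 1)) ^ m"
      unfolding MQ' using Q by (simp add: power_divide power_mult_distrib)
    also have "\<dots> \<le> 2 * exp (2 * (M * Q) + 3 + Q) * (1 / 2) ^ m"
      using KL by (intro mult_left_mono power_mono) (auto simp: divide_simps)
    also have "2 * (M * Q) + 3 + Q = (3 + (2 * M + 1) * B) + D * x"
      by (simp add: Q_def D_def algebra_simps)
    finally show "K ^ m * \<bar>kterm \<alpha> q \<tau> m\<bar> \<le> C * exp (D * q powr (a / 2)) * (1 / 2) ^ m"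
      by (simp add: C_def x_def exp_add mult.assoc)
  qed
qed

text \<open>The constants are uniform in q, \<tau> and the number M of terms, as dominated
  convergence requires.\<close>

lemma
  fixes c :: "nat \<Rightarrow> complex"
  assumes "K > 0" and c: "\<And>m. norm (c m) \<le> K ^ m"
  shows kseries_partial_sum_bound: "\<exists>C D. C \<ge> 0 \<and> D \<ge> 0 \<and> (\<forall>q \<tau> M. q \<ge> 0 \<longrightarrow> \<bar>\<tau>\<bar> \<le> 1 \<longrightarrow>
      norm (\<Sum>m<M. c m * of_real (kterm \<alpha> q \<tau> m)) \<le> C * exp (D * q powr (a / 2)))"
    and summable_kseries: "q \<ge> 0 \<Longrightarrow> \<bar>\<tau>\<bar> \<le> 1 \<Longrightarrow> summable (\<lambda>m. c m * of_real (kterm \<alpha> q \<tau> m))"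
proof -
  obtain C D where CD: "C \<ge> 0" "D \<ge> 0"
    and bd: "\<And>m q \<tau>. q \<ge> 0 \<Longrightarrow> \<bar>\<tau>\<bar> \<le> 1 \<Longrightarrow> K ^ m * \<bar>kterm \<alpha> q \<tau> m\<bar> \<le> C * exp (D * q powr (a / 2)) * (1 / 2) ^ m"
    using kterm_bound[OF assms(1)] by metis
  have tb: "norm (c m * of_real (kterm \<alpha> q \<tau> m)) \<le> C * exp (D * q powr (a / 2)) * (1 / 2) ^ m"
    if "q \<ge> 0" "\<bar>\<tau>\<bar> \<le> 1" for m q \<tau>
  proof -
    have "norm (c m * of_real (kterm \<alpha> q \<tau> m)) \<le> K ^ m * \<bar>kterm \<alpha> q \<tau> m\<bar>"
      unfolding norm_mult norm_of_real by (intro mult_right_mono c) auto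
    also note bd[OF that]
    finally show ?thesis .
  qed
  have geo: "(\<lambda>m. C * exp (D * q powr (a / 2)) * (1 / 2) ^ m) sums (C * exp (D * q powr (a / 2)) * 2)" for q
    using sums_mult[OF geometric_sums[of "1 / 2 :: real"]] by simp
  show "summable (\<lambda>m. c m * of_real (kterm \<alpha> q \<tau> m))" if "q \<ge> 0" "\<bar>\<tau>\<bar> \<le> 1"
    using tb[OF that] by (intro summable_comparison_test'[OF sums_summable[OF geo[of q]]]) auto
  have "norm (\<Sum>m<M. c m * of_real (kterm \<alpha> q \<tau> m)) \<le> (2 * C) * exp (D * q powr (a / 2))"
    if "q \<ge> 0" "\<bar>\<tau>\<bar> \<le> 1" for q \<tau> M
  proof -
    have "norm (\<Sum>m<M. c m * of_real (kterm \<alpha> q \<tau> m)) \<le> (\<Sum>m<M. C * exp (D * q powr (a / 2)) * (1 / 2) ^ m)"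
      by (rule order_trans[OF norm_sum sum_mono]) (rule tb[OF that])
    also have "\<dots> \<le> (\<Sum>m. C * exp (D * q powr (a / 2)) * (1 / 2) ^ m)"
      using CD by (intro sum_le_suminf sums_summable[OF geo[of q]]) auto
    also have "\<dots> = (2 * C) * exp (D * q powr (a / 2))"
      using geo[of q] by (simp add: sums_iff)
    finally show ?thesis .
  qed
  moreover have "2 * C \<ge> 0" using CD by simp
  ultimately show "\<exists>C D. C \<ge> 0 \<and> D \<ge> 0 \<and> (\<forall>q \<tau> M. q \<ge> 0 \<longrightarrow> \<bar>\<tau>\<bar> \<le> 1 \<longrightarrow>
      norm (\<Sum>m<M. c m * of_real (kterm \<alpha> q \<tau> m)) \<le> C * exp (D * q powr (a / 2)))"
    using CD(2) by blast
qed

text \<open>Under u = |y|^a the volume element contributes the exponent d/a - 1 and the weight (2 -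
  a)/a; the difference is (d - 2)/a.\<close>

lemma weight_powr: "u > 0 \<Longrightarrow> u powr (d / a - 1) / u powr ((2 - a) / a) = u powr bindex 0"
  using a_pos by (simp add: bindex_def diff_divide_distrib add_divide_distrib flip: powr_diff)

text \<open>The majorant for dominated convergence: in u = |y|^a, products of partial sums of two
  kernel series grow at most like \<open>exp (E * sqrt u)\<close>.\<close>

lemma integrable_exp_sqrt_weight:
  assumes dim: "d = real DIM('a::euclidean_space)" and "p > 0"
  shows "integrable lborel (\<lambda>y::'a. exp (E * norm y powr (a / 2)) * (exp (- p * norm y powr a) / norm y powr (2 - a)))"
proof -
  define f where "f v = exp (E * sqrt v) * (exp (- p * v) / v powr ((2 - a) / a))" for v :: real
  have [measurable]: "f \<in> borel_measurable borel" unfolding f_def[abs_def] by measurable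
  have "integrable lborel (\<lambda>u. indicator {0<..} u * (u powr bindex 0 * exp (- p * u)) * exp (E * sqrt u))"
    by (rule integrable_Gamma_weight[OF bindex_0 assms(2), where C = 1 and D = E]) auto
  also have "(\<lambda>u. indicator {0<..} u * (u powr bindex 0 * exp (- p * u)) * exp (E * sqrt u)) =
      (\<lambda>u. indicator {0<..} u * u powr (d / a - 1) * f u)"
  proof
    fix u :: real
    show "indicator {0<..} u * (u powr bindex 0 * exp (- p * u)) * exp (E * sqrt u) =
          indicator {0<..} u * u powr (d / a - 1) * f u"
      using weight_powr[of u] by (cases "u > 0") (simp_all add: f_def flip: weight_powr)
  qed
  finally obtain I where "has_bochner_integral lborel (\<lambda>u. indicator {0<..} u * u powr (d / a - 1) * f u) I"
    by (auto simp: integrable.simps)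
  hence "has_bochner_integral lborel (\<lambda>y::'a. 1 * f (norm y powr a)) (sphere_integral (\<lambda>_::'a. 1) / a * I)"
    unfolding dim using a_pos by (intro polar_integral[where C = 1]) auto
  hence "integrable lborel (\<lambda>y::'a. f (norm y powr a))"
    by (simp add: has_bochner_integral_iff)
  moreover have "sqrt (norm y powr a) = norm y powr (a / 2)" for y :: 'a
    by (simp add: powr_half_sqrt[symmetric] powr_powr)
  moreover have "(norm y powr a) powr ((2 - a) / a) = norm y powr (2 - a)" for y :: 'a
    using a_pos by (simp add: powr_powr)
  ultimately show ?thesis by (simp add: f_def)
qed

text \<open>Off the diagonal the angular factor is 0 and the radial integral only has to exist; on
  the diagonal the radial exponent equals the common order of both Bessel factors, and Weber's
  integral applies.\<close>

lemma kterm_integral: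
  fixes \<omega> \<zeta> :: "'a::euclidean_space"
  assumes dim: "d = real DIM('a)" and "p > 0" and unit: "norm \<omega> = 1" "norm \<zeta> = 1" and rs: "r \<ge> 0" "s \<ge> 0"
  shows "has_bochner_integral lborel (\<lambda>y. kterm \<alpha> (r * norm y) (\<omega> \<bullet> sgn y) m * kterm \<beta> (s * norm y) (sgn y \<bullet> \<zeta>) n
           * (exp (- p * norm y powr a) / norm y powr (2 - a)))
         (if m = n then sphere_integral (\<lambda>_::'a. 1) / a * p powr (- (bindex 0 + 1)) * exp ((\<alpha> * r powr a + \<beta> * s powr a) / p)
            * (p powr (- (2 / a * real m)) * kterm (\<alpha> * \<beta> / p\<^sup>2) (r * s) (\<omega> \<bullet> \<zeta>) m) else 0)"
proof -
  define A B where "A = \<alpha> * r powr a" and "B = \<beta> * s powr a"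
  define f where "f v = v powr (real (m + n) / a) * (besE (bindex m) (A * v) * besE (bindex n) (B * v)) * (exp (- p * v) / v powr ((2 - a) / a))" for v
  define \<phi> where "\<phi> \<xi> = norm_Gegenbauer \<nu> m (\<omega> \<bullet> \<xi>) * norm_Gegenbauer \<nu> n (\<xi> \<bullet> \<zeta>)" for \<xi>
  note [measurable] = measurable_besE[OF bindex_gt]
  have [measurable]: "f \<in> borel_measurable borel" unfolding f_def[abs_def] by measurable
  have [measurable]: "\<phi> \<in> borel_measurable borel" unfolding \<phi>_def[abs_def]
    by (auto intro!: borel_measurable_times measurable_compose[OF _ measurable_norm_Gegenbauer])
  have in1: "\<bar>\<omega> \<bullet> sgn y\<bar> \<le> 1" "\<bar>sgn y \<bullet> \<zeta>\<bar> \<le> 1" for y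
    using Cauchy_Schwarz_ineq2[of \<omega> "sgn y"] Cauchy_Schwarz_ineq2[of "sgn y" \<zeta>] unit
    by (auto simp: norm_sgn split: if_splits)
  have \<phi>_bd: "\<bar>\<phi> (sgn y)\<bar> \<le> (2 * (7 + 4 * \<nu>) ^ m) * (2 * (7 + 4 * \<nu>) ^ n)" for y
  proof -
    have "7 + 4 * \<nu> \<ge> 0" using d_ge by (simp add: field_simps)
    thus ?thesis unfolding \<phi>_def abs_mult using in1[of y] d_ge
      by (intro mult_mono abs_norm_Gegenbauer_le) (auto intro!: mult_nonneg_nonneg zero_le_power simp del: times_divide_eq_right)
  qed
  have sph: "sphere_integral \<phi> = (if m = n then norm_Gegenbauer \<nu> m (\<omega> \<bullet> \<zeta>) else 0) * sphere_integral (\<lambda>_::'a. 1)"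
  proof -
    have eq: "d / 2 - 1 = \<nu>" by (simp add: field_simps)
    have "d / 2 = real DIM('a) / 2" by (simp add: dim)
    from sphere_integral_Gegenbauer[OF unit this, of m n] show ?thesis
      unfolding eq \<phi>_def .
  qed
  have f_eq: "indicator {0<..} u * u powr (d / a - 1) * f u =
      indicator {0<..} u * (u powr (bindex 0 + real (m + n) / a) * exp (- p * u)) * (besE (bindex m) (A * u) * besE (bindex n) (B * u))" for u
    using weight_powr[of u] by (cases "u > 0") (simp_all add: f_def powr_add flip: weight_powr)
  have "integrable lborel (\<lambda>u. indicator {0<..} u * (u powr (bindex 0 + real (m + n) / a) * exp (- p * u)) * (besE (bindex m) (A * u) * besE (bindex n) (B * u)))"
  proof (rule integrable_Gamma_weight[where C = "exp 6 * exp 6" and D = "3 * sqrt \<bar>A\<bar> + 3 * sqrt \<bar>B\<bar>"])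
    have "0 \<le> real (m + n) / a" using a_pos by simp
    thus "- 1 < bindex 0 + real (m + n) / a" using bindex_0 by linarith
    fix u :: real assume u: "u > 0"
    have "\<bar>besE (bindex m) (A * u) * besE (bindex n) (B * u)\<bar> \<le> (exp 6 * exp (3 * sqrt \<bar>A\<bar> * sqrt u)) * (exp 6 * exp (3 * sqrt \<bar>B\<bar> * sqrt u))"
      unfolding abs_mult using u by (intro mult_mono abs_besE_le_exp_sqrt(1) bindex_gt) auto
    also have "\<dots> = exp 6 * exp 6 * exp ((3 * sqrt \<bar>A\<bar> + 3 * sqrt \<bar>B\<bar>) * sqrt u)"
      by (simp add: exp_add ring_distribs)
    finally show "\<bar>besE (bindex m) (A * u) * besE (bindex n) (B * u)\<bar> \<le> exp 6 * exp 6 * exp ((3 * sqrt \<bar>A\<bar> + 3 * sqrt \<bar>B\<bar>) * sqrt u)" .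
  next
    show "(\<lambda>u. besE (bindex m) (A * u) * besE (bindex n) (B * u)) \<in> borel_measurable borel" by measurable
  qed (rule assms(2))
  then obtain I where I: "has_bochner_integral lborel (\<lambda>u. indicator {0<..} u * u powr (d / a - 1) * f u) I"
    unfolding f_eq[symmetric] by (auto simp: integrable.simps)
  have "has_bochner_integral lborel (\<lambda>y::'a. \<phi> (sgn y) * f (norm y powr a)) (sphere_integral \<phi> / a * I)"
    using I \<phi>_bd a_pos unfolding dim by (intro polar_integral[where C = "(2 * (7 + 4 * \<nu>) ^ m) * (2 * (7 + 4 * \<nu>) ^ n)"]) (auto simp: dim)
  hence 1: "has_bochner_integral lborel (\<lambda>y::'a. r ^ m * s ^ n * (\<phi> (sgn y) * f (norm y powr a))) (r ^ m * s ^ n * (sphere_integral \<phi> / a * I))"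
    by (rule has_bochner_integral_mult_right)
  \<comment> \<open>At y = 0 both sides are 0, since \<open>0 powr x = 0\<close> and division by 0
    gives 0.\<close>
  have 2: "r ^ m * s ^ n * (\<phi> (sgn y) * f (norm y powr a)) =
      kterm \<alpha> (r * norm y) (\<omega> \<bullet> sgn y) m * kterm \<beta> (s * norm y) (sgn y \<bullet> \<zeta>) n * (exp (- p * norm y powr a) / norm y powr (2 - a))" for y
  proof (cases "y = 0")
    case False
    have "(norm y powr a) powr (real (m + n) / a) = norm y powr (a * (real (m + n) / a))"
      by (rule powr_powr)
    also have "a * (real (m + n) / a) = real (m + n)" using a_pos by simp
    also have "norm y powr real (m + n) = norm y ^ (m + n)"
      using False by (intro powr_realpow) simp
    finally have "(norm y powr a) powr (real (m + n) / a) = norm y ^ m * norm y ^ n"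
      by (simp only: power_add)
    moreover have "(norm y powr a) powr ((2 - a) / a) = norm y powr (2 - a)"
      using a_pos by (simp add: powr_powr)
    moreover have "\<alpha> * (r * norm y) powr a = A * norm y powr a" "\<beta> * (s * norm y) powr a = B * norm y powr a"
      using rs by (simp_all add: A_def B_def powr_mult)
    ultimately show ?thesis unfolding f_def \<phi>_def kterm_def
      by (simp add: power_mult_distrib mult_ac)
  qed (simp add: f_def)
  have "r ^ m * s ^ n * (sphere_integral \<phi> / a * I) = (if m = n then sphere_integral (\<lambda>_::'a. 1) / a * p powr (- (bindex 0 + 1)) * exp ((\<alpha> * r powr a + \<beta> * s powr a) / p)
            * (p powr (- (2 / a * real m)) * kterm (\<alpha> * \<beta> / p\<^sup>2) (r * s) (\<omega> \<bullet> \<zeta>) m) else 0)"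
  proof (cases "m = n")
    case True
    have "bindex 0 + real (m + n) / a = bindex m"
      using True bindex_add[of m] by (simp add: add_divide_distrib)
    hence "has_bochner_integral lborel (\<lambda>u. indicator {0<..} u * (u powr bindex m * exp (- p * u)) * (besE (bindex m) (A * u) * besE (bindex m) (B * u))) I"
      using I True unfolding f_eq by (simp only:)
    hence "I = p powr (- (bindex m + 1)) * exp ((A + B) / p) * besE (bindex m) (A * B / p\<^sup>2)"
      using Weber_integral[OF bindex_gt[of m] assms(2), of A B] by (rule has_bochner_integral_eq)
    moreover have "p powr (- (bindex m + 1)) = p powr (- (bindex 0 + 1)) * p powr (- (2 / a * real m))"
    proof -
      have "- (bindex m + 1) = - (bindex 0 + 1) + - (2 / a * real m)"
        using bindex_add[of m] by simp
      thus ?thesis by (simp only: powr_add)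
    qed
    moreover have "A * B / p\<^sup>2 = (\<alpha> * \<beta> / p\<^sup>2) * (r * s) powr a"
      using rs by (simp add: A_def B_def powr_mult)
    ultimately have I': "I = (p powr (- (bindex 0 + 1)) * p powr (- (2 / a * real m))) * exp ((A + B) / p) * besE (bindex m) ((\<alpha> * \<beta> / p\<^sup>2) * (r * s) powr a)"
      by (simp only:)
    define Z where "Z = besE (bindex m) ((\<alpha> * \<beta> / p\<^sup>2) * (r * s) powr a)"
    show ?thesis
      unfolding sph I' kterm_def True[symmetric] A_def[symmetric] B_def[symmetric] Z_def[symmetric]
      by (simp add: power_mult_distrib)
  qed (simp add: sph)
  with 1 show ?thesis unfolding 2 by simp
qed

text \<open>Both series are truncated at the same M, so each diagonal index below M occurs in the
  product and the integral is a partial sum of the resulting series. The new coefficients are again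
  geometrically bounded, so kernel series of this kind are closed under the operation.\<close>

lemma kseries_convolution:
  fixes \<omega> \<zeta> :: "'a::euclidean_space" and c e :: "nat \<Rightarrow> complex"
  assumes dim: "d = real DIM('a)" and p: "p > 0" and unit: "norm \<omega> = 1" "norm \<zeta> = 1" and rs: "r \<ge> 0" "s \<ge> 0"
    and K: "K > 0" "L > 0" "\<And>m. norm (c m) \<le> K ^ m" "\<And>m. norm (e m) \<le> L ^ m"
  shows "has_bochner_integral lborel (\<lambda>y. kseries c \<alpha> (r * norm y) (\<omega> \<bullet> sgn y) * kseries e \<beta> (s * norm y) (sgn y \<bullet> \<zeta>)
           * of_real (exp (- p * norm y powr a) / norm y powr (2 - a)))
         (of_real (sphere_integral (\<lambda>_::'a. 1) / a * p powr (- (bindex 0 + 1)) * exp ((\<alpha> * r powr a + \<beta> * s powr a) / p))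
            * kseries (\<lambda>m. c m * e m * of_real (p powr (- (2 / a * real m)))) (\<alpha> * \<beta> / p\<^sup>2) (r * s) (\<omega> \<bullet> \<zeta>))"
proof -
  define W where "W y = exp (- p * norm y powr a) / norm y powr (2 - a)" for y :: 'a
  define P where "P M y = (\<Sum>m<M. c m * of_real (kterm \<alpha> (r * norm y) (\<omega> \<bullet> sgn y) m))" for M y
  define Q where "Q M y = (\<Sum>n<M. e n * of_real (kterm \<beta> (s * norm y) (sgn y \<bullet> \<zeta>) n))" for M y
  define J where "J = sphere_integral (\<lambda>_::'a. 1) / a * p powr (- (bindex 0 + 1)) * exp ((\<alpha> * r powr a + \<beta> * s powr a) / p)"
  define g where "g m = c m * e m * of_real (p powr (- (2 / a * real m)))" for m
  let ?t = "\<lambda>m. kterm (\<alpha> * \<beta> / p\<^sup>2) (r * s) (\<omega> \<bullet> \<zeta>) m"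
  have W_nonneg: "W y \<ge> 0" for y by (simp add: W_def)
  have in1: "\<bar>\<omega> \<bullet> sgn y\<bar> \<le> 1" "\<bar>sgn y \<bullet> \<zeta>\<bar> \<le> 1" "\<bar>\<omega> \<bullet> \<zeta>\<bar> \<le> 1" for y
    using Cauchy_Schwarz_ineq2[of \<omega> "sgn y"] Cauchy_Schwarz_ineq2[of "sgn y" \<zeta>] Cauchy_Schwarz_ineq2[of \<omega> \<zeta>] unit
    by (auto simp: norm_sgn split: if_splits)
  obtain C D where CD: "C \<ge> 0" "D \<ge> 0"
    and CD3: "\<forall>q \<tau> M. q \<ge> 0 \<longrightarrow> \<bar>\<tau>\<bar> \<le> 1 \<longrightarrow> norm (\<Sum>m<M. c m * of_real (kterm \<alpha> q \<tau> m)) \<le> C * exp (D * q powr (a / 2))"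
    using kseries_partial_sum_bound[where c = c and \<alpha> = \<alpha>, OF K(1) K(3)] by blast
  obtain C' D' where CD': "C' \<ge> 0" "D' \<ge> 0"
    and CD'3: "\<forall>q \<tau> M. q \<ge> 0 \<longrightarrow> \<bar>\<tau>\<bar> \<le> 1 \<longrightarrow> norm (\<Sum>m<M. e m * of_real (kterm \<beta> q \<tau> m)) \<le> C' * exp (D' * q powr (a / 2))"
    using kseries_partial_sum_bound[where c = e and \<alpha> = \<beta>, OF K(2) K(4)] by blast
  define E where "E = D * r powr (a / 2) + D' * s powr (a / 2)"
  have dom: "norm (P M y * Q M y * of_real (W y)) \<le> C * C' * (exp (E * norm y powr (a / 2)) * W y)" for M y
  proof -
    have "norm (P M y) \<le> C * exp (D * (r * norm y) powr (a / 2))"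
      unfolding P_def using rs in1 by (intro CD3[rule_format]) auto
    moreover have "norm (Q M y) \<le> C' * exp (D' * (s * norm y) powr (a / 2))"
      unfolding Q_def using rs in1 by (intro CD'3[rule_format]) auto
    ultimately have "norm (P M y) * norm (Q M y) * W y \<le> (C * exp (D * (r * norm y) powr (a / 2))) * (C' * exp (D' * (s * norm y) powr (a / 2))) * W y"
      using W_nonneg CD CD' by (intro mult_right_mono mult_mono) auto
    also have "\<dots> = C * C' * (exp (E * norm y powr (a / 2)) * W y)"
      using rs by (simp add: E_def powr_mult exp_add ring_distribs mult_ac)
    finally show ?thesis using W_nonneg[of y] by (simp add: norm_mult)
  qed
  have "integrable lborel (\<lambda>y::'a. exp (E * norm y powr (a / 2)) * W y)"
    unfolding W_def by (rule integrable_exp_sqrt_weight[OF dim p])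
  hence int_dom: "integrable lborel (\<lambda>y::'a. C * C' * (exp (E * norm y powr (a / 2)) * W y))"
    by (rule integrable_mult_right)
  have lim: "(\<lambda>M. P M y * Q M y * of_real (W y)) \<longlonglongrightarrow>
      kseries c \<alpha> (r * norm y) (\<omega> \<bullet> sgn y) * kseries e \<beta> (s * norm y) (sgn y \<bullet> \<zeta>) * of_real (W y)" for y
    unfolding P_def Q_def kseries_def
    using rs in1
    by (intro tendsto_mult tendsto_const summable_LIMSEQ summable_kseries[where c = c, OF K(1) K(3)]
          summable_kseries[where c = e, OF K(2) K(4)]) auto
  have part: "has_bochner_integral lborel (\<lambda>y. P M y * Q M y * of_real (W y)) (of_real J * (\<Sum>m<M. g m * of_real (?t m)))" for M
  proof -
    define X where "X m n = (if m = n then J * (p powr (- (2 / a * real m)) * ?t m) else 0)" for m n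
    have tm: "has_bochner_integral lborel (\<lambda>y. kterm \<alpha> (r * norm y) (\<omega> \<bullet> sgn y) m * kterm \<beta> (s * norm y) (sgn y \<bullet> \<zeta>) n * W y) (X m n)" for m n
      unfolding X_def J_def W_def by (rule kterm_integral[OF dim p unit rs])
    have "has_bochner_integral lborel (\<lambda>y. complex_of_real (kterm \<alpha> (r * norm y) (\<omega> \<bullet> sgn y) m * kterm \<beta> (s * norm y) (sgn y \<bullet> \<zeta>) n * W y)) (of_real (X m n))" for m n
      by (rule has_bochner_integral_bounded_linear[OF bounded_linear_of_real tm])
    hence "has_bochner_integral lborel (\<lambda>y. \<Sum>m<M. \<Sum>n<M. c m * e n * complex_of_real (kterm \<alpha> (r * norm y) (\<omega> \<bullet> sgn y) m * kterm \<beta> (s * norm y) (sgn y \<bullet> \<zeta>) n * W y)) (\<Sum>m<M. \<Sum>n<M. c m * e n * of_real (X m n))"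
      by (intro has_bochner_integral_sum has_bochner_integral_mult_right)
    moreover have "(\<Sum>m<M. \<Sum>n<M. c m * e n * complex_of_real (kterm \<alpha> (r * norm y) (\<omega> \<bullet> sgn y) m * kterm \<beta> (s * norm y) (sgn y \<bullet> \<zeta>) n * W y)) = P M y * Q M y * of_real (W y)" for y
    proof -
      have "P M y * Q M y * of_real (W y) = (\<Sum>m<M. \<Sum>n<M. (c m * of_real (kterm \<alpha> (r * norm y) (\<omega> \<bullet> sgn y) m)) *
          (e n * of_real (kterm \<beta> (s * norm y) (sgn y \<bullet> \<zeta>) n))) * of_real (W y)"
        unfolding P_def Q_def by (simp only: sum_product)
      also have "\<dots> = (\<Sum>m<M. \<Sum>n<M. (c m * of_real (kterm \<alpha> (r * norm y) (\<omega> \<bullet> sgn y) m)) *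
          (e n * of_real (kterm \<beta> (s * norm y) (sgn y \<bullet> \<zeta>) n)) * of_real (W y))"
        by (simp only: sum_distrib_right)
      finally show ?thesis by (simp add: mult_ac)
    qed
    moreover have "(\<Sum>m<M. \<Sum>n<M. c m * e n * of_real (X m n)) = of_real J * (\<Sum>m<M. g m * of_real (?t m))"
    proof -
      have "(\<Sum>n<M. c m * e n * of_real (X m n)) = of_real J * (g m * of_real (?t m))" if "m < M" for m
      proof -
        have "(\<Sum>n<M. c m * e n * of_real (X m n)) = (\<Sum>n\<in>{m}. c m * e n * of_real (X m n))"
          by (rule sum.mono_neutral_right) (use that in \<open>auto simp: X_def\<close>)
        thus ?thesis by (simp add: X_def g_def mult_ac)
      qed
      thus ?thesis by (simp add: sum_distrib_left)
    qed
    ultimately show ?thesis by simp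
  qed
  have meas1: "(\<lambda>y. P M y * Q M y * of_real (W y)) \<in> borel_measurable lborel" for M
    using part[of M] by (auto simp: has_bochner_integral_iff)
  \<comment> \<open>Measurability of the full series comes from the pointwise limit of its
    truncations.\<close>
  have meas: "(\<lambda>y. kseries c \<alpha> (r * norm y) (\<omega> \<bullet> sgn y) * kseries e \<beta> (s * norm y) (sgn y \<bullet> \<zeta>) * of_real (W y)) \<in> borel_measurable lborel"
    by (rule borel_measurable_LIMSEQ_metric[OF meas1 lim])
  note dct = meas meas1 int_dom AE_I2[OF lim] AE_I2[OF dom]
  have int: "integrable lborel (\<lambda>y. kseries c \<alpha> (r * norm y) (\<omega> \<bullet> sgn y) * kseries e \<beta> (s * norm y) (sgn y \<bullet> \<zeta>) * of_real (W y))"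
    by (rule integrable_dominated_convergence[OF dct])
  have "(\<lambda>M. LINT y|lborel. P M y * Q M y * of_real (W y)) \<longlonglongrightarrow>
     (LINT y|lborel. kseries c \<alpha> (r * norm y) (\<omega> \<bullet> sgn y) * kseries e \<beta> (s * norm y) (sgn y \<bullet> \<zeta>) * of_real (W y))"
    by (rule integral_dominated_convergence[OF dct])
  also have "(\<lambda>M. LINT y|lborel. P M y * Q M y * of_real (W y)) = (\<lambda>M. of_real J * (\<Sum>m<M. g m * of_real (?t m)))"
    using part by (simp add: has_bochner_integral_iff)
  finally have lim1: "(\<lambda>M. of_real J * (\<Sum>m<M. g m * of_real (?t m))) \<longlonglongrightarrow>
     (LINT y|lborel. kseries c \<alpha> (r * norm y) (\<omega> \<bullet> sgn y) * kseries e \<beta> (s * norm y) (sgn y \<bullet> \<zeta>) * of_real (W y))" .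
  have "norm (g m) \<le> (K * L * p powr (- (2 / a))) ^ m" for m
  proof -
    have "p powr (- (2 / a * real m)) = (p powr (- (2 / a))) ^ m"
      using p by (simp add: powr_powr flip: powr_realpow)
    thus ?thesis unfolding g_def norm_mult power_mult_distrib
      using K by (intro mult_mono) (auto simp: norm_power)
  qed
  moreover have "K * L * p powr (- (2 / a)) > 0" using K p by simp
  ultimately have "summable (\<lambda>m. g m * of_real (?t m))"
    using rs in1(3) by (intro summable_kseries[where K = "K * L * p powr (- (2 / a))"]) auto
  hence "(\<lambda>M. of_real J * (\<Sum>m<M. g m * of_real (?t m))) \<longlonglongrightarrow> of_real J * kseries g (\<alpha> * \<beta> / p\<^sup>2) (r * s) (\<omega> \<bullet> \<zeta>)"
    unfolding kseries_def by (intro tendsto_mult tendsto_const summable_LIMSEQ)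
  with lim1 have "(LINT y|lborel. kseries c \<alpha> (r * norm y) (\<omega> \<bullet> sgn y) * kseries e \<beta> (s * norm y) (sgn y \<bullet> \<zeta>) * of_real (W y))
     = of_real J * kseries g (\<alpha> * \<beta> / p\<^sup>2) (r * s) (\<omega> \<bullet> \<zeta>)"
    by (rule LIMSEQ_unique)
  with int show ?thesis unfolding has_bochner_integral_iff W_def J_def g_def by blast
qed

section \<open>The deformed heat kernel\<close>

text \<open>The coefficient of \<open>q ^ m\<close> in the power 2m/a of w/2, where w/2 = -i q^(a/2)
  / a has argument -\<pi>/2.\<close>

definition kcoeff :: "nat \<Rightarrow> complex" where
  "kcoeff m = cis (- pi * real m / a) * of_real (a powr (- (2 / a * real m)))"

text \<open>The squared modulus of \<open>kcoeff m\<close> times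
  \<open>p powr (- (2 / a * m))\<close> at the rate p = t/a.\<close>

definition tcoeff :: "real \<Rightarrow> nat \<Rightarrow> complex" where
  "tcoeff t m = of_real ((a * t) powr (- (2 / a * real m)))"

lemma powr_index: "x > 0 \<Longrightarrow> x powr (- (2 / a * real m)) = (x powr (- (2 / a))) ^ m"
  by (simp add: powr_powr flip: powr_realpow)

lemma norm_kcoeff: "norm (kcoeff m) \<le> (a powr (- (2 / a))) ^ m"
  using a_pos by (simp add: kcoeff_def norm_mult flip: powr_index)

lemma norm_tcoeff: "t > 0 \<Longrightarrow> norm (tcoeff t m) \<le> ((a * t) powr (- (2 / a))) ^ m"
  using a_pos by (simp add: tcoeff_def flip: powr_index)

lemma norm_Bessel_I_eq_besE:
  assumes "\<mu> > -1" "(w / 2)\<^sup>2 = of_real v"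
  shows "norm_Bessel_I \<mu> w = of_real (besE \<mu> v)"
proof -
  have "(w / 2) ^ (2 * j) * of_real (rGamma (\<mu> + real j + 1)) / fact j = of_real (v ^ j * rGamma (\<mu> + real j + 1) / fact j)" for j
    using assms(2) by (simp add: power_mult)
  thus ?thesis unfolding norm_Bessel_I_def besE_def
    by (simp only: suminf_of_real[OF summable_besE[OF assms(1)], symmetric])
qed

text \<open>For q > 0 the number w/2 lies on the negative imaginary axis: its square is real, which
  makes the Bessel factor real, and its principal argument -\<pi>/2 yields the phases.\<close>

lemma scriptI_eq_kseries:
  assumes "q \<ge> 0"
  shows "scriptI (2 / a) \<nu> (of_real (2 * q powr (a / 2)) / (of_real a * \<i>)) \<tau> =
         of_real (Gamma (bindex 0 + 1)) * kseries kcoeff (- 1 / a\<^sup>2) q \<tau>"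
proof -
  define w :: complex where "w = of_real (2 * q powr (a / 2)) / (of_real a * \<i>)"
  define x where "x = q powr (a / 2) / a"
  have "w / 2 * (of_real a * \<i>) = of_real x * (- \<i>) * (of_real a * \<i>)"
    using a_pos by (simp add: w_def x_def)
  hence w2: "w / 2 = of_real x * (- \<i>)"
    using a_pos by (subst (asm) mult_right_cancel) auto
  have "q powr a = (q powr (a / 2))\<^sup>2" using powr_powr[of q "a / 2" 2] by simp
  hence "(w / 2)\<^sup>2 = of_real (- 1 / a\<^sup>2 * q powr a)"
    unfolding w2 by (simp add: x_def power_mult_distrib power_divide)
  hence bes: "norm_Bessel_I (2 / a * (real m + \<nu>)) w = of_real (besE (bindex m) (- 1 / a\<^sup>2 * q powr a))" for m
    using norm_Bessel_I_eq_besE[OF bindex_gt] by (simp add: bindex_def)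
  have pp: "ppow (w / 2) (2 / a * real m) = kcoeff m * of_real (q ^ m)" for m
  proof (cases "m = 0")
    case True
    thus ?thesis using a_pos by (simp add: ppow_def kcoeff_def)
  next
    case False
    show ?thesis
    \<comment> \<open>For m > 0 both sides vanish at q = 0, where no argument is available.\<close>
    proof (cases "q = 0")
      case True
      hence "w = 0" using a_pos by (simp add: w_def)
      thus ?thesis using False True a_pos by (simp add: ppow_def)
    next
      case q: False
      have x: "x > 0" using q assms a_pos by (simp add: x_def)
      have "sgn (w / 2) = cis (- (pi / 2))"
        unfolding w2 using x by (simp add: sgn_mult sgn_of_real cis.code complex_eq_iff)
      hence arg: "Arg (w / 2) = - (pi / 2)"
        by (rule cis_Arg_unique) (use pi_gt_zero in \<open>auto intro: order_trans[of _ 0]\<close>)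
      have "cmod (w / 2) = x" unfolding w2 using x by (simp add: norm_mult)
      moreover have "x powr (2 / a * real m) = q ^ m * a powr (- (2 / a * real m))"
      proof -
        have "x powr (2 / a * real m) = (q powr (a / 2)) powr (2 / a * real m) / a powr (2 / a * real m)"
          using a_pos by (simp add: x_def powr_divide)
        also have "(q powr (a / 2)) powr (2 / a * real m) = q powr real m"
          using a_pos by (simp add: powr_powr)
        also have "\<dots> = q ^ m" using q assms by (simp add: powr_realpow)
        finally show ?thesis by (simp only: powr_minus divide_inverse)
      qed
      moreover have "- (pi / 2) * (2 / a * real m) = - pi * real m / a" by simp
      moreover have "2 / a * real m \<noteq> 0" using False a_pos by simp
      ultimately show ?thesis unfolding ppow_def kcoeff_def arg
        by (simp only: if_False of_real_mult) (simp add: mult_ac)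
    qed
  qed
  have "2 / a * \<nu> + 1 = bindex 0 + 1" by (simp add: bindex_def)
  thus ?thesis unfolding scriptI_def w_def[symmetric] kseries_def bes pp kterm_def
    by (simp add: mult_ac)
qed

text \<open>The first point is given by a radius and a unit vector, not by its \<open>sgn\<close>,
  so that the origin is covered with an arbitrary direction.\<close>

lemma kernel_B_eq_kseries:
  fixes \<omega> y :: "real ^ 'n"
  assumes dim: "d = real CARD('n)" and "norm \<omega> = 1" "r \<ge> 0" "y \<noteq> 0"
  shows "kernel_B a (r *\<^sub>R \<omega>) y = of_real (Gamma (bindex 0 + 1)) * kseries kcoeff (- 1 / a\<^sup>2) (r * norm y) (\<omega> \<bullet> sgn y)"
proof -
  have "y = norm y *\<^sub>R sgn y" using assms by (simp add: sgn_div_norm)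
  hence "kernel_B a (r *\<^sub>R \<omega>) y = kernel_B a (r *\<^sub>R \<omega>) (norm y *\<^sub>R sgn y)" by simp
  also have "\<dots> = scriptI (2 / a) \<nu> (of_real (2 * (r * norm y) powr (a / 2)) / (of_real a * \<i>)) (\<omega> \<bullet> sgn y)"
    unfolding dim using assms a_pos by (intro kernel_B_polar) (auto simp: norm_sgn)
  also have "\<dots> = of_real (Gamma (bindex 0 + 1)) * kseries kcoeff (- 1 / a\<^sup>2) (r * norm y) (\<omega> \<bullet> sgn y)"
    by (rule scriptI_eq_kseries) (use assms in simp)
  finally show ?thesis .
qed

lemma cnj_kseries:
  assumes "K > 0" "\<And>m. norm (c m) \<le> K ^ m" "q \<ge> 0" "\<bar>\<tau>\<bar> \<le> 1"
  shows "cnj (kseries c \<alpha> q \<tau>) = kseries (\<lambda>m. cnj (c m)) \<alpha> q \<tau>"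
proof -
  have "(\<lambda>m. c m * of_real (kterm \<alpha> q \<tau> m)) sums kseries c \<alpha> q \<tau>"
    unfolding kseries_def by (intro summable_sums summable_kseries[OF assms(1,2)] assms)
  hence "(\<lambda>m. cnj (c m * of_real (kterm \<alpha> q \<tau> m))) sums cnj (kseries c \<alpha> q \<tau>)"
    by (simp only: sums_cnj)
  thus ?thesis unfolding kseries_def[of "\<lambda>m. cnj (c m)"] by (simp add: sums_iff)
qed

text \<open>In polar coordinates the defining integral is a Gamma integral with rate 1/a.\<close>

lemma const_c_eq:
  assumes dim: "d = real CARD('n::finite)"
  shows "const_c TYPE('n) a = 1 / (sphere_integral (\<lambda>_::real ^ 'n. 1) / a * a powr (bindex 0 + 1) * Gamma (bindex 0 + 1))"
proof -
  define f where "f v = exp (- (1 / a) * v) / v powr ((2 - a) / a)" for v :: real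
  have [measurable]: "f \<in> borel_measurable borel" unfolding f_def[abs_def] by measurable
  have eq: "indicator {0<..} u * (u powr (bindex 0 + 1 - 1) * exp (- (1 / a) * u)) = indicator {0<..} u * u powr (d / a - 1) * f u" for u :: real
    using weight_powr[of u] by (cases "u > 0") (simp_all add: f_def flip: weight_powr)
  have "has_bochner_integral lborel (\<lambda>u. indicator {0<..} u * u powr (d / a - 1) * f u) (Gamma (bindex 0 + 1) * (1 / a) powr (- (bindex 0 + 1)))"
    unfolding eq[symmetric] using a_pos bindex_0 by (intro has_bochner_integral_Gamma) auto
  hence "has_bochner_integral lborel (\<lambda>y::real ^ 'n. 1 * f (norm y powr a)) (sphere_integral (\<lambda>_::real ^ 'n. 1) / a * (Gamma (bindex 0 + 1) * (1 / a) powr (- (bindex 0 + 1))))"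
    using a_pos by (intro polar_integral[where C = 1]) (auto simp: dim)
  moreover have "1 * f (norm y powr a) = exp (- (1 / a) * norm y powr a) / norm y powr (2 - a)" for y :: "real ^ 'n"
    using a_pos by (simp add: f_def powr_powr)
  moreover have "(1 / a) powr (- e) = a powr e" for e
    using a_pos by (simp add: powr_divide powr_minus)
  ultimately show ?thesis unfolding const_c_def
    by (simp only: has_bochner_integral_integral_eq) (simp add: field_simps)
qed

text \<open>The convolution of the conjugate kernel with the kernel at rate p = t/a. Both have
  \<alpha> = -1/a^2, so the product is positive and the result is of type I; the exponential is the
  one in Weber's formula. Of the two Gamma factors contributed by the kernels,
  \<open>const_c\<close> cancels one.\<close>

lemma heat_kernel_eq:
  fixes \<omega> \<eta> :: "real ^ 'n"
  assumes dim: "d = real CARD('n)" and unit: "norm \<omega> = 1" "norm \<eta> = 1" and r: "r \<ge> 0" "\<rho> \<ge> 0" and t: "t > 0"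
  shows "heat_kernel a (r *\<^sub>R \<omega>) (\<rho> *\<^sub>R \<eta>) t =
    of_real (Gamma (bindex 0 + 1) * t powr (- (bindex 0 + 1)) * exp (- (r powr a + \<rho> powr a) / (a * t)))
      * kseries (tcoeff t) (1 / (a * t)\<^sup>2) (r * \<rho>) (\<omega> \<bullet> \<eta>)"
proof -
  let ?G = "Gamma (bindex 0 + 1)" and ?K = "a powr (- (2 / a))" and ?\<sigma> = "sphere_integral (\<lambda>_::real ^ 'n. 1)"
  have K: "?K > 0" using a_pos by simp
  have G: "?G > 0" using bindex_0 by (intro Gamma_real_pos) simp
  have in1: "\<bar>\<omega> \<bullet> sgn y\<bar> \<le> 1" for y
    using Cauchy_Schwarz_ineq2[of \<omega> "sgn y"] unit by (auto simp: norm_sgn split: if_splits)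
  define W where "W \<xi> = exp (- (t / a) * norm \<xi> powr a) / norm \<xi> powr (2 - a)" for \<xi> :: "real ^ 'n"
  define F where "F \<xi> = kseries (\<lambda>m. cnj (kcoeff m)) (- 1 / a\<^sup>2) (r * norm \<xi>) (\<omega> \<bullet> sgn \<xi>) * kseries kcoeff (- 1 / a\<^sup>2) (\<rho> * norm \<xi>) (sgn \<xi> \<bullet> \<eta>) * of_real (W \<xi>)" for \<xi> :: "real ^ 'n"
  have co: "(\<lambda>m. cnj (kcoeff m) * kcoeff m * of_real ((t / a) powr (- (2 / a * real m)))) = tcoeff t"
  proof
    fix m
    let ?s = "- (2 / a * real m)"
    have "cnj (kcoeff m) * kcoeff m = of_real ((a powr ?s)\<^sup>2)"
      by (simp add: kcoeff_def cis_cnj power2_eq_square cis_mult mult_ac)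
    moreover have "(a powr ?s)\<^sup>2 * (t / a) powr ?s = (a * t) powr ?s"
      using a_pos t by (simp add: powr_mult powr_divide power2_eq_square)
    ultimately show "cnj (kcoeff m) * kcoeff m * of_real ((t / a) powr ?s) = tcoeff t m"
      by (simp only: tcoeff_def of_real_mult[symmetric])
  qed
  have arg: "- 1 / a\<^sup>2 * (- 1 / a\<^sup>2) / (t / a)\<^sup>2 = 1 / (a * t)\<^sup>2"
    using a_pos t by (simp add: power2_eq_square divide_simps)
  have ex: "(- 1 / a\<^sup>2 * r powr a + - 1 / a\<^sup>2 * \<rho> powr a) / (t / a) = - (r powr a + \<rho> powr a) / (a * t)"
    using a_pos t by (simp add: power2_eq_square divide_simps)
  have "has_bochner_integral lborel F
      (of_real (?\<sigma> / a * (t / a) powr (- (bindex 0 + 1)) * exp (- (r powr a + \<rho> powr a) / (a * t))) * kseries (tcoeff t) (1 / (a * t)\<^sup>2) (r * \<rho>) (\<omega> \<bullet> \<eta>))"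
    unfolding F_def W_def using kseries_convolution[of "t / a" \<omega> \<eta> r \<rho> ?K ?K "\<lambda>m. cnj (kcoeff m)" kcoeff "- 1 / a\<^sup>2" "- 1 / a\<^sup>2"]
      unit r a_pos t K norm_kcoeff dim unfolding co arg ex by simp
  hence "(LINT \<xi>|lborel. F \<xi>) = of_real (?\<sigma> / a * (t / a) powr (- (bindex 0 + 1)) * exp (- (r powr a + \<rho> powr a) / (a * t))) * kseries (tcoeff t) (1 / (a * t)\<^sup>2) (r * \<rho>) (\<omega> \<bullet> \<eta>)"
    by (rule has_bochner_integral_integral_eq)
  moreover have "(LINT \<xi>|lborel. cnj (kernel_B a (r *\<^sub>R \<omega>) \<xi>) * kernel_B a (\<rho> *\<^sub>R \<eta>) \<xi> *
        of_real (exp (- (t / a) * norm \<xi> powr a)) / of_real (norm \<xi> powr (2 - a))) = of_real (?G\<^sup>2) * (LINT \<xi>|lborel. F \<xi>)"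
  proof -
    \<comment> \<open>An equality at every point: at the origin both integrands are 0 by division by
      0.\<close>
    have "of_real (?G\<^sup>2) * F \<xi> = cnj (kernel_B a (r *\<^sub>R \<omega>) \<xi>) * kernel_B a (\<rho> *\<^sub>R \<eta>) \<xi> *
        of_real (exp (- (t / a) * norm \<xi> powr a)) / of_real (norm \<xi> powr (2 - a))" for \<xi>
    proof (cases "\<xi> = 0")
      case False
      have "cnj (kernel_B a (r *\<^sub>R \<omega>) \<xi>) = of_real ?G * kseries (\<lambda>m. cnj (kcoeff m)) (- 1 / a\<^sup>2) (r * norm \<xi>) (\<omega> \<bullet> sgn \<xi>)"
        using False r unit kernel_B_eq_kseries[OF dim] cnj_kseries[OF K norm_kcoeff _ in1] by simp
      moreover have "kernel_B a (\<rho> *\<^sub>R \<eta>) \<xi> = of_real ?G * kseries kcoeff (- 1 / a\<^sup>2) (\<rho> * norm \<xi>) (sgn \<xi> \<bullet> \<eta>)"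
        using False r unit kernel_B_eq_kseries[OF dim] by (simp add: inner_commute)
      ultimately show ?thesis
        by (simp add: F_def W_def power2_eq_square mult_ac)
    qed (simp add: F_def W_def)
    hence "(LINT \<xi>|lborel. cnj (kernel_B a (r *\<^sub>R \<omega>) \<xi>) * kernel_B a (\<rho> *\<^sub>R \<eta>) \<xi> *
        of_real (exp (- (t / a) * norm \<xi> powr a)) / of_real (norm \<xi> powr (2 - a))) = (LINT \<xi>|lborel. of_real (?G\<^sup>2) * F \<xi>)"
      by (simp only:)
    thus ?thesis by simp
  qed
  ultimately have "heat_kernel a (r *\<^sub>R \<omega>) (\<rho> *\<^sub>R \<eta>) t = of_real (const_c TYPE('n) a) * (of_real (?G\<^sup>2) *
     (of_real (?\<sigma> / a * (t / a) powr (- (bindex 0 + 1)) * exp (- (r powr a + \<rho> powr a) / (a * t))) * kseries (tcoeff t) (1 / (a * t)\<^sup>2) (r * \<rho>) (\<omega> \<bullet> \<eta>)))"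
    by (simp only: heat_kernel_def)
  also have "\<dots> = of_real (const_c TYPE('n) a * (?G\<^sup>2 * (?\<sigma> / a * (t / a) powr (- (bindex 0 + 1)) * exp (- (r powr a + \<rho> powr a) / (a * t))))) * kseries (tcoeff t) (1 / (a * t)\<^sup>2) (r * \<rho>) (\<omega> \<bullet> \<eta>)"
    by (simp only: of_real_mult mult.assoc)
  also have "const_c TYPE('n) a * (?G\<^sup>2 * (?\<sigma> / a * (t / a) powr (- (bindex 0 + 1)) * exp (- (r powr a + \<rho> powr a) / (a * t)))) = ?G * t powr (- (bindex 0 + 1)) * exp (- (r powr a + \<rho> powr a) / (a * t))"
  proof -
    have scale: "(t / a) powr (- e) = t powr (- e) * a powr e" for e
      using a_pos t by (simp add: powr_divide powr_minus) (simp add: divide_inverse mult.commute)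
    have "a powr (bindex 0 + 1) > 0" using a_pos by simp
    thus ?thesis
      unfolding const_c_eq[OF dim] scale using G a_pos sphere_integral_one_pos[where 'a = "real ^ 'n"]
      by (simp add: power2_eq_square)
  qed
  finally show ?thesis .
qed

end

section \<open>Convolving two heat kernels through their closed forms\<close>

theorem corollary4p26:
  fixes a t s :: real and x z :: "real ^ 'n"
  assumes "a > max 0 (2 - real CARD('n))" and "t > 0" and "s > 0"
  shows "integrable lborel (\<lambda>y :: real ^ 'n.
           heat_kernel a x y t * heat_kernel a y z s / of_real (norm y powr (2 - a)))
    \<and> of_real (const_c TYPE('n) a) *
        (LINT y|lborel. heat_kernel a x y t * heat_kernel a y z s / of_real (norm y powr (2 - a)))
      = heat_kernel a x z (t + s)"
proof -
  interpret deformation a "real CARD('n)"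
    using assms by unfold_locales (auto simp: Suc_le_eq)
  \<comment> \<open>The origin receives an arbitrary unit vector as direction, so that the closed
    form applies to every x and z.\<close>
  have polar: "\<exists>\<omega>. norm \<omega> = 1 \<and> x = norm x *\<^sub>R \<omega>" for x :: "real ^ 'n"
  proof (cases "x = 0")
    case True
    obtain \<omega> :: "real ^ 'n" where "norm \<omega> = 1" using vector_choose_size[of 1] by auto
    thus ?thesis using True by auto
  next
    case False
    thus ?thesis by (intro exI[of _ "sgn x"]) (auto simp: norm_sgn sgn_div_norm)
  qed
  obtain \<omega> where \<omega>: "norm \<omega> = 1" "x = norm x *\<^sub>R \<omega>" using polar by blast
  obtain \<zeta> where \<zeta>: "norm \<zeta> = 1" "z = norm z *\<^sub>R \<zeta>" using polar by blast
  define R S where "R = norm x" and "S = norm z"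
  have R: "R \<ge> 0" "S \<ge> 0" by (simp_all add: R_def S_def)
  have x: "x = R *\<^sub>R \<omega>" and z: "z = S *\<^sub>R \<zeta>" using \<omega> \<zeta> by (simp_all add: R_def S_def)
  define e where "e = bindex 0 + 1"
  let ?G = "Gamma e" and ?\<sigma> = "sphere_integral (\<lambda>_::real ^ 'n. 1)"
  have G: "?G > 0" using bindex_0 unfolding e_def by (intro Gamma_real_pos) simp
  \<comment> \<open>1/(a t) + 1/(a s), the sum of the decay rates of the two heat kernels in
    |y|^a.\<close>
  define p where "p = (t + s) / (a * t * s)"
  note pos = a_pos assms(2,3)
  have p: "p > 0" using pos by (simp add: p_def)
  \<comment> \<open>All factors that do not depend on y.\<close>
  define A where "A = ?G\<^sup>2 * (t powr (- e) * s powr (- e)) * (exp (- (R powr a) / (a * t)) * exp (- (S powr a) / (a * s)))"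
  define F where "F y = kseries (tcoeff t) (1 / (a * t)\<^sup>2) (R * norm y) (\<omega> \<bullet> sgn y) * kseries (tcoeff s) (1 / (a * s)\<^sup>2) (S * norm y) (sgn y \<bullet> \<zeta>)
      * of_real (exp (- p * norm y powr a) / norm y powr (2 - a))" for y
  have integrand: "heat_kernel a x y t * heat_kernel a y z s / of_real (norm y powr (2 - a)) = of_real A * F y" for y
  proof (cases "y = 0")
    case False
    define v where "v = norm y powr a"
    have y: "y = norm y *\<^sub>R sgn y" using False by (simp add: sgn_div_norm)
    have u: "norm (sgn y) = 1" using False by (simp add: norm_sgn)
    have "heat_kernel a x y t = heat_kernel a (R *\<^sub>R \<omega>) (norm y *\<^sub>R sgn y) t" using x y by simp
    also have "\<dots> = of_real (?G * t powr (- e) * exp (- (R powr a + v) / (a * t))) * kseries (tcoeff t) (1 / (a * t)\<^sup>2) (R * norm y) (\<omega> \<bullet> sgn y)"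
      unfolding e_def v_def using R by (intro heat_kernel_eq refl \<omega> u pos) auto
    finally have 1: "heat_kernel a x y t = \<dots>" .
    have "heat_kernel a y z s = heat_kernel a (norm y *\<^sub>R sgn y) (S *\<^sub>R \<zeta>) s" using z y by simp
    also have "\<dots> = of_real (?G * s powr (- e) * exp (- (v + S powr a) / (a * s))) * kseries (tcoeff s) (1 / (a * s)\<^sup>2) (norm y * S) (sgn y \<bullet> \<zeta>)"
      unfolding e_def v_def using R by (intro heat_kernel_eq refl \<zeta> u pos) auto
    finally have 2: "heat_kernel a y z s = of_real (?G * s powr (- e) * exp (- (v + S powr a) / (a * s))) * kseries (tcoeff s) (1 / (a * s)\<^sup>2) (S * norm y) (sgn y \<bullet> \<zeta>)"
      by (simp only: mult.commute[of S])
    have "- (R powr a + v) / (a * t) + - (v + S powr a) / (a * s) = - (R powr a) / (a * t) + - (S powr a) / (a * s) + - p * v"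
      using pos by (simp add: p_def divide_simps) (simp add: algebra_simps)
    hence ex: "exp (- (R powr a + v) / (a * t)) * exp (- (v + S powr a) / (a * s)) = exp (- (R powr a) / (a * t)) * exp (- (S powr a) / (a * s)) * exp (- p * v)"
      by (simp only: exp_add[symmetric])
    have "(?G * t powr (- e) * exp (- (R powr a + v) / (a * t))) * (?G * s powr (- e) * exp (- (v + S powr a) / (a * s)))
        = ?G\<^sup>2 * (t powr (- e) * s powr (- e)) * (exp (- (R powr a + v) / (a * t)) * exp (- (v + S powr a) / (a * s)))"
      by (simp add: power2_eq_square)
    also have "\<dots> = A * exp (- p * v)" unfolding ex A_def by simp
    finally have co: "complex_of_real (?G * t powr (- e) * exp (- (R powr a + v) / (a * t))) * of_real (?G * s powr (- e) * exp (- (v + S powr a) / (a * s))) = of_real (A * exp (- p * v))"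
      by (simp only: of_real_mult[symmetric])
    define k1 k2 where "k1 = kseries (tcoeff t) (1 / (a * t)\<^sup>2) (R * norm y) (\<omega> \<bullet> sgn y)"
      and "k2 = kseries (tcoeff s) (1 / (a * s)\<^sup>2) (S * norm y) (sgn y \<bullet> \<zeta>)"
    have "heat_kernel a x y t * heat_kernel a y z s = of_real (A * exp (- p * v)) * (k1 * k2)"
      unfolding 1 2 co[symmetric] k1_def[symmetric] k2_def[symmetric] by (simp only: mult_ac)
    thus ?thesis unfolding F_def k1_def[symmetric] k2_def[symmetric] v_def[symmetric] by simp
  qed (simp add: F_def)
  \<comment> \<open>The semigroup law rests on (a t)(a s) p = a (t + s): it gives the coefficients
    here and the argument of the Bessel factors in \<open>arg\<close>.\<close>
  have co: "(\<lambda>m. tcoeff t m * tcoeff s m * of_real (p powr (- (2 / a * real m)))) = tcoeff (t + s)"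
  proof
    fix m
    have "(a * t) * (a * s) * p = a * (t + s)" using pos by (simp add: p_def field_simps)
    moreover have "(a * t) powr q * (a * s) powr q * p powr q = ((a * t) * (a * s) * p) powr q" for q
      using pos p by (simp add: powr_mult)
    ultimately show "tcoeff t m * tcoeff s m * of_real (p powr (- (2 / a * real m))) = tcoeff (t + s) m"
      unfolding tcoeff_def of_real_mult[symmetric] by (simp only:)
  qed
  have arg: "1 / (a * t)\<^sup>2 * (1 / (a * s)\<^sup>2) / p\<^sup>2 = 1 / (a * (t + s))\<^sup>2"
    using pos by (simp add: p_def power_mult_distrib power_divide)
  let ?E = "exp ((1 / (a * t)\<^sup>2 * R powr a + 1 / (a * s)\<^sup>2 * S powr a) / p)"
  have "0 < (a * t) powr (- (2 / a))" "0 < (a * s) powr (- (2 / a))" using pos by auto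
  hence conv: "has_bochner_integral lborel F (of_real (?\<sigma> / a * p powr (- e) * ?E) * kseries (tcoeff (t + s)) (1 / (a * (t + s))\<^sup>2) (R * S) (\<omega> \<bullet> \<zeta>))"
    using kseries_convolution[where \<omega> = \<omega> and \<zeta> = \<zeta> and r = R and s = S and p = p and c = "tcoeff t" and e = "tcoeff s"
        and K = "(a * t) powr (- (2 / a))" and L = "(a * s) powr (- (2 / a))" and \<alpha> = "1 / (a * t)\<^sup>2" and \<beta> = "1 / (a * s)\<^sup>2"]
      p \<omega>(1) \<zeta>(1) R norm_tcoeff pos unfolding co arg F_def[symmetric] e_def[symmetric] by simp
  have "const_c TYPE('n) a * (A * (?\<sigma> / a * p powr (- e) * ?E)) = ?G * (t + s) powr (- e) * exp (- (R powr a + S powr a) / (a * (t + s)))"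
  proof -
    have c: "const_c TYPE('n) a = 1 / (?\<sigma> / a * a powr e * ?G)"
      unfolding e_def by (rule const_c_eq) simp
    have "a * t * s * p = t + s" using pos by (simp add: p_def)
    moreover have "a powr (- e) * t powr (- e) * s powr (- e) * p powr (- e) = (a * t * s * p) powr (- e)"
      using pos p by (simp add: powr_mult)
    ultimately have "(t + s) powr (- e) = t powr (- e) * s powr (- e) * p powr (- e) / a powr e"
      by (simp add: powr_minus divide_inverse mult_ac)
    \<comment> \<open>Weber's exponential corrects the rates: 1/((a t)^2 p) = s/(a t (t + s)), and
      subtracting this from 1/(a t) leaves 1/(a (t + s)); likewise for S.\<close>
    moreover have "- (R powr a) / (a * t) + - (S powr a) / (a * s) + (1 / (a * t)\<^sup>2 * R powr a + 1 / (a * s)\<^sup>2 * S powr a) / p = - (R powr a + S powr a) / (a * (t + s))"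
      using pos by (simp add: p_def divide_simps power2_eq_square) (simp add: algebra_simps)
    hence "exp (- (R powr a) / (a * t)) * exp (- (S powr a) / (a * s)) * ?E = exp (- (R powr a + S powr a) / (a * (t + s)))"
      by (simp only: exp_add[symmetric])
    moreover have "1 / (?\<sigma> / a * a powr e * ?G) * (A * (?\<sigma> / a * p powr (- e) * ?E))
      = ?G * (t powr (- e) * s powr (- e) * p powr (- e) / a powr e) * (exp (- (R powr a) / (a * t)) * exp (- (S powr a) / (a * s)) * ?E)"
      unfolding A_def using G pos sphere_integral_one_pos[where 'a = "real ^ 'n"]
      by (simp add: power2_eq_square)
    ultimately show ?thesis unfolding c by (simp only:)
  qed
  hence val: "complex_of_real (const_c TYPE('n) a) * (of_real A * (of_real (?\<sigma> / a * p powr (- e) * ?E) * k)) =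
      of_real (?G * (t + s) powr (- e) * exp (- (R powr a + S powr a) / (a * (t + s)))) * k" for k
    by (simp only: of_real_mult[symmetric] mult.assoc[symmetric])
  have "has_bochner_integral lborel (\<lambda>y. of_real A * F y) (of_real A * (of_real (?\<sigma> / a * p powr (- e) * ?E) * kseries (tcoeff (t + s)) (1 / (a * (t + s))\<^sup>2) (R * S) (\<omega> \<bullet> \<zeta>)))"
    by (rule has_bochner_integral_mult_right[OF conv])
  moreover have "heat_kernel a x z (t + s) = of_real (?G * (t + s) powr (- e) * exp (- (R powr a + S powr a) / (a * (t + s)))) * kseries (tcoeff (t + s)) (1 / (a * (t + s))\<^sup>2) (R * S) (\<omega> \<bullet> \<zeta>)"
    unfolding x z e_def using pos by (intro heat_kernel_eq refl \<omega> \<zeta> R) auto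
  ultimately show ?thesis unfolding integrand has_bochner_integral_iff by (simp only: val simp_thms)
qed

end
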